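(* Fix $\beta\ge1$. There exist $\alpha\in(0,1)$, depending only on $\beta$, and a constant $C_{\alpha,\beta}>0$, depending only on $\alpha$ and $\beta$, such that the following holds. Let $(\xi_i)_{1\le i\le n}$ be a sequence of independent random variables in a sublinear expectation space $(\Omega,\mathcal{H},\hat{\mathbf{E}})$ such that for each $1\le i\le n$: $\hat{\mathbf{E}}[\xi_i]=\hat{\mathbf{E}}[-\xi_i]=0$; the numbers $\overline{\sigma}_i^2:=\hat{\mathbf{E}}[\xi_i^2]$ and $\underline{\sigma}_i^2:=-\hat{\mathbf{E}}[-\xi_i^2]$ satisfy $\infty>\overline{\sigma}_i\ge\underline{\sigma}_i>0$ and $\overline{\sigma}_i/\underline{\sigma}_i=\beta$; and put $\sigma_i:=\frac{\overline{\sigma}_i+\underline{\sigma}_i}{2}$. Let $W:=\xi_1+\cdots+\xi_n$ and $\sigma:=\big(\sum_{i=1}^n\sigma_i^2\big)^{1/2}$. Then $$\sup_{\varphi\in C_{b,Lip}(\mathbb{R}),\ |\varphi|_{Lip}\le1}\Big|\hat{\mathbf{E}}\Big[\varphi\Big(\frac{W}{\sigma}\Big)\Big]-\mathcal{N}_\beta[\varphi]\Big|\le C_{\alpha,\beta}\sup_{1\le i\le n}\Big\{\frac{\hat{\mathbf{E}}[|\xi_i|^{2+\alpha}]}{\sigma_i^{2+\alpha}}\Big(\frac{\sigma_i}{\sigma}\Big)^\alpha\Big\}.$$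
   Context: $C_{b,Lip}(\mathbb{R}^m)$ is the set of bounded Lipschitz functions on $\mathbb{R}^m$; $|\varphi|_{Lip}$ is the Lipschitz constant of $\varphi$; $a^+=\max(a,0)$, $a^-=\max(-a,0)$. Sublinear expectation space: $\Omega$ is a set, $\mathcal{H}$ is a linear space of real functions on $\Omega$ (the random variables) such that $\varphi(X_1,\dots,X_m)\in\mathcal{H}$ whenever $X_1,\dots,X_m\in\mathcal{H}$ and $\varphi\in C_{b,Lip}(\mathbb{R}^m)$, and $\hat{\mathbf{E}}:\mathcal{H}\to\mathbb{R}$ satisfies: (E1) $\hat{\mathbf{E}}[X]\ge\hat{\mathbf{E}}[Y]$ if $X\ge Y$; (E2) $\hat{\mathbf{E}}[\lambda X]=\lambda\hat{\mathbf{E}}[X]$ for $\lambda\ge0$; (E3) $\hat{\mathbf{E}}[c]=c$ for $c\in\mathbb{R}$; (E4) $\hat{\mathbf{E}}[X+Y]\le\hat{\mathbf{E}}[X]+\hat{\mathbf{E}}[Y]$; (E5) $\hat{\mathbf{E}}[\varphi_n(X)]\downarrow0$ for $X\in\mathcal{H}$ and $\varphi_n\in C_{b,Lip}(\mathbb{R})$ with $\varphi_n\downarrow0$. For each $X\in\mathcal{H}$ there is a weakly compact set $\Theta$ of probability measures on $(\mathbb{R},\mathcal{B}(\mathbb{R}))$ with $\hat{\mathbf{E}}[\varphi(X)]=\sup_{\mu\in\Theta}\int\varphi\,d\mu$ for all $\varphi\in C_{b,Lip}(\mathbb{R})$; expectations of unbounded functions of $X$ (such as $X$, $-X$, $\pm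 X^2$, $|X|^{2+\alpha}$) are understood as $\hat{\mathbf{E}}[\psi(X)]=\sup_{\mu\in\Theta}\int\psi\,d\mu$ (the value $+\infty$ being allowed for $\hat{\mathbf{E}}[|\xi_i|^{2+\alpha}]$). Independence: a random vector $\mathbf{X}\in\mathcal{H}^m$ is independent from $\mathbf{Y}\in\mathcal{H}^k$ if $\hat{\mathbf{E}}[\varphi(\mathbf{Y},\mathbf{X})]=\hat{\mathbf{E}}\big[\hat{\mathbf{E}}[\varphi(\mathbf{y},\mathbf{X})]|_{\mathbf{y}=\mathbf{Y}}\big]$ for all $\varphi\in C_{b,Lip}(\mathbb{R}^{k+m})$ (this relation is not symmetric). $(\xi_i)_{1\le i\le n}$ is a sequence of independent random variables if $\xi_{i+1}$ is independent from $(\xi_1,\dots,\xi_i)$ for every $1\le i<n$. The distribution $\mathcal{N}_\beta$: let $G_\beta(a)=\frac12(\overline{\sigma}^2a^+-\underline{\sigma}^2a^-)$ with $\underline{\sigma}=\frac{2}{1+\beta}$ and $\overline{\sigma}=\frac{2\beta}{1+\beta}$ (so $\overline\sigma/\underline\sigma=\beta$ and $(\overline\sigma+\underline\sigma)/2=1$). For $\varphi\in C_{b,Lip}(\mathbb{R})$, let $u$ be the unique bounded solution (viscosity, in fact classical) of $\partial_tu-G_\beta(D_x^2u)=0$ on $\mathbb{R}\times(0,\infty)$, $u(x,0)=\varphi(x)$. Then $\mathcal{N}_\beta[\varphi]:=u(0,1)$; more generally $u(x,t)=\mathcal{N}_\beta[\varphi(x+\sqrt t\,\cdot)]$. *)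

theory Defs
  imports "HOL-Probability.Probability"
begin

section \<open>Bounded Lipschitz functions\<close>

definition CbLip :: "(real \<Rightarrow> real) set" where
  "CbLip = {\<phi>. bounded (range \<phi>) \<and> (\<exists>L. L-lipschitz_on UNIV \<phi>)}"

text \<open>A function on the m-dimensional Euclidean space is a function of \<open>v :: nat \<Rightarrow> real\<close> that
  only depends on the coordinates \<open>v 0, \<dots>, v (m - 1)\<close>; the Lipschitz condition below already
  forces this.\<close>

definition CbLip_n :: "nat \<Rightarrow> ((nat \<Rightarrow> real) \<Rightarrow> real) set" where
  "CbLip_n m = {\<phi>. bounded (range \<phi>) \<and>
     (\<exists>L. \<forall>v w. \<bar>\<phi> v - \<phi> w\<bar> \<le> L * L2_set (\<lambda>i. v i - w i) {..<m})}"

section \<open>Sublinear expectation spaces\<close>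

text \<open>Random variables on \<open>\<Omega>\<close> are represented by total functions; their values outside
  \<open>\<Omega>\<close> are irrelevant by \<open>E1\<close>.\<close>

locale sublinear_expectation_space =
  fixes \<Omega> :: "'w set" and H :: "('w \<Rightarrow> real) set" and E :: "('w \<Rightarrow> real) \<Rightarrow> real"
  assumes H_zero: "(\<lambda>_. 0) \<in> H"
    and H_add: "X \<in> H \<Longrightarrow> Y \<in> H \<Longrightarrow> (\<lambda>\<omega>. X \<omega> + Y \<omega>) \<in> H"
    and H_scale: "X \<in> H \<Longrightarrow> (\<lambda>\<omega>. c * X \<omega>) \<in> H"
    and H_CbLip: "(\<And>i. i < m \<Longrightarrow> Xs i \<in> H) \<Longrightarrow> \<phi> \<in> CbLip_n m \<Longrightarrow> (\<lambda>\<omega>. \<phi> (\<lambda>i. Xs i \<omega>)) \<in> H"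
    and E1: "X \<in> H \<Longrightarrow> Y \<in> H \<Longrightarrow> (\<And>\<omega>. \<omega> \<in> \<Omega> \<Longrightarrow> Y \<omega> \<le> X \<omega>) \<Longrightarrow> E Y \<le> E X"
    and E2: "X \<in> H \<Longrightarrow> 0 \<le> c \<Longrightarrow> E (\<lambda>\<omega>. c * X \<omega>) = c * E X"
    and E3: "E (\<lambda>_. c) = c"
    and E4: "X \<in> H \<Longrightarrow> Y \<in> H \<Longrightarrow> E (\<lambda>\<omega>. X \<omega> + Y \<omega>) \<le> E X + E Y"
    and E5: "X \<in> H \<Longrightarrow> (\<And>k. f k \<in> CbLip) \<Longrightarrow> (\<And>x. decseq (\<lambda>k. f k x)) \<Longrightarrow>
      (\<And>x. (\<lambda>k. f k x) \<longlonglongrightarrow> 0) \<Longrightarrow>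
      decseq (\<lambda>k. E (\<lambda>\<omega>. f k (X \<omega>))) \<and> (\<lambda>k. E (\<lambda>\<omega>. f k (X \<omega>))) \<longlonglongrightarrow> 0"

definition weak_topology :: "real measure topology" where
  "weak_topology = topology_generated_by
     {{\<mu>. prob_space \<mu> \<and> sets \<mu> = sets borel \<and> (\<integral>x. f x \<partial>\<mu>) \<in> U}
        | (f :: real \<Rightarrow> real) (U :: real set).
        continuous_on UNIV f \<and> bounded (range f) \<and> open U}"

definition represents :: "(('w \<Rightarrow> real) \<Rightarrow> real) \<Rightarrow> ('w \<Rightarrow> real) \<Rightarrow> real measure set \<Rightarrow> bool" where
  "represents E X \<Theta> \<longleftrightarrow> \<Theta> \<noteq> {} \<and> compactin weak_topology \<Theta> \<and>
     (\<forall>\<phi>\<in>CbLip. E (\<lambda>\<omega>. \<phi> (X \<omega>)) = (SUP \<mu>\<in>\<Theta>. \<integral>x. \<phi> x \<partial>\<mu>))"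

text \<open>The integral of the positive part minus that of the negative part. Unlike the Bochner
  integral it does not turn divergent integrals into 0.\<close>

definition ext_integral :: "real measure \<Rightarrow> (real \<Rightarrow> real) \<Rightarrow> ereal" where
  "ext_integral \<mu> \<psi> =
     enn2ereal (\<integral>\<^sup>+x. ennreal (\<psi> x) \<partial>\<mu>) - enn2ereal (\<integral>\<^sup>+x. ennreal (- \<psi> x) \<partial>\<mu>)"

text \<open>\<open>upper_exp E X \<psi>\<close> is the upper expectation of \<open>\<psi>(X)\<close> for possibly unbounded \<open>\<psi>\<close>.
  A representing set exists for every \<open>X \<in> H\<close>. It is not unique, but the value
  does not depend on the choice for \<open>\<psi>\<close> continuous with \<open>\<psi> \<ge> 0\<close> or \<open>\<psi> \<le> 0\<close>, nor, if the second
  moment is finite, for \<open>\<psi>(x) = x\<close> and \<open>\<psi>(x) = -x\<close>. In particular \<open>upper_exp E X (\<lambda>x. x)\<close>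
  need not be \<open>E X\<close> for unbounded \<open>X\<close>.\<close>

definition upper_exp :: "(('w \<Rightarrow> real) \<Rightarrow> real) \<Rightarrow> ('w \<Rightarrow> real) \<Rightarrow> (real \<Rightarrow> real) \<Rightarrow> ereal" where
  "upper_exp E X \<psi> = (SUP \<mu>\<in>(SOME \<Theta>. represents E X \<Theta>). ext_integral \<mu> \<psi>)"

section \<open>Independence\<close>

text \<open>\<open>indep_from E m X k Y\<close>: the m-vector \<open>(X 0, \<dots>, X (m - 1))\<close> is independent from the
  k-vector \<open>(Y 0, \<dots>, Y (k - 1))\<close>.\<close>

definition indep_from ::
  "(('w \<Rightarrow> real) \<Rightarrow> real) \<Rightarrow> nat \<Rightarrow> (nat \<Rightarrow> 'w \<Rightarrow> real) \<Rightarrow> nat \<Rightarrow> (nat \<Rightarrow> 'w \<Rightarrow> real) \<Rightarrow> bool" where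
  "indep_from E m X k Y \<longleftrightarrow> (\<forall>\<phi>\<in>CbLip_n (k + m).
     E (\<lambda>\<omega>. \<phi> (\<lambda>j. if j < k then Y j \<omega> else X (j - k) \<omega>)) =
     E (\<lambda>\<omega>. E (\<lambda>\<omega>'. \<phi> (\<lambda>j. if j < k then Y j \<omega> else X (j - k) \<omega>'))))"

definition indep_seq :: "(('w \<Rightarrow> real) \<Rightarrow> real) \<Rightarrow> nat \<Rightarrow> (nat \<Rightarrow> 'w \<Rightarrow> real) \<Rightarrow> bool" where
  "indep_seq E n \<xi> \<longleftrightarrow>
     (\<forall>i. 1 \<le> i \<and> i < n \<longrightarrow> indep_from E 1 (\<lambda>_. \<xi> (i + 1)) i (\<lambda>j. \<xi> (j + 1)))"

section \<open>The G-normal distribution\<close>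

definition G :: "real \<Rightarrow> real \<Rightarrow> real" where
  "G \<beta> a = ((2 * \<beta> / (1 + \<beta>))\<^sup>2 * max a 0 - (2 / (1 + \<beta>))\<^sup>2 * max (- a) 0) / 2"

text \<open>\<open>p\<close> is a test function of class \<open>C\<^sup>1\<close> in time and \<open>C\<^sup>2\<close> in space, with derivatives
  \<open>pt\<close>, \<open>px\<close>, \<open>pxx\<close>.\<close>

definition test_function ::
  "(real \<Rightarrow> real \<Rightarrow> real) \<Rightarrow> (real \<Rightarrow> real \<Rightarrow> real) \<Rightarrow> (real \<Rightarrow> real \<Rightarrow> real) \<Rightarrow> (real \<Rightarrow> real \<Rightarrow> real) \<Rightarrow> bool"
where
  "test_function p pt px pxx \<longleftrightarrow>
     (\<forall>x t. 0 < t \<longrightarrow>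
        ((\<lambda>s. p x s) has_real_derivative pt x t) (at t) \<and>
        ((\<lambda>y. p y t) has_real_derivative px x t) (at x) \<and>
        ((\<lambda>y. px y t) has_real_derivative pxx x t) (at x)) \<and>
     continuous_on (UNIV \<times> {0<..}) (\<lambda>(x, t). pt x t) \<and>
     continuous_on (UNIV \<times> {0<..}) (\<lambda>(x, t). px x t) \<and>
     continuous_on (UNIV \<times> {0<..}) (\<lambda>(x, t). pxx x t)"

definition viscosity_subsolution :: "real \<Rightarrow> (real \<Rightarrow> real \<Rightarrow> real) \<Rightarrow> bool" where
  "viscosity_subsolution \<beta> u \<longleftrightarrow>
     (\<forall>p pt px pxx x t. test_function p pt px pxx \<longrightarrow> 0 < t \<longrightarrow>
        (\<forall>\<^sub>F (y, s) in nhds (x, t). u y s - p y s \<le> u x t - p x t) \<longrightarrow>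
        pt x t - G \<beta> (pxx x t) \<le> 0)"

definition viscosity_supersolution :: "real \<Rightarrow> (real \<Rightarrow> real \<Rightarrow> real) \<Rightarrow> bool" where
  "viscosity_supersolution \<beta> u \<longleftrightarrow>
     (\<forall>p pt px pxx x t. test_function p pt px pxx \<longrightarrow> 0 < t \<longrightarrow>
        (\<forall>\<^sub>F (y, s) in nhds (x, t). u x t - p x t \<le> u y s - p y s) \<longrightarrow>
        0 \<le> pt x t - G \<beta> (pxx x t))"

definition G_heat_solution :: "real \<Rightarrow> (real \<Rightarrow> real) \<Rightarrow> (real \<Rightarrow> real \<Rightarrow> real) \<Rightarrow> bool" where
  "G_heat_solution \<beta> \<phi> u \<longleftrightarrow>
     continuous_on (UNIV \<times> {0..}) (\<lambda>(x, t). u x t) \<and>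
     bounded ((\<lambda>(x, t). u x t) ` (UNIV \<times> {0..})) \<and>
     (\<forall>x. u x 0 = \<phi> x) \<and>
     viscosity_subsolution \<beta> u \<and> viscosity_supersolution \<beta> u"

text \<open>The solution is unique only for times \<open>t \<ge> 0\<close>, so the value and not the function \<open>u\<close>
  is described.\<close>

definition G_normal :: "real \<Rightarrow> (real \<Rightarrow> real) \<Rightarrow> real" where
  "G_normal \<beta> \<phi> = (THE z. \<exists>u. G_heat_solution \<beta> \<phi> u \<and> z = u 0 1)"

section \<open>The error bound\<close>

text \<open>\<open>su i\<close> and \<open>sl i\<close> are the upper and lower standard deviations of \<open>\<xi> i\<close>. Both sides of the
  bound are extended reals, since moments of order \<open>2 + \<alpha>\<close> may be infinite.\<close>

definition normal_approx_bound :: "'w itself \<Rightarrow> real \<Rightarrow> real \<Rightarrow> real \<Rightarrow> bool" where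
  "normal_approx_bound _ \<beta> \<alpha> C \<longleftrightarrow>
     (\<forall>(\<Omega> :: 'w set) H E (n :: nat) \<xi> (su :: nat \<Rightarrow> real) (sl :: nat \<Rightarrow> real).
        sublinear_expectation_space \<Omega> H E \<longrightarrow> 1 \<le> n \<longrightarrow>
        (\<forall>i\<in>{1..n}. \<xi> i \<in> H) \<longrightarrow> indep_seq E n \<xi> \<longrightarrow>
        (\<forall>i\<in>{1..n}.
           upper_exp E (\<xi> i) (\<lambda>x. x) = 0 \<and> upper_exp E (\<xi> i) (\<lambda>x. - x) = 0 \<and>
           upper_exp E (\<xi> i) (\<lambda>x. x\<^sup>2) = ereal ((su i)\<^sup>2) \<and>
           - upper_exp E (\<xi> i) (\<lambda>x. - x\<^sup>2) = ereal ((sl i)\<^sup>2) \<and>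
           sl i \<le> su i \<and> 0 < sl i \<and> su i / sl i = \<beta>) \<longrightarrow>
        (let m = (\<lambda>i. (su i + sl i) / 2);
             s = sqrt (\<Sum>i=1..n. (m i)\<^sup>2);
             W = (\<lambda>\<omega>. \<Sum>i=1..n. \<xi> i \<omega>)
         in (SUP \<phi>\<in>{\<phi> \<in> CbLip. 1-lipschitz_on UNIV \<phi>}.
               ereal \<bar>E (\<lambda>\<omega>. \<phi> (W \<omega> / s)) - G_normal \<beta> \<phi>\<bar>)
            \<le> ereal C * (SUP i\<in>{1..n}.
                 upper_exp E (\<xi> i) (\<lambda>x. \<bar>x\<bar> powr (2 + \<alpha>)) / ereal (m i powr (2 + \<alpha>))
                   * ereal ((m i / s) powr \<alpha>))))"

text \<open>The constants must not depend on the sublinear expectation space, hence not on the type of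
  its points either, but a type cannot be quantified after \<open>\<alpha>\<close> and \<open>C\<close>. Uniformity over
  all types is therefore expressed in two parts: suitable constants exist for spaces over
  \<open>nat \<Rightarrow> real\<close>, and any constants valid for these are valid, unchanged, for spaces over every
  type \<open>'w\<close>. Together the two parts say that a single pair \<open>\<alpha>, C\<close> works for all types.\<close>

end

theory Submission
  imports Defs
begin

text \<open>The \<open>G\<close>-heat equation is solved by an explicit monotone finite difference scheme. The discrete
  solution, its space difference and its time difference all satisfy a linear nondivergence form
  equation with measurable coefficients, for which Kruzhkov's doubling of variables gives, in one
  space dimension, a Lipschitz bound that only depends on the supremum norm and the elapsed time.
  Applied to the time difference, which is a strictly monotone function of the second space
  difference, it bounds \<open>D\<^sup>2u\<close> by \<open>t\<^sup>-\<^sup>1\<^sup>/\<^sup>2\<close> and its Lipschitz constant by \<open>t\<^sup>-\<^sup>1\<close>,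
  uniformly in the mesh size. The limit is a classical solution, hence a test function for any
  viscosity solution, which gives uniqueness.

  The one-step errors of Lindeberg's method then are of order \<open>\<delta>\<^sub>i t\<^sub>i\<^sup>-\<^sup>3\<^sup>/\<^sup>4\<close> times the
  right-hand side of the bound for \<open>\<alpha> = 1/2\<close>, and they are summable after all times are shifted by
  the largest step \<open>\<delta>\<^sub>i = (\<sigma>\<^sub>i/\<sigma>)\<^sup>2\<close>. Spaces over other types are pushed forward along
  \<open>\<omega> \<mapsto> (\<xi>\<^sub>i \<omega>)\<^sub>i\<close>.\<close>

section \<open>The discrete equation\<close>

text \<open>The discretization supplies existence and regularity together. Differences of the scheme
  satisfy linear equations exactly, so nothing is differentiated before it is known to be smooth,
  and every estimate is a comparison with an explicit barrier. Why \<alpha> = 1/2: interpolation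
  between the bound and the Lipschitz bound of the second derivative gives a Hoelder seminorm of
  order \<alpha> and size \<open>t^(-(1+\<alpha>)/2)\<close>. This is integrable near 0 for every
  \<alpha> < 1 but not for \<alpha> = 1, and 1/2 turns all powers into square roots. The time shift
  keeps the last step away from \<open>t = 0\<close>. It costs the square root of the largest step,
  which the bound absorbs because the moment ratio is never small. A further obstacle is that
  \<open>upper_exp\<close> evaluates a set picked by \<open>SOME\<close>, about which nothing is
  known until a representing set exists. Existence is derived from the axioms by Hahn-Banach, by a
  Riesz representation on the line for which \<open>E5\<close> supplies tightness, and by Tychonoff
  compactness.\<close>

definition second_diff :: "(int \<Rightarrow> real) \<Rightarrow> int \<Rightarrow> real" where
  "second_diff f j = f (j + 1) + f (j - 1) - 2 * f j"

text \<open>The existential quantifier lets the coefficient jump from one grid point to the next;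
  only the ellipticity bounds are kept.\<close>

definition diffusive :: "real \<Rightarrow> real \<Rightarrow> (nat \<Rightarrow> int \<Rightarrow> real) \<Rightarrow> bool" where
  "diffusive c1 c2 F \<longleftrightarrow>
     (\<forall>k j. \<exists>a. c1 \<le> a \<and> a \<le> c2 \<and> F (Suc k) j = F k j + a * second_diff (F k) j)"

lemma diffusiveE:
  assumes "diffusive c1 c2 F"
  obtains a where "c1 \<le> a" "a \<le> c2" "F (Suc k) j = F k j + a * second_diff (F k) j"
  using assms unfolding diffusive_def by blast

lemma diffusive_uminus: "diffusive c1 c2 F \<Longrightarrow> diffusive c1 c2 (\<lambda>k j. - F k j)"
  unfolding diffusive_def second_diff_def
  by (smt (verit, best) mult_minus_right)

lemma diffusive_add_time: "diffusive c1 c2 F \<Longrightarrow> diffusive c1 c2 (\<lambda>k. F (n + k))"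
  unfolding diffusive_def by simp

text \<open>Discrete maximum principle. As \<open>a \<le> 1/2\<close>, one step is an average with
  nonnegative weights \<open>1 - 2a, a, a\<close> and thus preserves order. \<open>S\<close> must be
  a supersolution for every admissible coefficient because the one used by \<open>F\<close> is
  unknown.\<close>

lemma diffusive_le:
  assumes F: "diffusive c1 c2 F" and c: "0 \<le> c1" "c2 \<le> 1 / 2"
    and S: "\<And>k j a. c1 \<le> a \<Longrightarrow> a \<le> c2 \<Longrightarrow> S k j + a * second_diff (S k) j \<le> S (Suc k) j"
    and init: "\<And>j. F 0 j \<le> S 0 j"
  shows "F k j \<le> S k j"
proof (induction k arbitrary: j)
  case 0
  show ?case by (rule init)
next
  case (Suc k)
  obtain a where a: "c1 \<le> a" "a \<le> c2" "F (Suc k) j = F k j + a * second_diff (F k) j"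
    using F by (rule diffusiveE)
  have "F (Suc k) j = (1 - 2 * a) * F k j + a * (F k (j + 1) + F k (j - 1))"
    unfolding a(3) second_diff_def by (simp add: algebra_simps)
  also have "\<dots> \<le> (1 - 2 * a) * S k j + a * (S k (j + 1) + S k (j - 1))"
    using a c Suc.IH by (intro add_mono mult_left_mono) auto
  also have "\<dots> = S k j + a * second_diff (S k) j"
    unfolding second_diff_def by (simp add: algebra_simps)
  also have "\<dots> \<le> S (Suc k) j" using a S by blast
  finally show ?case .
qed

lemma diffusive_abs_le:
  assumes F: "diffusive c1 c2 F" and c: "0 \<le> c1" "c2 \<le> 1 / 2"
    and init: "\<And>j. \<bar>F 0 j\<bar> \<le> M"
  shows "\<bar>F k j\<bar> \<le> M"
proof -
  have "F k j \<le> M"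
    by (rule diffusive_le[OF F c, of "\<lambda>_ _. M"]) (use init in \<open>auto simp: second_diff_def abs_le_iff\<close>)
  moreover have "- F k j \<le> M"
    by (rule diffusive_le[OF diffusive_uminus[OF F] c, of "\<lambda>_ _. M"])
      (use init in \<open>auto simp: second_diff_def abs_le_iff\<close>)
  ultimately show ?thesis by simp
qed

text \<open>The cone \<open>L * |i - j|\<close> lies below a parabola of width
  \<open>r = sqrt n\<close> and height \<open>L * r / 2\<close> at its vertex. The second difference
  of the parabola is constant, so it may rise at constant speed, and it gains another
  \<open>L * r / 2\<close> in \<open>n = r^2\<close> steps.\<close>

lemma diffusive_upper_time_modulus:
  assumes F: "diffusive c1 c2 F" and c: "0 \<le> c1" "c2 \<le> 1 / 2"
    and init: "\<And>i. F 0 i \<le> F 0 j + L * \<bar>real_of_int (i - j)\<bar>" and L: "0 \<le> L"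
  shows "F n j \<le> F 0 j + L * sqrt (real n)"
proof (cases "n = 0")
  case False
  define r where "r = sqrt (real n)"
  have r: "r > 0" and r2: "real n = r * r" using False by (auto simp: r_def)
  define S where "S k i = F 0 j + L * ((real_of_int (i - j))\<^sup>2 / (2 * r) + r / 2 + real k / (2 * r))"
    for k :: nat and i :: int
  have "F n j \<le> S n j"
  proof (rule diffusive_le[OF F c])
    fix k i a assume a: "c1 \<le> a" "a \<le> c2"
    have sd: "second_diff (S k) i = L / r"
      unfolding second_diff_def S_def using r by (simp add: field_simps power2_eq_square)
    have "a * (L / r) \<le> 1 / 2 * (L / r)"
      using a c L r by (intro mult_right_mono) auto
    moreover have "S (Suc k) i = S k i + 1 / 2 * (L / r)"
      using r by (simp add: S_def field_simps)
    ultimately show "S k i + a * second_diff (S k) i \<le> S (Suc k) i"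
      unfolding sd by simp
  next
    fix i
    define x where "x = \<bar>real_of_int (i - j)\<bar>"
    have "0 \<le> (x - r)\<^sup>2 / (2 * r)" using r by simp
    also have "\<dots> = x\<^sup>2 / (2 * r) + r / 2 - x"
      using r by (simp add: field_simps power2_eq_square)
    finally have "x \<le> (real_of_int (i - j))\<^sup>2 / (2 * r) + r / 2" by (simp add: x_def)
    then have "L * x \<le> L * ((real_of_int (i - j))\<^sup>2 / (2 * r) + r / 2)"
      using L by (intro mult_left_mono)
    with init[of i] show "F 0 i \<le> S 0 i"
      by (simp add: S_def x_def)
  qed
  also have "S n j = F 0 j + L * r"
    using r by (simp add: S_def r2)
  finally show ?thesis by (simp add: r_def)
qed simp

lemma diffusive_time_modulus:
  assumes F: "diffusive c1 c2 F" and c: "0 \<le> c1" "c2 \<le> 1 / 2"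
    and init: "\<And>i j. \<bar>F k i - F k j\<bar> \<le> L * \<bar>real_of_int (i - j)\<bar>" and L: "0 \<le> L"
  shows "\<bar>F (k + n) j - F k j\<bar> \<le> L * sqrt (real n)"
proof -
  have F': "diffusive c1 c2 (\<lambda>m. F (k + m))" by (rule diffusive_add_time[OF F])
  have i: "F k i \<le> F k j + L * \<bar>real_of_int (i - j)\<bar>"
          "- F k i \<le> - F k j + L * \<bar>real_of_int (i - j)\<bar>" for i
    using init[of i j] by linarith+
  show ?thesis
    using diffusive_upper_time_modulus[OF F' c _ L, of j n]
      diffusive_upper_time_modulus[OF diffusive_uminus[OF F'] c _ L, of j n] i
    by auto
qed

section \<open>Lipschitz regularization by doubling of variables\<close>

text \<open>As a function of the distance \<open>r\<close> this is concave, vanishes at 0 with slope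
  \<open>2e\<close>, and equals 1 from \<open>r = 1/e\<close> on. Concavity turns diffusion into
  decay, which allows \<open>e\<close> to shrink with time and so flattens the slope at 0.\<close>

definition barrier :: "real \<Rightarrow> real \<Rightarrow> real" where
  "barrier e r = 1 - (max 0 (1 - e * r))\<^sup>2"

text \<open>The subtracted term is the square of a nonnegative convex function of \<open>r\<close>,
  hence convex.\<close>

lemma barrier_concave: "barrier e (r + 1) + barrier e (r - 1) - 2 * barrier e r \<le> 0"
proof -
  define p q s where "p = max 0 (1 - e * (r + 1))" "q = max 0 (1 - e * (r - 1))" "s = max 0 (1 - e * r)"
  have s: "0 \<le> s" "2 * s \<le> p + q"
    by (auto simp: p_q_s_def algebra_simps max_def)
  have "(2 * s)\<^sup>2 \<le> (p + q)\<^sup>2" using s by (intro power_mono) auto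
  moreover have "0 \<le> (p - q)\<^sup>2" by simp
  ultimately have "2 * s\<^sup>2 \<le> p\<^sup>2 + q\<^sup>2" by (simp add: power2_eq_square algebra_simps)
  then show ?thesis by (simp add: barrier_def p_q_s_def)
qed

text \<open>The barrier with shrinking parameter is a supersolution of the doubled equation;
  \<open>2c\<close> is the least total diffusion of two points. Before the plateau, diffusion gains
  at least \<open>2c * e^2\<close>, while passing from \<open>e\<close> to \<open>e'\<close> costs
  at most \<open>2 (e - e') r\<close>, which the assumed rate bounds by \<open>c * e^2 / 2\<close>.
  The delicate case is the crossing of the corner \<open>e * r = 1\<close>.\<close>

lemma barrier_step:
  assumes e: "0 < e" "e \<le> 1" and e': "0 \<le> e'" "e' \<le> e" "e - e' \<le> c / 4 * e ^ 3"
    and c: "0 < c" "c \<le> 1 / 4" and r: "1 \<le> r"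
  shows "barrier e r + 2 * c * (barrier e (r + 1) + barrier e (r - 1) - 2 * barrier e r) \<le> barrier e' r"
proof -
  define d where "d = e - e'"
  have d0: "0 \<le> d" using e' by (simp add: d_def)
  have dr: "d * r \<le> c / 4 * e\<^sup>2 * (e * r)"
    using mult_right_mono[OF e'(3), of r] r by (simp add: d_def power2_eq_square power3_eq_cube algebra_simps)
  define D where "D = barrier e (r + 1) + barrier e (r - 1) - 2 * barrier e r"
  have "(max 0 (1 - e' * r))\<^sup>2 - (max 0 (1 - e * r))\<^sup>2 \<le> 2 * c * - D"
  proof (cases "e * r \<le> 1")
    case True
    have D: "e\<^sup>2 \<le> - D"
    proof (cases "e * (r + 1) \<le> 1")
      case True2: True
      have "e * (r - 1) \<le> 1" using True e by (simp add: algebra_simps)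
      then have "max 0 (1 - e * (r + 1)) = 1 - e * (r + 1)" "max 0 (1 - e * (r - 1)) = 1 - e * (r - 1)"
        "max 0 (1 - e * r) = 1 - e * r"
        using \<open>e * (r - 1) \<le> 1\<close> True True2 by (simp_all only: max_absorb2 diff_ge_0_iff_ge)
      then have "- D = 2 * e\<^sup>2"
        unfolding D_def barrier_def by (simp add: power2_eq_square algebra_simps)
      then show ?thesis by simp
    next
      case False
      then have f: "max 0 (1 - e * (r + 1)) = 0" by simp
      \<comment> \<open>The right neighbour is on the plateau. With \<open>y = 1 - e * r\<close>,
        which lies between 0 and \<open>e\<close>, the surplus over \<open>e^2\<close> is
        \<open>y * (2e - y)\<close>.\<close>
      have "- D = (1 - e * r + e)\<^sup>2 - 2 * (1 - e * r)\<^sup>2"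
      proof -
        have "e * (r - 1) \<le> 1" using True e by (simp add: algebra_simps)
        then have "max 0 (1 - e * (r - 1)) = 1 - e * (r - 1)" "max 0 (1 - e * r) = 1 - e * r"
          using True by (simp_all only: max_absorb2 diff_ge_0_iff_ge)
        then show ?thesis unfolding D_def barrier_def f by (simp add: algebra_simps)
      qed
      also have "\<dots> = e\<^sup>2 + (1 - e * r) * (2 * e - (1 - e * r))"
        by (simp add: power2_eq_square algebra_simps)
      also have "\<dots> \<ge> e\<^sup>2"
      proof -
        have "0 \<le> (1 - e * r) * (2 * e - (1 - e * r))"
          by (rule mult_nonneg_nonneg) (use True False e in \<open>auto simp: algebra_simps\<close>)
        then show ?thesis by simp
      qed
      finally show ?thesis .
    qed
    have er: "0 \<le> e * r" "0 \<le> e' * r" "e' * r \<le> e * r" using e e' r by (auto intro: mult_right_mono)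
    have "(max 0 (1 - e' * r))\<^sup>2 - (max 0 (1 - e * r))\<^sup>2 = (1 - e' * r)\<^sup>2 - (1 - e * r)\<^sup>2"
      using True er by (simp add: max_def)
    also have "\<dots> = d * r * (2 - (e * r + e' * r))"
      by (simp add: d_def power2_eq_square algebra_simps)
    also have "\<dots> \<le> d * r * 2"
    proof (rule mult_left_mono)
      show "2 - (e * r + e' * r) \<le> 2" using er(1,2) by linarith
    qed (use d0 r in simp)
    also have "\<dots> \<le> c / 4 * e\<^sup>2 * 1 * 2"
    proof -
      have "c / 4 * e\<^sup>2 * (e * r) \<le> c / 4 * e\<^sup>2 * 1" using True c by (intro mult_left_mono) auto
      then show ?thesis using dr by simp
    qed
    also have "\<dots> \<le> 2 * c * e\<^sup>2" using c by simp
    also have "\<dots> \<le> 2 * c * - D" using D c by (intro mult_left_mono) auto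
    finally show ?thesis .
  next
    case False
    \<comment> \<open>Now \<open>r\<close> is on the plateau for \<open>e\<close> but may leave it
      for \<open>e'\<close>. In that case the overshoot \<eta> is of order \<open>c * e^2\<close>,
      so the cost \<open>(1 - e' * r)^2\<close> is of order \<open>e^4\<close>, whereas the left
      neighbour still gains \<open>(e - \<eta>)^2 \<ge> e^2 / 4\<close>.\<close>
    define \<eta> where "\<eta> = e * r - 1"
    have \<eta>: "\<eta> > 0" using False by (simp add: \<eta>_def)
    have er: "e * r = 1 + \<eta>" by (simp add: \<eta>_def)
    have h: "max 0 (1 - e * r) = 0" using False by simp
    show ?thesis
    proof (cases "e' * r \<le> 1")
      case True
      have e2: "e\<^sup>2 \<le> e" "0 < e\<^sup>2" "e\<^sup>2 \<le> 1" using e by (auto simp: power2_eq_square mult_le_one)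
      have le: "c / 4 * e\<^sup>2 \<le> 1 / 16 * 1" using c e2 by (intro mult_mono) auto
      have "d * r = 1 + \<eta> - e' * r" using er by (simp add: d_def algebra_simps)
      then have q1: "1 - e' * r = d * r - \<eta>" "\<eta> \<le> d * r" using True by auto
      have "\<eta> \<le> c / 4 * e\<^sup>2 * (1 + \<eta>)" using dr q1 er by simp
      also have "\<dots> \<le> c / 4 * e\<^sup>2 + 1 / 16 * \<eta>"
        using mult_right_mono[OF le, of \<eta>] \<eta> by (simp add: algebra_simps)
      finally have \<eta>1: "\<eta> \<le> c / 4 * e\<^sup>2 + 1 / 16 * \<eta>" .
      have \<eta>2: "\<eta> \<le> c / 2 * e\<^sup>2" "\<eta> \<le> 1" 
      proof -
        have "0 \<le> c * e\<^sup>2" using c by simp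
        then show "\<eta> \<le> c / 2 * e\<^sup>2" using \<eta>1 by linarith
        then show "\<eta> \<le> 1" using le by linarith
      qed
      have "c / 4 * e\<^sup>2 * (1 + \<eta>) \<le> c / 4 * e\<^sup>2 * 2" using \<eta>2 c by (intro mult_left_mono) auto
      then have dr2: "d * r \<le> c / 2 * e\<^sup>2" using dr unfolding er by linarith
      have "c / 2 * e\<^sup>2 \<le> 1 / 8 * e" using c e2 by (intro mult_mono) auto
      then have et: "\<eta> \<le> e / 2" using \<eta>2 e by linarith
      have "(1 - e' * r)\<^sup>2 \<le> (c / 2 * e\<^sup>2)\<^sup>2" using q1 dr2 \<eta> by (intro power_mono) auto
      also have "\<dots> = c * (c / 4) * e\<^sup>2 * e\<^sup>2" by (simp add: power2_eq_square)
      also have "\<dots> \<le> c * (1 / 2) * e\<^sup>2 * 1" using c e2 by (intro mult_mono) auto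
      also have "\<dots> = 2 * c * (e / 2)\<^sup>2" by (simp add: power2_eq_square)
      also have "\<dots> \<le> 2 * c * (e - \<eta>)\<^sup>2" using et c e by (intro mult_left_mono power_mono) auto
      also have "(e - \<eta>)\<^sup>2 = - D"
      proof -
        have m1: "max 0 (1 - e * (r + 1)) = 0" using False e by (simp add: algebra_simps)
        have "1 - e * (r - 1) = e - \<eta>" using er by (simp add: algebra_simps)
        then have m2: "max 0 (1 - e * (r - 1)) = e - \<eta>" using et e by simp
        show ?thesis unfolding D_def barrier_def m1 m2 h by simp
      qed
      finally show ?thesis using True h by simp
    next
      case False
      have "0 \<le> - D" unfolding D_def using barrier_concave[of e r] by simp
      then have "0 \<le> 2 * c * - D" using c by (intro mult_nonneg_nonneg) auto
      with False h c show ?thesis by simp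
    qed
  qed
  then show ?thesis unfolding D_def[symmetric] by (simp add: barrier_def)
qed

lemma barrier_le: "0 \<le> e * r \<Longrightarrow> barrier e r \<le> 2 * (e * r)"
proof -
  assume a: "0 \<le> e * r"
  show ?thesis
  proof (cases "e * r \<le> 1")
    case True
    then have "barrier e r = 2 * (e * r) - (e * r)\<^sup>2"
      by (simp add: barrier_def power2_eq_square algebra_simps)
    then show ?thesis by simp
  next
    case False
    then show ?thesis by (simp add: barrier_def)
  qed
qed

text \<open>\<open>e = 1 / sqrt y\<close> solves \<open>de/dy = - e^3 / 2\<close> and is convex, so
  a step of \<open>2a\<close> loses at most \<open>a * e^3\<close>. This is the rate of decay that
  \<open>barrier_step\<close> tolerates.\<close>

lemma inverse_sqrt_step:
  assumes "0 \<le> (a::real)" "1 \<le> y"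
  shows "1 / sqrt y - 1 / sqrt (y + 2 * a) \<le> a * (1 / sqrt y) ^ 3"
proof -
  define p q where "p = sqrt y" "q = sqrt (y + 2 * a)"
  have p: "0 < p" "p \<le> q" using assms by (auto simp: p_q_def)
  have pq: "q * q - p * p = 2 * a" using assms by (simp add: p_q_def)
  have "1 / p - 1 / q = (q - p) / (p * q)" using p by (simp add: field_simps)
  also have "\<dots> = 2 * a / (p * q * (p + q))"
  proof -
    have "2 * a = (q - p) * (p + q)" using pq by (simp add: algebra_simps)
    then show ?thesis using p by simp
  qed
  also have "\<dots> \<le> 2 * a / (p * p * (p + p))"
    using p assms by (intro divide_left_mono mult_mono) (auto intro!: mult_pos_pos)
  also have "\<dots> = a * (1 / p) ^ 3" using p by (simp add: field_simps power3_eq_cube)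
  finally show ?thesis by (simp add: p_q_def)
qed

text \<open>Kruzhkov's doubling of variables: \<open>F k i - F k j\<close> evolves by moving one of the two points at
  a time, so the distance of the points changes by at most 1 and cannot jump over 0.\<close>

lemma diffusive_doubling:
  assumes F: "diffusive c1 c2 F" and c: "0 < c1" "c1 \<le> c2" "c2 \<le> 1 / 4"
    and init: "\<And>j. \<bar>F 0 j\<bar> \<le> M" and ij: "j \<le> i"
  shows "\<bar>F k i - F k j\<bar> \<le> 2 * M * barrier (1 / sqrt (1 + c1 / 2 * real k)) (real_of_int (i - j))"
  using ij
proof (induction k arbitrary: i j)
  case 0
  have M: "0 \<le> M" using init[of 0] by linarith
  show ?case
  proof (cases "i = j")
    case False
    then have "1 \<le> real_of_int (i - j)" using 0 by linarith
    \<comment> \<open>The initial parameter is 1, and the barrier then equals 1 at every positive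
      integer distance, so the supremum norm alone controls the start.\<close>
    then have "barrier 1 (real_of_int (i - j)) = 1" by (simp add: barrier_def)
    then show ?thesis using init[of i] init[of j] by simp
  qed (use M in \<open>simp add: barrier_def\<close>)
next
  case (Suc k)
  have M: "0 \<le> M" using init[of 0] by linarith
  define e e' where "e = 1 / sqrt (1 + c1 / 2 * real k)" "e' = 1 / sqrt (1 + c1 / 2 * real (Suc k))"
  show ?case
  proof (cases "i = j")
    case True
    then show ?thesis by (simp add: barrier_def)
  next
    case False
    define r where "r = real_of_int (i - j)"
    have r: "1 \<le> r" using False Suc.prems unfolding r_def by linarith
    obtain a where a: "c1 \<le> a" "a \<le> c2" "F (Suc k) i = F k i + a * second_diff (F k) i"
      using F by (rule diffusiveE)
    obtain b where b: "c1 \<le> b" "b \<le> c2" "F (Suc k) j = F k j + b * second_diff (F k) j"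
      using F by (rule diffusiveE)
    define B where "B = (\<lambda>y. 2 * M * barrier e y)"
    have IH: "\<bar>F k i' - F k j'\<bar> \<le> B (real_of_int (i' - j'))" if "j' \<le> i'" for i' j'
      unfolding B_def using Suc.IH[OF that] by (simp add: e_e'_def)
    have b1: "\<bar>F k i - F k j\<bar> \<le> B r"
      "\<bar>F k (i + 1) - F k j\<bar> \<le> B (r + 1)" "\<bar>F k (i - 1) - F k j\<bar> \<le> B (r - 1)"
      "\<bar>F k i - F k (j + 1)\<bar> \<le> B (r - 1)" "\<bar>F k i - F k (j - 1)\<bar> \<le> B (r + 1)"
      using IH[of j i] IH[of j "i + 1"] IH[of j "i - 1"] IH[of "j + 1" i] IH[of "j - 1" i] False Suc.prems
      by (auto simp: r_def algebra_simps)
    \<comment> \<open>The two updates combine to an average over the five pairs reachable by moving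
      at most one point; the central weight is nonnegative because \<open>a\<close> and
      \<open>b\<close> are at most 1/4.\<close>
    have "F (Suc k) i - F (Suc k) j =
        (1 - 2 * a - 2 * b) * (F k i - F k j) + a * (F k (i + 1) - F k j) + a * (F k (i - 1) - F k j)
        + b * (F k i - F k (j + 1)) + b * (F k i - F k (j - 1))"
      unfolding a(3) b(3) second_diff_def by (simp add: algebra_simps)
    also have "\<bar>\<dots>\<bar> \<le> (1 - 2 * a - 2 * b) * B r + a * B (r + 1) + a * B (r - 1) + b * B (r - 1) + b * B (r + 1)"
      using a b c b1
      by (intro order_trans[OF abs_triangle_ineq] add_mono order_trans[OF eq_refl[OF abs_mult]] mult_mono)
         auto
    also have "\<dots> = B r + (a + b) * (B (r + 1) + B (r - 1) - 2 * B r)"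
      by (simp add: algebra_simps)
    \<comment> \<open>The second difference of \<open>B\<close> is nonpositive, so replacing
      \<open>a + b\<close> by its lower bound only enlarges the right-hand side.\<close>
    also have "\<dots> \<le> B r + (2 * c1) * (B (r + 1) + B (r - 1) - 2 * B r)"
    proof -
      have "B (r + 1) + B (r - 1) - 2 * B r = 2 * M * (barrier e (r + 1) + barrier e (r - 1) - 2 * barrier e r)"
        by (simp add: B_def algebra_simps)
      then have "B (r + 1) + B (r - 1) - 2 * B r \<le> 0"
        using barrier_concave[of e r] M by (simp add: mult_nonneg_nonpos)
      then show ?thesis using a b by (auto intro: mult_right_mono_neg)
    qed
    also have "\<dots> = 2 * M * (barrier e r + 2 * c1 * (barrier e (r + 1) + barrier e (r - 1) - 2 * barrier e r))"
      by (simp add: B_def algebra_simps)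
    also have "\<dots> \<le> 2 * M * barrier e' r"
    proof (intro mult_left_mono barrier_step)
      have "1 / sqrt (1 + c1 / 2 * real k) - 1 / sqrt ((1 + c1 / 2 * real k) + 2 * (c1 / 4))
          \<le> c1 / 4 * (1 / sqrt (1 + c1 / 2 * real k)) ^ 3"
        using c by (intro inverse_sqrt_step) auto
      then show "e - e' \<le> c1 / 4 * e ^ 3" unfolding e_e'_def by (simp add: algebra_simps add_divide_distrib)
      show "0 < e" "e \<le> 1" "0 \<le> e'" using c by (auto simp: e_e'_def divide_simps add_pos_nonneg)
      show "e' \<le> e" unfolding e_e'_def using c
        by (intro divide_left_mono) (auto intro!: mult_pos_pos add_pos_nonneg)
    qed (use c r M in auto)
    finally show ?thesis by (simp add: r_def e_e'_def)
  qed
qed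

text \<open>The parameter of the barrier decays like \<open>1 / sqrt k\<close>, so bounded solutions
  become Lipschitz at the parabolic rate whatever the coefficients are. One factor 2 comes from the
  oscillation \<open>2M\<close>, the other from the slope \<open>2e\<close> of the barrier.\<close>

lemma diffusive_lipschitz:
  assumes F: "diffusive c1 c2 F" and c: "0 < c1" "c1 \<le> c2" "c2 \<le> 1 / 4"
    and init: "\<And>j. \<bar>F 0 j\<bar> \<le> M" and k: "0 < k"
  shows "\<bar>F k i - F k j\<bar> \<le> 4 * sqrt (2 / c1) * M * \<bar>real_of_int (i - j)\<bar> / sqrt (real k)"
proof -
  have M: "0 \<le> M" using init[of 0] by linarith
  have main: "\<bar>F k i - F k j\<bar> \<le> 4 * sqrt (2 / c1) * M * \<bar>real_of_int (i - j)\<bar> / sqrt (real k)"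
    if "j \<le> i" for i j
  proof -
    define e where "e = 1 / sqrt (1 + c1 / 2 * real k)"
    have "e \<le> 1 / sqrt (c1 / 2 * real k)"
      unfolding e_def using c k by (intro divide_left_mono) (auto intro!: mult_pos_pos add_pos_nonneg)
    also have "\<dots> = sqrt (2 / c1) / sqrt (real k)" using c k by (simp add: real_sqrt_mult real_sqrt_divide)
    finally have e: "e \<le> sqrt (2 / c1) / sqrt (real k)" .
    have e0: "0 \<le> e" using c by (simp add: e_def add_nonneg_nonneg)
    define r where "r = real_of_int (i - j)"
    have r: "0 \<le> r" "\<bar>real_of_int (i - j)\<bar> = r" using that by (auto simp: r_def)
    have "\<bar>F k i - F k j\<bar> \<le> 2 * M * barrier e r"
      unfolding e_def r_def by (rule diffusive_doubling[OF F c init that])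
    also have "\<dots> \<le> 2 * M * (2 * (e * r))"
      using M e0 r by (intro mult_left_mono barrier_le) auto
    also have "\<dots> \<le> 2 * M * (2 * (sqrt (2 / c1) / sqrt (real k) * r))"
      using M e r by (intro mult_left_mono mult_right_mono) auto
    finally show ?thesis unfolding r by (simp add: algebra_simps)
  qed
  show ?thesis
  proof (cases "j \<le> i")
    case False
    have "\<bar>F k j - F k i\<bar> = \<bar>F k i - F k j\<bar>" "\<bar>real_of_int (j - i)\<bar> = \<bar>real_of_int (i - j)\<bar>" by auto
    with main[of i j] False show ?thesis by simp
  qed (use main in blast)
qed

text \<open>The time step of the scheme is \<open>h\<^sup>2/8\<close> for mesh size \<open>h\<close>: the slopes of \<open>G/8\<close> are
  then at most \<open>1/4\<close>, so that even a pair of points can be moved one at a time.\<close>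

definition ell_lo :: "real \<Rightarrow> real" where "ell_lo \<beta> = (2 / (1 + \<beta>))\<^sup>2 / 16"
definition ell_up :: "real \<Rightarrow> real" where "ell_up \<beta> = (2 * \<beta> / (1 + \<beta>))\<^sup>2 / 16"

lemma ell_bounds:
  assumes "1 \<le> \<beta>"
  shows "0 < ell_lo \<beta>" "ell_lo \<beta> \<le> ell_up \<beta>" "ell_up \<beta> \<le> 1 / 4"
proof -
  show "0 < ell_lo \<beta>" using assms by (simp add: ell_lo_def)
  have "2 / (1 + \<beta>) \<le> 2 * \<beta> / (1 + \<beta>)" using assms by (intro divide_right_mono) auto
  then show "ell_lo \<beta> \<le> ell_up \<beta>" unfolding ell_lo_def ell_up_def using assms
    by (intro divide_right_mono power_mono) auto
  have "2 * \<beta> / (1 + \<beta>) \<le> 2" using assms by (simp add: field_simps)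
  then have "(2 * \<beta> / (1 + \<beta>))\<^sup>2 \<le> 2\<^sup>2" using assms by (intro power_mono) auto
  then show "ell_up \<beta> \<le> 1 / 4" unfolding ell_up_def by simp
qed

lemma G_eq: "G \<beta> a = 8 * (ell_up \<beta> * max a 0 - ell_lo \<beta> * max (- a) 0)"
  unfolding G_def ell_up_def ell_lo_def by (simp add: field_simps)

lemma G_diff_bounds:
  assumes "1 \<le> \<beta>" "x \<le> y"
  shows "8 * ell_lo \<beta> * (y - x) \<le> G \<beta> y - G \<beta> x" "G \<beta> y - G \<beta> x \<le> 8 * ell_up \<beta> * (y - x)"
proof -
  note c = ell_bounds[OF assms(1)]
  have le: "ell_lo \<beta> * z \<le> ell_up \<beta> * z" if "0 \<le> z" for z
    using c that by (intro mult_right_mono)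
  have cases: "0 \<le> x \<or> x \<le> 0 \<and> 0 \<le> y \<or> y \<le> 0" by linarith
  show "8 * ell_lo \<beta> * (y - x) \<le> G \<beta> y - G \<beta> x" "G \<beta> y - G \<beta> x \<le> 8 * ell_up \<beta> * (y - x)"
    using cases assms(2) le[of "y - x"] le[of y] le[of "- x"]
    by (auto simp: G_eq max_def algebra_simps)
qed

lemma G_mono: "1 \<le> \<beta> \<Longrightarrow> x \<le> y \<Longrightarrow> G \<beta> x \<le> G \<beta> y"
  using G_diff_bounds(1)[of \<beta> x y] ell_bounds(1)[of \<beta>]
  by (smt (verit) mult_nonneg_nonneg)

lemma G_abs_diff_bounds:
  assumes "1 \<le> \<beta>"
  shows "8 * ell_lo \<beta> * \<bar>y - x\<bar> \<le> \<bar>G \<beta> y - G \<beta> x\<bar>" "\<bar>G \<beta> y - G \<beta> x\<bar> \<le> 8 * ell_up \<beta> * \<bar>y - x\<bar>"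
  using G_diff_bounds[OF assms, of x y] G_diff_bounds[OF assms, of y x] G_mono[OF assms, of x y]
    G_mono[OF assms, of y x]
  by (cases "x \<le> y"; simp add: abs_if; smt (verit))+

text \<open>The coefficient is a difference quotient of \<open>G/8\<close>. It makes the difference
  of two values of the nonlinearity linear, which is how differences of the scheme become
  \<open>diffusive\<close>.\<close>

lemma G_slope:
  assumes "1 \<le> \<beta>"
  obtains a where "ell_lo \<beta> \<le> a" "a \<le> ell_up \<beta>" "G \<beta> y - G \<beta> x = 8 * a * (y - x)"
proof (cases "x = y")
  case True
  with that[of "ell_lo \<beta>"] ell_bounds[OF assms] show ?thesis by simp
next
  case False
  define a where "a = (G \<beta> y - G \<beta> x) / (8 * (y - x))"
  have "ell_lo \<beta> \<le> a \<and> a \<le> ell_up \<beta>"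
  proof (cases "x \<le> y")
    case True
    with False have "0 < y - x" by simp
    then show ?thesis using G_diff_bounds[OF assms True] by (simp add: a_def field_simps)
  next
    case nle: False
    then have "0 < x - y" by simp
    moreover have "a = (G \<beta> x - G \<beta> y) / (8 * (x - y))"
      unfolding a_def by (simp add: divide_simps) (simp add: algebra_simps)
    ultimately show ?thesis using G_diff_bounds[OF assms, of y x] nle by (simp add: pos_le_divide_eq pos_divide_le_eq mult.commute mult.left_commute)
  qed
  moreover have "a * (8 * (y - x)) = G \<beta> y - G \<beta> x"
    using False unfolding a_def times_divide_eq_left by (intro nonzero_mult_div_cancel_right) simp
  then have "G \<beta> y - G \<beta> x = 8 * a * (y - x)" by (simp add: algebra_simps)
  ultimately show ?thesis using that by blast
qed

lemma G_0 [simp]: "G \<beta> 0 = 0" by (simp add: G_def)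

lemma G_scale: "0 \<le> c \<Longrightarrow> G \<beta> (c * a) = c * G \<beta> a"
proof -
  assume c: "0 \<le> c"
  have "max (c * x) 0 = c * max x 0" for x :: real
    using c max_mult_distrib_left[of c x 0] by simp
  from this[of a] this[of "- a"] show ?thesis by (simp add: G_eq algebra_simps)
qed

lemma abs_telescope_le:
  fixes a :: "nat \<Rightarrow> real"
  assumes "\<And>i. i < n \<Longrightarrow> \<bar>a (Suc i) - a i - d\<bar> \<le> e"
  shows "\<bar>a n - a 0 - real n * d\<bar> \<le> real n * e"
  using assms
proof (induction n)
  case (Suc n)
  have "\<bar>a n - a 0 - real n * d\<bar> \<le> real n * e" using Suc by simp
  moreover have "\<bar>a (Suc n) - a n - d\<bar> \<le> e" using Suc.prems by simp
  ultimately show ?case by (simp add: algebra_simps)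
qed simp

section \<open>The explicit scheme and its a priori estimates\<close>

text \<open>The mesh size cancels by positive homogeneity: the time step \<open>h^2/8\<close> times
  \<open>G\<close> of the second difference divided by \<open>h^2\<close> is one eighth of
  \<open>G\<close> of the second difference.\<close>

fun scheme :: "real \<Rightarrow> (int \<Rightarrow> real) \<Rightarrow> nat \<Rightarrow> int \<Rightarrow> real" where
  "scheme \<beta> f 0 j = f j"
| "scheme \<beta> f (Suc k) j = scheme \<beta> f k j + G \<beta> (second_diff (scheme \<beta> f k) j) / 8"

locale discrete_G_heat =
  fixes \<beta> h M :: real and f :: "int \<Rightarrow> real"
  assumes \<beta>: "1 \<le> \<beta>" and h: "0 < h"
    and f_lip: "\<And>j. \<bar>f (j + 1) - f j\<bar> \<le> h" and f_bdd: "\<And>j. \<bar>f j\<bar> \<le> M"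
begin

abbreviation "c1 \<equiv> ell_lo \<beta>"
abbreviation "c2 \<equiv> ell_up \<beta>"
abbreviation "U \<equiv> scheme \<beta> f"
abbreviation "D k j \<equiv> second_diff (U k) j"
definition "P k j = U k (j + 1) - U k j"
text \<open>By the recursion this is the time difference \<open>U (Suc k) j - U k j\<close>. The
  second difference \<open>D\<close> itself satisfies an equation with \<open>G\<close> under the
  second difference, to which the estimates for \<open>diffusive\<close> do not apply
  directly.\<close>

definition "W k j = G \<beta> (D k j) / 8"

lemmas c = ell_bounds[OF \<beta>]

lemma c': "0 \<le> c1" "c2 \<le> 1 / 2" using c by auto

lemma diffusive_U: "diffusive c1 c2 U"
  unfolding diffusive_def
proof (intro allI)
  fix k j
  obtain a where "c1 \<le> a" "a \<le> c2" "G \<beta> (D k j) - G \<beta> 0 = 8 * a * (D k j - 0)"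
    using G_slope[OF \<beta>] by blast
  then show "\<exists>a\<ge>c1. a \<le> c2 \<and> U (Suc k) j = U k j + a * D k j" by auto
qed

lemma diffusive_P: "diffusive c1 c2 P"
  unfolding diffusive_def
proof (intro allI)
  fix k j
  obtain a where a: "c1 \<le> a" "a \<le> c2" "G \<beta> (D k (j + 1)) - G \<beta> (D k j) = 8 * a * (D k (j + 1) - D k j)"
    using G_slope[OF \<beta>] by blast
  have "D k (j + 1) - D k j = second_diff (P k) j"
    by (simp add: second_diff_def P_def)
  with a show "\<exists>a\<ge>c1. a \<le> c2 \<and> P (Suc k) j = P k j + a * second_diff (P k) j"
    by (intro exI[of _ a]) (simp add: P_def field_simps)
qed

lemma diffusive_W: "diffusive c1 c2 W"
  unfolding diffusive_def
proof (intro allI)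
  fix k j
  obtain a where a: "c1 \<le> a" "a \<le> c2" "G \<beta> (D (Suc k) j) - G \<beta> (D k j) = 8 * a * (D (Suc k) j - D k j)"
    using G_slope[OF \<beta>] by blast
  have "D (Suc k) j - D k j = second_diff (W k) j"
    by (simp add: second_diff_def W_def field_simps)
  with a show "\<exists>a\<ge>c1. a \<le> c2 \<and> W (Suc k) j = W k j + a * second_diff (W k) j"
    by (intro exI[of _ a]) (simp add: W_def field_simps)
qed

lemma U_bdd: "\<bar>U k j\<bar> \<le> M"
  by (rule diffusive_abs_le[OF diffusive_U c']) (simp add: f_bdd)

lemma P_bdd: "\<bar>P k j\<bar> \<le> h"
  by (rule diffusive_abs_le[OF diffusive_P c']) (simp add: P_def f_lip)

lemma lipschitz_of_step:
  fixes g :: "int \<Rightarrow> real"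
  assumes "\<And>j. \<bar>g (j + 1) - g j\<bar> \<le> L"
  shows "\<bar>g i - g j\<bar> \<le> L * \<bar>real_of_int (i - j)\<bar>"
proof -
  have main: "\<bar>g (j + int n) - g j\<bar> \<le> L * real n" for j n
  proof -
    have "\<bar>g (j + int n) - g (j + int 0) - real n * 0\<bar> \<le> real n * L"
      by (rule abs_telescope_le) (use assms[of "j + int _"] in \<open>simp add: algebra_simps\<close>)
    then show ?thesis by (simp add: algebra_simps)
  qed
  show ?thesis
  proof (cases "j \<le> i")
    case True
    then show ?thesis using main[of j "nat (i - j)"] by simp
  next
    case False
    then show ?thesis using main[of i "nat (j - i)"] by (simp add: abs_minus_commute)
  qed
qed

lemma U_lip: "\<bar>U k i - U k j\<bar> \<le> h * \<bar>real_of_int (i - j)\<bar>"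
  by (rule lipschitz_of_step) (use P_bdd in \<open>simp add: P_def\<close>)

lemma U_time: "\<bar>U (k + n) j - U k j\<bar> \<le> h * sqrt (real n)"
  by (rule diffusive_time_modulus[OF diffusive_U c' U_lip]) (use h in auto)

definition "C1 = 4 * sqrt (2 / c1)"

lemma C1: "0 \<le> C1" using c by (simp add: C1_def)

lemma P_lip: "0 < k \<Longrightarrow> \<bar>P k i - P k j\<bar> \<le> C1 * h / sqrt (real k) * \<bar>real_of_int (i - j)\<bar>"
  using diffusive_lipschitz[OF diffusive_P c P_bdd, of k i j] by (simp add: C1_def)

lemma P_time: "0 < k \<Longrightarrow> \<bar>P (k + n) j - P k j\<bar> \<le> C1 * h / sqrt (real k) * sqrt (real n)"
  by (rule diffusive_time_modulus[OF diffusive_P c' P_lip]) (use h C1 in auto)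

text \<open>The second difference is the increment of \<open>P\<close> over one cell, so the
  regularization of the first difference already bounds it.\<close>

lemma D_bdd:
  assumes "0 < k"
  shows "\<bar>D k j\<bar> \<le> C1 * h / sqrt (real k)"
proof -
  have "D k j = P k j - P k (j - 1)" by (simp add: P_def second_diff_def)
  then show ?thesis using P_lip[OF assms, of j "j - 1"] by simp
qed

lemma W_bdd:
  assumes "0 < k"
  shows "\<bar>W k j\<bar> \<le> c2 * (C1 * h / sqrt (real k))"
proof -
  have "\<bar>W k j\<bar> \<le> c2 * \<bar>D k j\<bar>" using G_abs_diff_bounds(2)[OF \<beta>, of "D k j" 0] by (simp add: W_def)
  also have "\<dots> \<le> c2 * (C1 * h / sqrt (real k))"
    using c D_bdd[OF assms] by (intro mult_left_mono) auto
  finally show ?thesis .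
qed

definition "C2 = 3 * c2 * C1\<^sup>2"

lemma C2: "0 \<le> C2" using c by (simp add: C2_def)

text \<open>The elapsed time is spent twice: the first half bounds \<open>W\<close> by order
  \<open>h / sqrt k\<close>, and the second half turns this bound into a Lipschitz constant of order
  \<open>h / k\<close>. Both halves have at least \<open>k/3\<close> steps, whence the 3 in
  \<open>C2\<close>.\<close>

lemma W_lip:
  assumes "2 \<le> k"
  shows "\<bar>W k i - W k j\<bar> \<le> C2 * h / real k * \<bar>real_of_int (i - j)\<bar>"
proof -
  define n m where "n = k div 2" "m = k - n"
  have nm: "0 < n" "0 < m" "real k \<le> 3 * real n" "real k \<le> 3 * real m" "n + m = k"
  proof -
    show "n + m = k" "0 < n" "0 < m" using assms unfolding n_m_def by presburger+
    have "k \<le> 3 * n" "k \<le> 3 * m" using assms unfolding n_m_def by presburger+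
    then have "real k \<le> real (3 * n)" "real k \<le> real (3 * m)" by (simp_all only: of_nat_le_iff)
    then show "real k \<le> 3 * real n" "real k \<le> 3 * real m" by simp_all
  qed
  have "\<bar>W (n + m) i - W (n + m) j\<bar>
      \<le> C1 * (c2 * (C1 * h / sqrt (real n))) * \<bar>real_of_int (i - j)\<bar> / sqrt (real m)"
    unfolding C1_def
    by (rule diffusive_lipschitz[OF diffusive_add_time[OF diffusive_W] c _ nm(2), unfolded add_0_right,
          OF W_bdd[OF nm(1), unfolded C1_def]])
  also have "\<dots> = c2 * C1\<^sup>2 * h * \<bar>real_of_int (i - j)\<bar> * (1 / (sqrt (real n) * sqrt (real m)))"
    by (simp add: power2_eq_square)
  also have "\<dots> \<le> c2 * C1\<^sup>2 * h * \<bar>real_of_int (i - j)\<bar> * (3 / real k)"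
  proof (intro mult_left_mono)
    have "real k * real k \<le> (3 * real n) * (3 * real m)" using nm by (intro mult_mono) auto
    then have "(real k / 3)\<^sup>2 \<le> real n * real m" by (simp add: power2_eq_square)
    then have "real k / 3 \<le> sqrt (real n * real m)" by (rule real_le_rsqrt)
    then have "1 / sqrt (real n * real m) \<le> 1 / (real k / 3)"
      using assms by (intro divide_left_mono) (auto intro!: mult_pos_pos nm(1,2))
    then show "1 / (sqrt (real n) * sqrt (real m)) \<le> 3 / real k" by (simp add: real_sqrt_mult)
  qed (use c h in auto)
  finally show ?thesis using nm(5) by (simp add: C2_def algebra_simps)
qed

lemma W_time:
  assumes "2 \<le> k"
  shows "\<bar>W (k + n) j - W k j\<bar> \<le> C2 * h / real k * sqrt (real n)"
  by (rule diffusive_time_modulus[OF diffusive_W c' W_lip[OF assms]]) (use h C2 in auto)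

text \<open>The lower ellipticity bound gives \<open>G\<close> a Lipschitz inverse, so every modulus
  of the time difference is one of the second difference.\<close>

lemma D_le_W: "\<bar>D k i - D l j\<bar> \<le> \<bar>W k i - W l j\<bar> / c1"
proof -
  have "c1 * \<bar>D k i - D l j\<bar> \<le> \<bar>W k i - W l j\<bar>"
    using G_abs_diff_bounds(1)[OF \<beta>, of "D k i" "D l j"] by (simp add: W_def flip: diff_divide_distrib)
  then show ?thesis using c by (simp add: field_simps)
qed

lemma D_lip:
  assumes "2 \<le> k"
  shows "\<bar>D k i - D k j\<bar> \<le> C2 / c1 * h / real k * \<bar>real_of_int (i - j)\<bar>"
proof -
  have "\<bar>W k i - W k j\<bar> / c1 \<le> C2 * h / real k * \<bar>real_of_int (i - j)\<bar> / c1"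
    by (rule divide_right_mono[OF W_lip[OF assms]]) (use c in simp)
  with D_le_W[of k i k j] show ?thesis by (simp add: field_simps)
qed

lemma D_time:
  assumes "2 \<le> k"
  shows "\<bar>D (k + n) j - D k j\<bar> \<le> C2 / c1 * h / real k * sqrt (real n)"
proof -
  have "\<bar>W (k + n) j - W k j\<bar> / c1 \<le> C2 * h / real k * sqrt (real n) / c1"
    by (rule divide_right_mono[OF W_time[OF assms]]) (use c in simp)
  with D_le_W[of "k + n" j k j] show ?thesis by (simp add: field_simps)
qed

text \<open>Taylor's formula in time: each of the \<open>n\<close> increments is a value of
  \<open>W\<close>, which the time modulus compares with the value at step \<open>k\<close>.\<close>

lemma U_time_expansion:
  assumes "2 \<le> k"
  shows "\<bar>U (k + n) j - U k j - real n * W k j\<bar> \<le> real n * (C2 * h / real k * sqrt (real n))"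
proof -
  have "\<bar>U (k + n) j - U (k + 0) j - real n * W k j\<bar> \<le> real n * (C2 * h / real k * sqrt (real n))"
  proof (rule abs_telescope_le[of n "\<lambda>i. U (k + i) j"])
    fix i assume "i < n"
    have "\<bar>U (k + Suc i) j - U (k + i) j - W k j\<bar> = \<bar>W (k + i) j - W k j\<bar>"
      by (simp add: W_def)
    also have "\<dots> \<le> C2 * h / real k * sqrt (real i)" by (rule W_time[OF assms])
    also have "\<dots> \<le> C2 * h / real k * sqrt (real n)"
      using \<open>i < n\<close> C2 h by (intro mult_left_mono) auto
    finally show "\<bar>U (k + Suc i) j - U (k + i) j - W k j\<bar> \<le> \<dots>" .
  qed
  then show ?thesis by simp
qed

lemma P_expansion:
  assumes "2 \<le> k"
  shows "\<bar>P k (j + int n) - P k j - real n * D k j\<bar> \<le> real n * (C2 / c1 * h / real k * real n)"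
proof -
  have "\<bar>P k (j + int n) - P k (j + int 0) - real n * D k j\<bar> \<le> real n * (C2 / c1 * h / real k * real n)"
  proof (rule abs_telescope_le[of n "\<lambda>i. P k (j + int i)"])
    fix i assume "i < n"
    \<comment> \<open>\<open>P\<close> is a forward and \<open>D\<close> a centred difference, so
      the increment of \<open>P\<close> from \<open>j + i\<close> to \<open>j + i + 1\<close> is
      \<open>D\<close> at the right end point.\<close>
    have "\<bar>P k (j + int (Suc i)) - P k (j + int i) - D k j\<bar> = \<bar>D k (j + int (Suc i)) - D k j\<bar>"
      by (simp add: P_def second_diff_def algebra_simps)
    also have "\<dots> \<le> C2 / c1 * h / real k * real (Suc i)" using D_lip[OF assms, of "j + int (Suc i)" j] by simp
    also have "\<dots> \<le> C2 / c1 * h / real k * real n"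
      using \<open>i < n\<close> C2 h c by (intro mult_left_mono) auto
    finally show "\<bar>P k (j + int (Suc i)) - P k (j + int i) - D k j\<bar> \<le> \<dots>" .
  qed
  then show ?thesis by simp
qed

lemma U_expansion:
  assumes "0 < k"
  shows "\<bar>U k (j + int n) - U k j - real n * P k j\<bar> \<le> real n * (C1 * h / sqrt (real k) * real n)"
proof -
  have "\<bar>U k (j + int n) - U k (j + int 0) - real n * P k j\<bar> \<le> real n * (C1 * h / sqrt (real k) * real n)"
  proof (rule abs_telescope_le[of n "\<lambda>i. U k (j + int i)"])
    fix i assume "i < n"
    have "\<bar>U k (j + int (Suc i)) - U k (j + int i) - P k j\<bar> = \<bar>P k (j + int i) - P k j\<bar>"
      by (simp add: P_def algebra_simps)
    also have "\<dots> \<le> C1 * h / sqrt (real k) * real i" using P_lip[OF assms, of "j + int i" j] by simp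
    also have "\<dots> \<le> C1 * h / sqrt (real k) * real n"
      using \<open>i < n\<close> C1 h by (intro mult_left_mono) auto
    finally show "\<bar>U k (j + int (Suc i)) - U k (j + int i) - P k j\<bar> \<le> \<dots>" .
  qed
  then show ?thesis by simp
qed

end

section \<open>The limit of vanishing mesh size\<close>

text \<open>An ultrafilter would do; the product of compact intervals provides a filter along which
  all bounded sequences converge.\<close>

lemma ex_limit_filter:
  "\<exists>F :: nat filter. F \<le> sequentially \<and> F \<noteq> bot \<and>
     (\<forall>s :: nat \<Rightarrow> real. Bseq s \<longrightarrow> (\<exists>l. (s \<longlongrightarrow> l) F))"
proof -
  define Q where "Q = {s :: nat \<Rightarrow> real. Bseq s}"
  have "\<forall>s\<in>Q. \<exists>K. \<forall>n. \<bar>s n\<bar> \<le> K"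
    unfolding Q_def Bseq_def by (auto simp: real_norm_def)
  then obtain K where K: "\<And>s n. s \<in> Q \<Longrightarrow> \<bar>s n\<bar> \<le> K s" by metis
  \<comment> \<open>The product is indexed by all real sequences; unbounded ones receive the trivial
    factor \<open>{0}\<close>, which keeps every factor compact.\<close>
  define S where "S s = (if s \<in> Q then {- K s..K s} else {0})" for s
  have "compact (PiE UNIV S)"
  proof -
    have "compactin (product_topology (\<lambda>_. euclideanreal) UNIV) (PiE UNIV S)"
      unfolding compactin_PiE S_def by auto
    then show ?thesis by (simp add: euclidean_product_topology)
  qed
  \<comment> \<open>The point \<open>x n\<close> evaluates all bounded sequences at
    \<open>n\<close>. Convergence of these points in the product is convergence of all bounded
    sequences at once.\<close>
  moreover define x where "x n = (\<lambda>s. if s \<in> Q then s n else 0)" for n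
  have "x n \<in> PiE UNIV S" for n using K by (auto simp: x_def S_def abs_le_iff minus_le_iff)
  then have "eventually (\<lambda>y. y \<in> PiE UNIV S) (filtermap x sequentially)"
    by (simp add: eventually_filtermap)
  moreover have "filtermap x sequentially \<noteq> bot" by (simp add: filtermap_bot_iff)
  ultimately obtain l where l: "inf (nhds l) (filtermap x sequentially) \<noteq> bot"
    unfolding compact_filter by blast
  \<comment> \<open>Neighbourhoods of the cluster point are pulled back to indices. The filter is
    proper because each of them is visited at arbitrarily large indices.\<close>
  define F where "F = inf sequentially (filtercomap x (nhds l))"
  have "F \<noteq> bot"
  proof
    assume "F = bot"
    then have "eventually (\<lambda>_. False) F" by simp
    then obtain P Q where PQ: "eventually P sequentially" "eventually Q (filtercomap x (nhds l))"
      "\<And>n. P n \<and> Q n \<Longrightarrow> False" unfolding F_def eventually_inf by blast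
    then obtain R where R: "eventually R (nhds l)" "\<And>n. R (x n) \<Longrightarrow> Q n"
      unfolding eventually_filtercomap by blast
    have "eventually (\<lambda>y. \<not> R y) (filtermap x sequentially)"
      unfolding eventually_filtermap by (rule eventually_mono[OF PQ(1)]) (use PQ(3) R(2) in blast)
    then have "eventually (\<lambda>_. False) (inf (nhds l) (filtermap x sequentially))"
      unfolding eventually_inf using R(1) by blast
    with l show False by (simp add: eventually_False)
  qed
  moreover have "F \<le> sequentially" by (simp add: F_def)
  moreover have "\<exists>l. (s \<longlongrightarrow> l) F" if "Bseq s" for s :: "nat \<Rightarrow> real"
  proof -
    have "(x \<longlongrightarrow> l) (filtercomap x (nhds l))" by (rule filterlim_filtercomap)
    then have "(x \<longlongrightarrow> l) F" unfolding F_def by (rule tendsto_mono[rotated]) simp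
    have "((\<lambda>n. x n s) \<longlongrightarrow> l s) F"
    proof (rule topological_tendstoI)
      fix T assume T: "open T" "l s \<in> T"
      have "open ((\<lambda>y :: (nat \<Rightarrow> real) \<Rightarrow> real. y s) -` T)"
        by (rule open_vimage[OF T(1) continuous_on_product_coordinates])
      from topological_tendstoD[OF \<open>(x \<longlongrightarrow> l) F\<close> this] T
      show "eventually (\<lambda>n. x n s \<in> T) F" by simp
    qed
    then show ?thesis using that by (auto simp: x_def Q_def)
  qed
  ultimately show ?thesis by blast
qed

text \<open>One filter serves all points and all difference quotients, so sums, products and
  inequalities pass to the limit together, without a diagonal choice of subsequences.\<close>

definition limit_filter :: "nat filter" where
  "limit_filter = (SOME F. F \<le> sequentially \<and> F \<noteq> bot \<and>
     (\<forall>s :: nat \<Rightarrow> real. Bseq s \<longrightarrow> (\<exists>l. (s \<longlongrightarrow> l) F)))"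

lemma limit_filter:
  "limit_filter \<le> sequentially" "limit_filter \<noteq> bot" "Bseq s \<Longrightarrow> \<exists>l. (s \<longlongrightarrow> (l :: real)) limit_filter"
  using someI_ex[OF ex_limit_filter] unfolding limit_filter_def by blast+

definition gen_lim :: "(nat \<Rightarrow> real) \<Rightarrow> real" where
  "gen_lim s = Lim limit_filter s"

lemma tendsto_gen_lim: "Bseq s \<Longrightarrow> (s \<longlongrightarrow> gen_lim s) limit_filter"
  unfolding gen_lim_def using limit_filter by (metis tendsto_Lim)

lemma gen_lim_eqI:
  assumes "s \<longlonglongrightarrow> l"
  shows "gen_lim s = l"
  unfolding gen_lim_def
  by (rule tendsto_Lim[OF limit_filter(2)]) (rule tendsto_mono[OF limit_filter(1) assms])

text \<open>Carries estimates of the scheme to the limit: the quantity being estimated converges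
  along the filter, its explicit bound in the usual sense.\<close>

lemma gen_le:
  fixes A B :: real
  assumes "(a \<longlongrightarrow> A) limit_filter" "b \<longlonglongrightarrow> B" "eventually (\<lambda>n. a n \<le> b n) sequentially"
  shows "A \<le> B"
  by (rule tendsto_le[OF limit_filter(2) tendsto_mono[OF limit_filter(1) assms(2)] assms(1)])
     (rule filter_leD[OF limit_filter(1) assms(3)])

section \<open>Grids and the passage to the limit\<close>

definition mesh :: "nat \<Rightarrow> real" where "mesh m = 1 / 2 ^ m"
text \<open>The factor 8 belongs to the time step \<open>h^2/8\<close>. Negative times are sent to
  step 0 by \<open>nat\<close>, so the limit is defined there too, with the initial values.\<close>

definition time_index :: "real \<Rightarrow> nat \<Rightarrow> nat" where "time_index t m = nat \<lfloor>8 * t / (mesh m)\<^sup>2\<rfloor>"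
definition space_index :: "real \<Rightarrow> nat \<Rightarrow> int" where "space_index x m = \<lfloor>x / mesh m\<rfloor>"

lemma mesh_pos [simp]: "0 < mesh m" "mesh m \<noteq> 0" by (simp_all add: mesh_def)

lemma mesh_tendsto: "mesh \<longlonglongrightarrow> 0"
  unfolding mesh_def[abs_def] by real_asymp

lemma floor_scale_tendsto:
  assumes "d \<longlonglongrightarrow> 0" "\<And>m. 0 < (d m :: real)"
  shows "(\<lambda>m. d m * real_of_int \<lfloor>y / d m\<rfloor>) \<longlonglongrightarrow> y"
proof (rule tendsto_sandwich)
  show "eventually (\<lambda>m. y - d m \<le> d m * real_of_int \<lfloor>y / d m\<rfloor>) sequentially"
  proof (rule always_eventually, rule allI)
    fix m
    have "y / d m - 1 \<le> real_of_int \<lfloor>y / d m\<rfloor>" by linarith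
    then have "d m * (y / d m - 1) \<le> d m * real_of_int \<lfloor>y / d m\<rfloor>"
      using assms(2)[of m] by (intro mult_left_mono) auto
    then show "y - d m \<le> d m * real_of_int \<lfloor>y / d m\<rfloor>"
      using assms(2)[of m] by (simp add: algebra_simps)
  qed
  show "eventually (\<lambda>m. d m * real_of_int \<lfloor>y / d m\<rfloor> \<le> y) sequentially"
  proof (rule always_eventually, rule allI)
    fix m
    have "d m * real_of_int \<lfloor>y / d m\<rfloor> \<le> d m * (y / d m)"
      using assms(2)[of m] by (intro mult_left_mono) auto
    then show "d m * real_of_int \<lfloor>y / d m\<rfloor> \<le> y" using assms(2)[of m] by simp
  qed
  show "(\<lambda>m. y - d m) \<longlonglongrightarrow> y" using tendsto_diff[OF tendsto_const assms(1), of y] by simp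
qed simp

lemma space_index_tendsto: "(\<lambda>m. mesh m * real_of_int (space_index x m)) \<longlonglongrightarrow> x"
  unfolding space_index_def by (rule floor_scale_tendsto[OF mesh_tendsto]) simp

lemma space_index_diff_tendsto:
  "(\<lambda>m. mesh m * real_of_int (space_index y m - space_index x m)) \<longlonglongrightarrow> y - x"
  using tendsto_diff[OF space_index_tendsto[of y] space_index_tendsto[of x]]
  by (simp add: algebra_simps)

lemma time_index_tendsto:
  assumes "0 \<le> t"
  shows "(\<lambda>m. (mesh m)\<^sup>2 * real (time_index t m)) \<longlonglongrightarrow> 8 * t"
proof -
  have "(\<lambda>m. (mesh m)\<^sup>2) \<longlonglongrightarrow> 0" using tendsto_power[OF mesh_tendsto, of 2] by simp
  then have "(\<lambda>m. (mesh m)\<^sup>2 * real_of_int \<lfloor>8 * t / (mesh m)\<^sup>2\<rfloor>) \<longlonglongrightarrow> 8 * t"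
    by (rule floor_scale_tendsto) simp
  moreover have "real (time_index t m) = real_of_int \<lfloor>8 * t / (mesh m)\<^sup>2\<rfloor>" for m
    using assms by (simp add: time_index_def)
  ultimately show ?thesis by simp
qed

lemma time_index_mono: "t \<le> t' \<Longrightarrow> time_index t m \<le> time_index t' m"
  unfolding time_index_def by (intro nat_mono floor_mono divide_right_mono) auto

lemma space_index_mono: "x \<le> y \<Longrightarrow> space_index x m \<le> space_index y m"
  unfolding space_index_def by (intro floor_mono divide_right_mono) (auto simp: less_imp_le)

lemma time_index_diff_tendsto:
  assumes "0 \<le> t" "0 \<le> s"
  shows "(\<lambda>m. (mesh m)\<^sup>2 * real (time_index (t + s) m - time_index t m)) \<longlonglongrightarrow> 8 * s"
proof -
  have "(mesh m)\<^sup>2 * real (time_index (t + s) m - time_index t m) =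
    (mesh m)\<^sup>2 * real (time_index (t + s) m) - (mesh m)\<^sup>2 * real (time_index t m)" for m
    using time_index_mono[of t "t + s" m] assms by (simp add: of_nat_diff algebra_simps)
  then show ?thesis
    using tendsto_diff[OF time_index_tendsto[of "t + s"] time_index_tendsto[of t]] assms by simp
qed

lemma sqrt_scale: "mesh m * sqrt (real k) = sqrt ((mesh m)\<^sup>2 * real k)"
  by (simp add: real_sqrt_mult less_imp_le)

text \<open>The estimates for \<open>W\<close> need two elapsed steps; on fine grids any positive
  time contains them.\<close>

lemma time_index_ge:
  assumes "0 < t"
  shows "eventually (\<lambda>m. 2 \<le> time_index t m) sequentially"
proof -
  have "eventually (\<lambda>m. 4 * t < (mesh m)\<^sup>2 * real (time_index t m)) sequentially"
    by (rule order_tendstoD(1)[OF time_index_tendsto]) (use assms in auto)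
  moreover have "(\<lambda>m. 2 * (mesh m)\<^sup>2) \<longlonglongrightarrow> 2 * 0\<^sup>2"
    by (intro tendsto_intros mesh_tendsto)
  then have "eventually (\<lambda>m. 2 * (mesh m)\<^sup>2 < 4 * t) sequentially"
    by (rule order_tendstoD(2)) (use assms in auto)
  ultimately show ?thesis
  proof eventually_elim
    case (elim m)
    then have "(mesh m)\<^sup>2 * 2 < (mesh m)\<^sup>2 * real (time_index t m)" by linarith
    then have "2 < real (time_index t m)" by (simp add: mult_less_cancel_left)
    then show ?case by linarith
  qed
qed

lemma Bseq_of_bound:
  fixes a b :: "nat \<Rightarrow> real"
  assumes "b \<longlonglongrightarrow> B" "eventually (\<lambda>n. \<bar>a n\<bar> \<le> b n) sequentially"
  shows "Bseq a"
proof -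
  have "eventually (\<lambda>n. b n < \<bar>B\<bar> + 1) sequentially"
    by (rule order_tendstoD(2)[OF assms(1)]) simp
  with assms(2) have "eventually (\<lambda>n. norm (a n) \<le> \<bar>B\<bar> + 1) sequentially"
    by eventually_elim simp
  then show ?thesis by (rule BfunI)
qed

locale G_heat_limit =
  fixes \<beta> M :: real and \<phi> :: "real \<Rightarrow> real"
  assumes \<beta>: "1 \<le> \<beta>" and \<phi>_lip: "\<And>x y. \<bar>\<phi> x - \<phi> y\<bar> \<le> \<bar>x - y\<bar>" and \<phi>_bdd: "\<And>x. \<bar>\<phi> x\<bar> \<le> M"
begin

definition "init m j = \<phi> (mesh m * real_of_int j)" for m :: nat

lemma discrete: "discrete_G_heat \<beta> (mesh m) M (init m)"
proof
  show "\<bar>init m (j + 1) - init m j\<bar> \<le> mesh m" for j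
    using \<phi>_lip[of "mesh m * real_of_int (j + 1)" "mesh m * real_of_int j"]
    by (simp add: init_def algebra_simps less_imp_le)
qed (use \<beta> \<phi>_bdd in \<open>auto simp: init_def\<close>)

abbreviation "U m \<equiv> scheme \<beta> (init m)"
abbreviation "C1 \<equiv> discrete_G_heat.C1 \<beta>"
abbreviation "C2 \<equiv> discrete_G_heat.C2 \<beta>"

text \<open>A pointwise limit of difference quotients need not be a derivative. That
  \<open>p\<close> and \<open>v\<close> are derivatives is obtained later, from the discrete Taylor
  formulas, which survive in the limit because their remainders are uniform in the mesh
  size.\<close>

definition "um x t m = U m (time_index t m) (space_index x m)"
definition "pm x t m = (U m (time_index t m) (space_index x m + 1) - U m (time_index t m) (space_index x m)) / mesh m"
definition "vm x t m = second_diff (U m (time_index t m)) (space_index x m) / (mesh m)\<^sup>2"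
definition "u x t = gen_lim (um x t)"
definition "p x t = gen_lim (pm x t)"
definition "v x t = gen_lim (vm x t)"

lemma C1: "0 \<le> C1" and C2: "0 \<le> C2"
  using discrete_G_heat.C1[OF discrete] discrete_G_heat.C2[OF discrete] by auto

lemma time_sqrt_tendsto: "0 \<le> t \<Longrightarrow> (\<lambda>m. mesh m * sqrt (real (time_index t m))) \<longlonglongrightarrow> sqrt (8 * t)"
  unfolding sqrt_scale by (intro tendsto_real_sqrt time_index_tendsto)

lemma time_diff_sqrt_tendsto: "0 \<le> t \<Longrightarrow> 0 \<le> s \<Longrightarrow>
    (\<lambda>m. mesh m * sqrt (real (time_index (t + s) m - time_index t m))) \<longlonglongrightarrow> sqrt (8 * s)"
  unfolding sqrt_scale by (intro tendsto_real_sqrt time_index_diff_tendsto)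

lemma space_abs_tendsto:
  "(\<lambda>m. mesh m * \<bar>real_of_int (space_index y m - space_index x m)\<bar>) \<longlonglongrightarrow> \<bar>y - x\<bar>"
proof -
  have "mesh m * \<bar>real_of_int (space_index y m - space_index x m)\<bar> =
      \<bar>mesh m * real_of_int (space_index y m - space_index x m)\<bar>" for m
    by (simp add: abs_mult less_imp_le)
  then show ?thesis using tendsto_rabs[OF space_index_diff_tendsto[of y x]] by simp
qed

lemma time_index_add: "0 \<le> s \<Longrightarrow> time_index t m + (time_index (t + s) m - time_index t m) = time_index (t + s) m"
  using time_index_mono[of t "t + s" m] by simp

lemma um_tendsto: "(um x t \<longlongrightarrow> u x t) limit_filter"
  unfolding u_def
  by (rule tendsto_gen_lim, rule Bseq_of_bound[of "\<lambda>_. M" M])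
     (auto simp: um_def discrete_G_heat.U_bdd[OF discrete])

lemma pm_tendsto: "(pm x t \<longlongrightarrow> p x t) limit_filter"
  unfolding p_def
proof (rule tendsto_gen_lim, rule Bseq_of_bound[of "\<lambda>_. 1" 1], simp, rule always_eventually, rule allI)
  fix m
  have "\<bar>U m (time_index t m) (space_index x m + 1) - U m (time_index t m) (space_index x m)\<bar> \<le> mesh m"
    using discrete_G_heat.P_bdd[OF discrete, of m "time_index t m" "space_index x m"]
    unfolding discrete_G_heat.P_def[OF discrete] .
  then show "\<bar>pm x t m\<bar> \<le> 1" by (simp add: pm_def abs_divide less_imp_le divide_le_eq)
qed

lemma vm_bound:
  assumes "0 < t"
  shows "eventually (\<lambda>m. \<bar>vm x t m\<bar> \<le> C1 / (mesh m * sqrt (real (time_index t m)))) sequentially"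
  using time_index_ge[OF assms]
proof eventually_elim
  case (elim m)
  have "\<bar>vm x t m\<bar> = \<bar>second_diff (U m (time_index t m)) (space_index x m)\<bar> / (mesh m)\<^sup>2"
    by (simp add: vm_def)
  also have "\<dots> \<le> C1 * mesh m / sqrt (real (time_index t m)) / (mesh m)\<^sup>2"
    by (intro divide_right_mono discrete_G_heat.D_bdd[OF discrete]) (use elim in auto)
  finally show ?case by (simp add: power2_eq_square mult.commute)
qed

lemma vm_bound_tendsto:
  "0 < t \<Longrightarrow> (\<lambda>m. C1 / (mesh m * sqrt (real (time_index t m)))) \<longlonglongrightarrow> C1 / sqrt (8 * t)"
  by (intro tendsto_intros time_sqrt_tendsto) auto

lemma vm_tendsto: "0 < t \<Longrightarrow> (vm x t \<longlongrightarrow> v x t) limit_filter"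
  unfolding v_def by (intro tendsto_gen_lim Bseq_of_bound[OF vm_bound_tendsto vm_bound])

lemma v_bdd: "0 < t \<Longrightarrow> \<bar>v x t\<bar> \<le> C1 / sqrt (8 * t)"
  by (rule gen_le[OF tendsto_rabs[OF vm_tendsto] vm_bound_tendsto vm_bound])

lemma u_bdd: "\<bar>u x t\<bar> \<le> M"
  by (rule gen_le[OF tendsto_rabs[OF um_tendsto] tendsto_const])
     (auto simp: um_def discrete_G_heat.U_bdd[OF discrete])

lemma u_init: "u x 0 = \<phi> x"
  unfolding u_def
proof (rule gen_lim_eqI)
  have "isCont \<phi> x" unfolding isCont_def
    by (rule LIM_I) (metis \<phi>_lip le_less_trans real_norm_def)
  then have "(\<lambda>m. \<phi> (mesh m * real_of_int (space_index x m))) \<longlonglongrightarrow> \<phi> x"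
    by (rule isCont_tendsto_compose[OF _ space_index_tendsto])
  then show "um x 0 \<longlonglongrightarrow> \<phi> x" by (simp add: um_def[abs_def] init_def time_index_def)
qed

lemma u_lip: "\<bar>u y t - u x t\<bar> \<le> \<bar>y - x\<bar>"
  by (rule gen_le[OF tendsto_rabs[OF tendsto_diff[OF um_tendsto um_tendsto]] space_abs_tendsto])
     (auto simp: um_def intro!: always_eventually discrete_G_heat.U_lip[OF discrete, simplified])

lemma u_time:
  assumes "0 \<le> t" "0 \<le> s"
  shows "\<bar>u x (t + s) - u x t\<bar> \<le> sqrt (8 * s)"
proof (rule gen_le[OF tendsto_rabs[OF tendsto_diff[OF um_tendsto um_tendsto]] time_diff_sqrt_tendsto[OF assms]],
    rule always_eventually, rule allI)
  fix m
  show "\<bar>um x (t + s) m - um x t m\<bar> \<le> mesh m * sqrt (real (time_index (t + s) m - time_index t m))"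
    using discrete_G_heat.U_time[OF discrete, of m "time_index t m" "time_index (t + s) m - time_index t m" "space_index x m"]
    unfolding time_index_add[OF assms(2)] um_def by simp
qed

text \<open>Expanding the discrete bound by powers of the mesh size exhibits the quantities
  \<open>mesh * |i - j|\<close> and \<open>mesh^2 * k\<close>, whose limits are
  \<open>|y - x|\<close> and \<open>8t\<close>. The other moduli are rescaled in the same
  way.\<close>

lemma v_lip:
  assumes t: "0 < t"
  shows "\<bar>v y t - v x t\<bar> \<le> C2 / ell_lo \<beta> * \<bar>y - x\<bar> / (8 * t)"
proof (rule gen_le[OF tendsto_rabs[OF tendsto_diff[OF vm_tendsto vm_tendsto]]])
  show "(\<lambda>m. C2 / ell_lo \<beta> * (mesh m * \<bar>real_of_int (space_index y m - space_index x m)\<bar>) /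
      ((mesh m)\<^sup>2 * real (time_index t m))) \<longlonglongrightarrow> C2 / ell_lo \<beta> * \<bar>y - x\<bar> / (8 * t)"
    using t by (intro tendsto_divide tendsto_mult tendsto_const space_abs_tendsto time_index_tendsto) auto
  show "eventually (\<lambda>m. \<bar>vm y t m - vm x t m\<bar> \<le>
      C2 / ell_lo \<beta> * (mesh m * \<bar>real_of_int (space_index y m - space_index x m)\<bar>) /
      ((mesh m)\<^sup>2 * real (time_index t m))) sequentially"
    using time_index_ge[OF t]
  proof eventually_elim
    case (elim m)
    let ?k = "time_index t m" and ?i = "space_index y m" and ?j = "space_index x m"
    have "\<bar>vm y t m - vm x t m\<bar> = \<bar>second_diff (U m ?k) ?i - second_diff (U m ?k) ?j\<bar> / (mesh m)\<^sup>2"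
      by (simp add: vm_def flip: diff_divide_distrib)
    also have "\<dots> \<le> C2 / ell_lo \<beta> * mesh m / real ?k * \<bar>real_of_int (?i - ?j)\<bar> / (mesh m)\<^sup>2"
      by (intro divide_right_mono discrete_G_heat.D_lip[OF discrete] elim) simp
    finally show ?case by (simp add: field_simps)
  qed
qed (use t in auto)

lemma v_time:
  assumes t: "0 < t" and s: "0 \<le> s"
  shows "\<bar>v x (t + s) - v x t\<bar> \<le> C2 / ell_lo \<beta> * sqrt (8 * s) / (8 * t)"
proof (rule gen_le[OF tendsto_rabs[OF tendsto_diff[OF vm_tendsto vm_tendsto]]])
  let ?n = "\<lambda>m. time_index (t + s) m - time_index t m"
  show "(\<lambda>m. C2 / ell_lo \<beta> * (mesh m * sqrt (real (?n m))) /
      ((mesh m)\<^sup>2 * real (time_index t m))) \<longlonglongrightarrow> C2 / ell_lo \<beta> * sqrt (8 * s) / (8 * t)"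
    using t s by (intro tendsto_divide tendsto_mult tendsto_const time_diff_sqrt_tendsto time_index_tendsto) auto
  show "eventually (\<lambda>m. \<bar>vm x (t + s) m - vm x t m\<bar> \<le>
      C2 / ell_lo \<beta> * (mesh m * sqrt (real (?n m))) / ((mesh m)\<^sup>2 * real (time_index t m))) sequentially"
    using time_index_ge[OF t]
  proof eventually_elim
    case (elim m)
    let ?k = "time_index t m" and ?j = "space_index x m"
    have "\<bar>vm x (t + s) m - vm x t m\<bar> =
        \<bar>second_diff (U m (?k + ?n m)) ?j - second_diff (U m ?k) ?j\<bar> / (mesh m)\<^sup>2"
      unfolding time_index_add[OF s] by (simp add: vm_def flip: diff_divide_distrib)
    also have "\<dots> \<le> C2 / ell_lo \<beta> * mesh m / real ?k * sqrt (real (?n m)) / (mesh m)\<^sup>2"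
      by (intro divide_right_mono discrete_G_heat.D_time[OF discrete] elim) simp
    finally show ?case by (simp add: field_simps)
  qed
qed (use t s in auto)

lemma p_time:
  assumes t: "0 < t" and s: "0 \<le> s"
  shows "\<bar>p x (t + s) - p x t\<bar> \<le> C1 * sqrt (8 * s) / sqrt (8 * t)"
proof (rule gen_le[OF tendsto_rabs[OF tendsto_diff[OF pm_tendsto pm_tendsto]]])
  let ?n = "\<lambda>m. time_index (t + s) m - time_index t m"
  show "(\<lambda>m. C1 * (mesh m * sqrt (real (?n m))) /
      (mesh m * sqrt (real (time_index t m)))) \<longlonglongrightarrow> C1 * sqrt (8 * s) / sqrt (8 * t)"
    using t s by (intro tendsto_divide tendsto_mult tendsto_const time_diff_sqrt_tendsto time_sqrt_tendsto) auto
  show "eventually (\<lambda>m. \<bar>pm x (t + s) m - pm x t m\<bar> \<le>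
      C1 * (mesh m * sqrt (real (?n m))) / (mesh m * sqrt (real (time_index t m)))) sequentially"
    using time_index_ge[OF t]
  proof eventually_elim
    case (elim m)
    let ?k = "time_index t m" and ?j = "space_index x m"
    have "\<bar>pm x (t + s) m - pm x t m\<bar> =
        \<bar>(U m (?k + ?n m) (?j + 1) - U m (?k + ?n m) ?j) - (U m ?k (?j + 1) - U m ?k ?j)\<bar> / mesh m"
      unfolding time_index_add[OF s] by (simp add: pm_def less_imp_le flip: diff_divide_distrib)
    also have "\<dots> \<le> C1 * mesh m / sqrt (real ?k) * sqrt (real (?n m)) / mesh m"
      by (intro divide_right_mono discrete_G_heat.P_time[OF discrete, unfolded discrete_G_heat.P_def[OF discrete]])
        (use elim in \<open>auto simp: less_imp_le\<close>)
    finally show ?case by (simp add: field_simps)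
  qed
qed

lemma u_time_expansion:
  assumes t: "0 < t" and s: "0 \<le> s"
  shows "\<bar>u x (t + s) - u x t - s * G \<beta> (v x t)\<bar> \<le> C2 * s * sqrt (8 * s) / t"
proof -
  let ?n = "\<lambda>m. time_index (t + s) m - time_index t m"
  have G: "((\<lambda>m. G \<beta> (vm x t m)) \<longlongrightarrow> G \<beta> (v x t)) limit_filter"
    unfolding G_eq by (intro tendsto_intros vm_tendsto t)
  have sn: "((\<lambda>m. (mesh m)\<^sup>2 * real (?n m)) \<longlongrightarrow> 8 * s) limit_filter"
    by (rule tendsto_mono[OF limit_filter(1) time_index_diff_tendsto]) (use t s in auto)
  \<comment> \<open>Elapsed time enters as the limit \<open>8s\<close> of \<open>mesh^2 * n\<close>;
    the factors 8 are cancelled at the end.\<close>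
  have "\<bar>u x (t + s) - u x t - (8 * s) * G \<beta> (v x t) / 8\<bar> \<le> C2 * (8 * s) * sqrt (8 * s) / (8 * t)"
  proof (rule gen_le[OF tendsto_rabs[OF tendsto_diff[OF tendsto_diff[OF um_tendsto um_tendsto]]]])
    show "((\<lambda>m. ((mesh m)\<^sup>2 * real (?n m)) * G \<beta> (vm x t m) / 8) \<longlongrightarrow> 8 * s * G \<beta> (v x t) / 8) limit_filter"
      by (intro tendsto_intros sn G) auto
    show "(\<lambda>m. C2 * ((mesh m)\<^sup>2 * real (?n m)) * (mesh m * sqrt (real (?n m))) /
        ((mesh m)\<^sup>2 * real (time_index t m))) \<longlonglongrightarrow> C2 * (8 * s) * sqrt (8 * s) / (8 * t)"
      using t s by (intro tendsto_divide tendsto_mult tendsto_const time_diff_sqrt_tendsto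
          time_index_diff_tendsto time_index_tendsto) auto
    show "eventually (\<lambda>m. \<bar>um x (t + s) m - um x t m - ((mesh m)\<^sup>2 * real (?n m)) * G \<beta> (vm x t m) / 8\<bar>
        \<le> C2 * ((mesh m)\<^sup>2 * real (?n m)) * (mesh m * sqrt (real (?n m))) /
          ((mesh m)\<^sup>2 * real (time_index t m))) sequentially"
      using time_index_ge[OF t]
    proof eventually_elim
      case (elim m)
      let ?k = "time_index t m" and ?j = "space_index x m"
      have "G \<beta> (second_diff (U m ?k) ?j) = (mesh m)\<^sup>2 * G \<beta> (vm x t m)"
        by (simp add: vm_def flip: G_scale)
      then have "\<bar>um x (t + s) m - um x t m - ((mesh m)\<^sup>2 * real (?n m)) * G \<beta> (vm x t m) / 8\<bar> =
          \<bar>U m (?k + ?n m) ?j - U m ?k ?j - real (?n m) * (G \<beta> (second_diff (U m ?k) ?j) / 8)\<bar>"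
        unfolding time_index_add[OF s] by (simp add: um_def algebra_simps)
      also have "\<dots> \<le> real (?n m) * (C2 * mesh m / real ?k * sqrt (real (?n m)))"
        by (intro discrete_G_heat.U_time_expansion[OF discrete, unfolded discrete_G_heat.W_def[OF discrete]] elim)
      finally show ?case by (simp add: field_simps)
    qed
  qed
  then show ?thesis using t by (simp add: field_simps)
qed

lemma space_index_nat:
  assumes "x \<le> y"
  obtains n where "space_index y m = space_index x m + int n"
    "real n = real_of_int (space_index y m - space_index x m)"
  using space_index_mono[OF assms, of m] that[of "nat (space_index y m - space_index x m)"] by simp

lemma p_expansion:
  assumes t: "0 < t" and xy: "x \<le> y"
  shows "\<bar>p y t - p x t - (y - x) * v x t\<bar> \<le> C2 / ell_lo \<beta> * (y - x)\<^sup>2 / (8 * t)"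
proof (rule gen_le[OF tendsto_rabs[OF tendsto_diff[OF tendsto_diff[OF pm_tendsto pm_tendsto]]]])
  let ?d = "\<lambda>m. mesh m * real_of_int (space_index y m - space_index x m)"
  show "((\<lambda>m. ?d m * vm x t m) \<longlongrightarrow> (y - x) * v x t) limit_filter"
    by (intro tendsto_mult vm_tendsto t tendsto_mono[OF limit_filter(1) space_index_diff_tendsto])
  show "(\<lambda>m. C2 / ell_lo \<beta> * (?d m)\<^sup>2 / ((mesh m)\<^sup>2 * real (time_index t m)))
      \<longlonglongrightarrow> C2 / ell_lo \<beta> * (y - x)\<^sup>2 / (8 * t)"
    using t by (intro tendsto_divide tendsto_mult tendsto_power tendsto_const space_index_diff_tendsto
        time_index_tendsto) auto
  show "eventually (\<lambda>m. \<bar>pm y t m - pm x t m - ?d m * vm x t m\<bar>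
      \<le> C2 / ell_lo \<beta> * (?d m)\<^sup>2 / ((mesh m)\<^sup>2 * real (time_index t m))) sequentially"
    using time_index_ge[OF t]
  proof eventually_elim
    case (elim m)
    let ?k = "time_index t m" and ?j = "space_index x m"
    obtain n where n: "space_index y m = ?j + int n" "real n = real_of_int (space_index y m - ?j)"
      using space_index_nat[OF xy] by blast
    have "pm y t m - pm x t m - ?d m * vm x t m =
        ((U m ?k (?j + int n + 1) - U m ?k (?j + int n)) - (U m ?k (?j + 1) - U m ?k ?j)
          - real n * second_diff (U m ?k) ?j) / mesh m"
      unfolding pm_def vm_def n(2)[symmetric] n(1) by (simp add: field_simps power2_eq_square)
    then have "\<bar>pm y t m - pm x t m - ?d m * vm x t m\<bar> =
        \<bar>(U m ?k (?j + int n + 1) - U m ?k (?j + int n)) - (U m ?k (?j + 1) - U m ?k ?j)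
          - real n * second_diff (U m ?k) ?j\<bar> / mesh m"
      by (simp only: abs_divide) (simp add: less_imp_le)
    also have "\<dots> \<le> real n * (C2 / ell_lo \<beta> * mesh m / real ?k * real n) / mesh m"
      by (intro divide_right_mono discrete_G_heat.P_expansion[OF discrete, unfolded discrete_G_heat.P_def[OF discrete]] elim)
        (simp add: less_imp_le)
    finally show ?case unfolding n(2)[symmetric] by (simp add: power2_eq_square mult_ac)
  qed
qed

lemma u_expansion:
  assumes t: "0 < t" and xy: "x \<le> y"
  shows "\<bar>u y t - u x t - (y - x) * p x t\<bar> \<le> C1 * (y - x)\<^sup>2 / sqrt (8 * t)"
proof (rule gen_le[OF tendsto_rabs[OF tendsto_diff[OF tendsto_diff[OF um_tendsto um_tendsto]]]])
  let ?d = "\<lambda>m. mesh m * real_of_int (space_index y m - space_index x m)"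
  show "((\<lambda>m. ?d m * pm x t m) \<longlongrightarrow> (y - x) * p x t) limit_filter"
    by (intro tendsto_mult pm_tendsto tendsto_mono[OF limit_filter(1) space_index_diff_tendsto])
  show "(\<lambda>m. C1 * (?d m)\<^sup>2 / (mesh m * sqrt (real (time_index t m))))
      \<longlonglongrightarrow> C1 * (y - x)\<^sup>2 / sqrt (8 * t)"
    using t by (intro tendsto_divide tendsto_mult tendsto_power tendsto_const space_index_diff_tendsto
        time_sqrt_tendsto) auto
  show "eventually (\<lambda>m. \<bar>um y t m - um x t m - ?d m * pm x t m\<bar>
      \<le> C1 * (?d m)\<^sup>2 / (mesh m * sqrt (real (time_index t m)))) sequentially"
    using time_index_ge[OF t]
  proof eventually_elim
    case (elim m)
    let ?k = "time_index t m" and ?j = "space_index x m"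
    obtain n where n: "space_index y m = ?j + int n" "real n = real_of_int (space_index y m - ?j)"
      using space_index_nat[OF xy] by blast
    have "?d m * pm x t m = real n * (U m ?k (?j + 1) - U m ?k ?j)"
      unfolding pm_def n(2)[symmetric] by simp
    then have "\<bar>um y t m - um x t m - ?d m * pm x t m\<bar> =
        \<bar>U m ?k (?j + int n) - U m ?k ?j - real n * (U m ?k (?j + 1) - U m ?k ?j)\<bar>"
      by (simp only: um_def n(1))
    also have "\<dots> \<le> real n * (C1 * mesh m / sqrt (real ?k) * real n)"
      by (intro discrete_G_heat.U_expansion[OF discrete, unfolded discrete_G_heat.P_def[OF discrete]])
        (use elim in simp)
    finally show ?case unfolding n(2)[symmetric] by (simp add: power2_eq_square mult_ac)
  qed
qed

end

section \<open>Comparison of viscosity and classical solutions\<close>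

lemma has_real_derivative_of_bound:
  fixes f :: "real \<Rightarrow> real"
  assumes e: "(e \<longlongrightarrow> 0) (at x)"
    and le: "eventually (\<lambda>y. \<bar>f y - f x - (y - x) * d\<bar> \<le> e y * \<bar>y - x\<bar>) (at x)"
  shows "(f has_real_derivative d) (at x)"
  unfolding has_field_derivative_iff
proof (rule Lim_null[THEN iffD2], rule Lim_null_comparison[OF _ e])
  show "eventually (\<lambda>y. norm ((f y - f x) / (y - x) - d) \<le> e y) (at x)"
    using le eventually_neq_at_within[of x x UNIV]
  proof eventually_elim
    case (elim y)
    then have "(f y - f x) / (y - x) - d = (f y - f x - (y - x) * d) / (y - x)"
      by (simp add: field_simps)
    with elim show ?case by (simp add: abs_divide divide_le_eq)
  qed
qed

text \<open>The discrete expansions only go to the right. For \<open>y < x\<close> one expands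
  around \<open>y\<close> and trades \<open>g y\<close> for \<open>g x\<close> by the Lipschitz
  bound, which doubles the error.\<close>

lemma has_real_derivative_of_expansion:
  fixes f g :: "real \<Rightarrow> real"
  assumes exp: "\<And>x y. x \<le> y \<Longrightarrow> \<bar>f y - f x - (y - x) * g x\<bar> \<le> A * (y - x)\<^sup>2"
    and lip: "\<And>x y. \<bar>g y - g x\<bar> \<le> A * \<bar>y - x\<bar>"
  shows "(f has_real_derivative g x) (at x)"
proof (rule has_real_derivative_of_bound)
  show "((\<lambda>y. 2 * A * \<bar>y - x\<bar>) \<longlongrightarrow> 0) (at x)" by (auto intro!: tendsto_eq_intros)
  show "eventually (\<lambda>y. \<bar>f y - f x - (y - x) * g x\<bar> \<le> 2 * A * \<bar>y - x\<bar> * \<bar>y - x\<bar>) (at x)"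
  proof (rule always_eventually, rule allI)
    fix y
    define E where "E = A * (y - x)\<^sup>2"
    have E: "2 * A * \<bar>y - x\<bar> * \<bar>y - x\<bar> = E + E" "\<bar>y - x\<bar> * (A * \<bar>x - y\<bar>) = E"
      by (simp_all add: E_def power2_eq_square abs_if algebra_simps)
    show "\<bar>f y - f x - (y - x) * g x\<bar> \<le> 2 * A * \<bar>y - x\<bar> * \<bar>y - x\<bar>"
    proof (cases "x \<le> y")
      case True
      show ?thesis unfolding E using exp[OF True] unfolding E_def[symmetric] by linarith
    next
      case False
      have e: "\<bar>f x - f y - (x - y) * g y\<bar> \<le> E"
        using exp[of y x] False by (simp add: E_def power2_commute[of x y])
      have "\<bar>y - x\<bar> * \<bar>g x - g y\<bar> \<le> \<bar>y - x\<bar> * (A * \<bar>x - y\<bar>)"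
        by (intro mult_left_mono lip) simp
      then have "\<bar>(y - x) * (g x - g y)\<bar> \<le> E" unfolding E by (simp add: abs_mult)
      moreover have "f y - f x - (y - x) * g x = - (f x - f y - (x - y) * g y) - (y - x) * (g x - g y)"
        by (simp add: algebra_simps)
      ultimately show ?thesis unfolding E using e by linarith
    qed
  qed
qed

text \<open>The modulus \<open>A\<close> may blow up at time 0. Near \<open>t0\<close> it is bounded
  by \<open>A (t0 / 2)\<close>, which is why \<open>T\<close> has to be closed under halving; if
  \<open>t0 = 0\<close> belongs to \<open>T\<close>, the bound is \<open>A 0\<close>.\<close>

lemma continuous_on_of_moduli:
  fixes f :: "real \<Rightarrow> real \<Rightarrow> real"
  assumes T: "T \<subseteq> {0..}" "\<And>t. t \<in> T \<Longrightarrow> t / 2 \<in> T"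
    and A: "\<And>s t. s \<in> T \<Longrightarrow> t \<in> T \<Longrightarrow> s \<le> t \<Longrightarrow> A t \<le> A s" "\<And>t. t \<in> T \<Longrightarrow> 0 \<le> A t"
    and x: "\<And>x y t. t \<in> T \<Longrightarrow> \<bar>f y t - f x t\<bar> \<le> A t * \<bar>y - x\<bar>"
    and t: "\<And>x t s. t \<in> T \<Longrightarrow> 0 \<le> s \<Longrightarrow> \<bar>f x (t + s) - f x t\<bar> \<le> A t * sqrt s"
  shows "continuous_on (UNIV \<times> T) (\<lambda>(x, t). f x t)"
  unfolding continuous_on_def
proof
  fix z assume z: "z \<in> (UNIV :: real set) \<times> T"
  define x0 t0 where "x0 = fst z" "t0 = snd z"
  have z_eq: "z = (x0, t0)" by (simp add: x0_t0_def)
  have t0: "t0 \<in> T" "0 \<le> t0" using z T by (auto simp: z_eq)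
  define a where "a = A (t0 / 2)"
  have "((\<lambda>w. a * \<bar>fst w - x0\<bar> + a * sqrt \<bar>snd w - t0\<bar>) \<longlongrightarrow> a * \<bar>fst z - x0\<bar> + a * sqrt \<bar>snd z - t0\<bar>)
      (at z within UNIV \<times> T)"
    by (intro tendsto_intros)
  then have lim: "((\<lambda>w. a * \<bar>fst w - x0\<bar> + a * sqrt \<bar>snd w - t0\<bar>) \<longlongrightarrow> 0) (at z within UNIV \<times> T)"
    by (simp add: z_eq)
  have ev: "eventually (\<lambda>w. t0 / 2 \<le> snd w) (at z within UNIV \<times> T)"
  proof (cases "t0 = 0")
    case True
    then show ?thesis using T by (auto simp: eventually_at_filter intro!: always_eventually)
  next
    case False
    have "(snd \<longlongrightarrow> t0) (at z within UNIV \<times> T)" unfolding z_eq by (rule tendsto_eq_intros refl tendsto_ident_at | simp)+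
    then have "eventually (\<lambda>w. t0 / 2 < snd w) (at z within UNIV \<times> T)"
      by (rule order_tendstoD) (use False t0 in simp)
    then show ?thesis by eventually_elim simp
  qed
  have "eventually (\<lambda>w. w \<in> UNIV \<times> T) (at z within UNIV \<times> T)"
    by (simp add: eventually_at_filter)
  with ev have "eventually (\<lambda>w. norm ((case w of (x, t) \<Rightarrow> f x t) - f x0 t0)
      \<le> a * \<bar>fst w - x0\<bar> + a * sqrt \<bar>snd w - t0\<bar>) (at z within UNIV \<times> T)"
  proof eventually_elim
    case (elim w)
    obtain y s where w: "w = (y, s)" by force
    have s: "s \<in> T" "t0 / 2 \<le> s" using elim by (auto simp: w)
    have th: "t0 / 2 \<in> T" using T t0 by blast
    have "\<bar>f y s - f x0 s\<bar> \<le> A s * \<bar>y - x0\<bar>" by (rule x[OF s(1)])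
    also have "\<dots> \<le> a * \<bar>y - x0\<bar>" unfolding a_def by (intro mult_right_mono A(1) th s) simp
    finally have 1: "\<bar>f y s - f x0 s\<bar> \<le> a * \<bar>y - x0\<bar>" .
    have 2: "\<bar>f x0 s - f x0 t0\<bar> \<le> a * sqrt \<bar>s - t0\<bar>"
    proof (cases "t0 \<le> s")
      case True
      have "\<bar>f x0 (t0 + (s - t0)) - f x0 t0\<bar> \<le> A t0 * sqrt (s - t0)"
        by (rule t) (use t0 True in auto)
      also have "\<dots> \<le> a * sqrt (s - t0)"
        unfolding a_def using True t0 by (intro mult_right_mono A(1) th t0) auto
      finally show ?thesis using True by simp
    next
      case False
      have "\<bar>f x0 (s + (t0 - s)) - f x0 s\<bar> \<le> A s * sqrt (t0 - s)"
        by (rule t) (use s False in auto)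
      also have "\<dots> \<le> a * sqrt (t0 - s)"
        unfolding a_def using False t0 by (intro mult_right_mono A(1) th s) auto
      finally show ?thesis using False by (simp add: abs_minus_commute)
    qed
    from 1 2 show ?case by (simp add: w)
  qed
  then have "((\<lambda>w. case w of (x, t) \<Rightarrow> f x t) \<longlongrightarrow> f x0 t0) (at z within UNIV \<times> T)"
    by (rule Lim_null[THEN iffD2, OF Lim_null_comparison[OF _ lim]])
  then show "((\<lambda>(x, t). f x t) \<longlongrightarrow> (case z of (x, t) \<Rightarrow> f x t)) (at z within UNIV \<times> T)"
    by (simp add: z_eq)
qed

lemma second_derivative_local_max:
  fixes w :: "real \<Rightarrow> real"
  assumes d: "\<And>y. (w has_real_derivative w' y) (at y)" and dd: "(w' has_real_derivative D) (at x)"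
    and max: "eventually (\<lambda>y. w y \<le> w x) (nhds x)"
  shows "D \<le> 0"
proof (rule ccontr)
  assume "\<not> D \<le> 0"
  obtain \<delta> where \<delta>: "0 < \<delta>" "\<And>y. \<bar>y - x\<bar> < \<delta> \<Longrightarrow> w y \<le> w x"
    using max unfolding eventually_nhds_metric dist_real_def by blast
  have w0: "w' x = 0"
    by (rule DERIV_local_max[OF d \<delta>(1)]) (use \<delta>(2) in \<open>auto simp: abs_minus_commute\<close>)
  obtain \<eta> where \<eta>: "0 < \<eta>" "\<And>h. 0 < h \<Longrightarrow> h < \<eta> \<Longrightarrow> w' x < w' (x + h)"
    using DERIV_pos_inc_right[OF dd] \<open>\<not> D \<le> 0\<close> by auto
  define h where "h = min \<delta> \<eta> / 2"
  have h: "0 < h" "h < \<delta>" "h < \<eta>" using \<delta> \<eta> by (auto simp: h_def min_def)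
  obtain z where z: "x < z" "z < x + h" "w (x + h) - w x = (x + h - x) * w' z"
    using MVT2[of x "x + h" w w'] h d by auto
  have "0 < w' z" using \<eta>(2)[of "z - x"] z h w0 by simp
  then have "0 < h * w' z" using h by simp
  then have "w x < w (x + h)" using z(3) by simp
  with \<delta>(2)[of "x + h"] h show False by simp
qed

lemma eventually_nhds_slices:
  assumes "\<forall>\<^sub>F (y, s) in nhds (x :: real, t :: real). P y s"
  shows "\<forall>\<^sub>F y in nhds x. P y t" "\<forall>\<^sub>F s in nhds t. P x s"
proof -
  have "filterlim (\<lambda>y. (y, t)) (nhds (x, t)) (nhds x)" "filterlim (\<lambda>s. (x, s)) (nhds (x, t)) (nhds t)"
    by (intro tendsto_intros filterlim_ident)+
  from this[THEN filterlim_iff[THEN iffD1], rule_format, OF assms]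
  show "\<forall>\<^sub>F y in nhds x. P y t" "\<forall>\<^sub>F s in nhds t. P x s" by simp_all
qed

lemma test_functionD:
  assumes "test_function p pt px pxx" "0 < t"
  shows "((\<lambda>s. p x s) has_real_derivative pt x t) (at t)"
    "((\<lambda>y. p y t) has_real_derivative px x t) (at x)"
    "((\<lambda>y. px y t) has_real_derivative pxx x t) (at x)"
  using assms unfolding test_function_def by blast+

text \<open>A local maximum at a positive time is one along each coordinate axis, so the first
  derivative in time and the second derivative in space can be compared separately.\<close>

lemma classical_touching:
  assumes u: "test_function u ut ux uxx" and p: "test_function p pt px pxx" and t: "0 < t"
    and max: "\<forall>\<^sub>F (y, s) in nhds (x, t). u y s - p y s \<le> u x t - p x t"
  shows "pt x t = ut x t" "uxx x t \<le> pxx x t"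
proof -
  note ev = eventually_nhds_slices[OF max]
  note du = test_functionD[OF u t] and dp = test_functionD[OF p t]
  obtain \<delta> where \<delta>: "0 < \<delta>" "\<And>s. \<bar>s - t\<bar> < \<delta> \<Longrightarrow> u x s - p x s \<le> u x t - p x t"
    using ev(2) unfolding eventually_nhds_metric dist_real_def by blast
  have "ut x t - pt x t = 0"
    by (rule DERIV_local_max[OF DERIV_diff[OF du(1) dp(1)] \<delta>(1)]) (use \<delta>(2) in \<open>auto simp: abs_minus_commute\<close>)
  then show "pt x t = ut x t" by simp
  have "uxx x t - pxx x t \<le> 0"
    by (rule second_derivative_local_max[OF DERIV_diff[OF du(2) dp(2)] DERIV_diff[OF du(3) dp(3)] ev(1)])
  then show "uxx x t \<le> pxx x t" by simp
qed

lemma test_function_uminus: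
  "test_function p pt px pxx \<Longrightarrow>
    test_function (\<lambda>x t. - p x t) (\<lambda>x t. - pt x t) (\<lambda>x t. - px x t) (\<lambda>x t. - pxx x t)"
  unfolding test_function_def
  by (auto intro!: DERIV_minus continuous_on_minus simp: case_prod_unfold)

lemma classical_viscosity:
  assumes \<beta>: "1 \<le> \<beta>" and u: "test_function u ut ux uxx"
    and eq: "\<And>x t. 0 < t \<Longrightarrow> ut x t = G \<beta> (uxx x t)"
  shows "viscosity_subsolution \<beta> u" "viscosity_supersolution \<beta> u"
proof -
  show "viscosity_subsolution \<beta> u"
    unfolding viscosity_subsolution_def
  proof (intro allI impI)
    fix p pt px pxx x t
    assume p: "test_function p pt px pxx" and t: "0 < t"
      and max: "\<forall>\<^sub>F (y, s) in nhds (x, t). u y s - p y s \<le> u x t - p x t"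
    from classical_touching[OF u p t max] G_mono[OF \<beta>, of "uxx x t" "pxx x t"] eq[OF t, of x]
    show "pt x t - G \<beta> (pxx x t) \<le> 0" by simp
  qed
  show "viscosity_supersolution \<beta> u"
    unfolding viscosity_supersolution_def
  proof (intro allI impI)
    fix p pt px pxx x t
    assume p: "test_function p pt px pxx" and t: "0 < t"
      and min: "\<forall>\<^sub>F (y, s) in nhds (x, t). u x t - p x t \<le> u y s - p y s"
    have "\<forall>\<^sub>F (y, s) in nhds (x, t). - u y s - - p y s \<le> - u x t - - p x t"
      using min by (rule eventually_mono) auto
    from classical_touching[OF test_function_uminus[OF u] test_function_uminus[OF p] t this]
      G_mono[OF \<beta>, of "pxx x t" "uxx x t"] eq[OF t, of x]
    show "0 \<le> pt x t - G \<beta> (pxx x t)" by simp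
  qed
qed

text \<open>The penalty grows in space and in time, so neither a bounded domain nor a final time is
  required. \<epsilon> is so small that the penalized function stays positive at
  \<open>(x0, t0)\<close>. It is negative outside the box \<open>S\<close> and nonpositive at time
  0, which forces the maximum to a positive time.\<close>

lemma penalized_max:
  fixes z :: "real \<Rightarrow> real \<Rightarrow> real"
  assumes cont: "continuous_on (UNIV \<times> {0..}) (\<lambda>(x, t). z x t)"
    and bdd: "\<And>x t. 0 \<le> t \<Longrightarrow> z x t \<le> B" and init: "\<And>x. z x 0 \<le> 0"
    and pos: "0 < z x0 t0" "0 \<le> t0" and K: "0 < K"
  obtains \<epsilon> x1 t1 where "0 < \<epsilon>" "0 < t1"
    "\<And>y s. 0 \<le> s \<Longrightarrow> z y s - \<epsilon> * (y\<^sup>2 + K * s) \<le> z x1 t1 - \<epsilon> * (x1\<^sup>2 + K * t1)"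
proof -
  define \<epsilon> where "\<epsilon> = z x0 t0 / (2 * (x0\<^sup>2 + K * t0 + 1))"
  have q: "0 \<le> x0\<^sup>2 + K * t0" using pos K by simp
  have \<epsilon>: "0 < \<epsilon>" using pos q by (simp add: \<epsilon>_def)
  define \<Phi> where "\<Phi> y s = z y s - \<epsilon> * (y\<^sup>2 + K * s)" for y s
  have "\<epsilon> * (x0\<^sup>2 + K * t0 + 1) = z x0 t0 / 2" using q by (simp add: \<epsilon>_def field_simps)
  then have \<Phi>0: "0 < \<Phi> x0 t0" using pos \<epsilon> by (simp add: \<Phi>_def algebra_simps)
  define \<rho> where "\<rho> = \<bar>B\<bar> / \<epsilon> + x0\<^sup>2 + K * t0 + 1"
  have \<rho>: "1 \<le> \<rho>" "\<bar>B\<bar> / \<epsilon> < \<rho>" "x0\<^sup>2 + 1 \<le> \<rho>" "K * t0 \<le> \<rho>" "0 \<le> \<bar>B\<bar> / \<epsilon>"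
  proof -
    show nn: "0 \<le> \<bar>B\<bar> / \<epsilon>" using \<epsilon> by simp
    have "0 \<le> x0\<^sup>2" "0 \<le> K * t0" using pos K by simp_all
    with nn show "1 \<le> \<rho>" "\<bar>B\<bar> / \<epsilon> < \<rho>" "x0\<^sup>2 + 1 \<le> \<rho>" "K * t0 \<le> \<rho>"
      unfolding \<rho>_def by linarith+
  qed
  define S where "S = {-\<rho>..\<rho>} \<times> {0..\<rho> / K}"
  have "compact S" unfolding S_def by (intro compact_Times) auto
  moreover have "continuous_on S (\<lambda>(y, s). \<Phi> y s)"
  proof -
    have "continuous_on S (\<lambda>(x, t). z x t)"
      by (rule continuous_on_subset[OF cont]) (auto simp: S_def)
    then show ?thesis unfolding \<Phi>_def case_prod_unfold by (intro continuous_intros)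
  qed
  moreover have x0S: "(x0, t0) \<in> S"
  proof -
    have "\<bar>x0\<bar> \<le> \<rho>"
    proof -
      have "0 \<le> (\<bar>x0\<bar> - 1 / 2)\<^sup>2" by simp
      then have "\<bar>x0\<bar> \<le> x0\<^sup>2 + 1 / 4" by (simp add: power2_eq_square algebra_simps)
      then show ?thesis using \<rho> by linarith
    qed
    then show ?thesis using \<rho> K pos by (auto simp: S_def abs_le_iff pos_le_divide_eq mult.commute)
  qed
  ultimately obtain w where w: "w \<in> S" "\<And>w'. w' \<in> S \<Longrightarrow> (\<lambda>(y, s). \<Phi> y s) w' \<le> (\<lambda>(y, s). \<Phi> y s) w"
    using continuous_attains_sup[of S "\<lambda>(y, s). \<Phi> y s"] by blast
  obtain x1 t1 where w_eq: "w = (x1, t1)" by force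
  have max: "\<Phi> y s \<le> \<Phi> x1 t1" if "(y, s) \<in> S" for y s using w(2)[OF that] by (simp add: w_eq)
  have \<Phi>1: "0 < \<Phi> x1 t1" using max[OF x0S] \<Phi>0 by linarith
  have t1: "0 \<le> t1" using w(1) by (simp add: w_eq S_def)
  have "t1 \<noteq> 0"
  proof
    assume "t1 = 0"
    moreover have "0 \<le> \<epsilon> * x1\<^sup>2" using \<epsilon> by simp
    ultimately have "\<Phi> x1 t1 \<le> 0" using init[of x1] by (simp add: \<Phi>_def)
    with \<Phi>1 show False by simp
  qed
  have out: "\<Phi> y s < 0" if "(y, s) \<notin> S" "0 \<le> s" for y s
  proof -
    have "\<rho> < y\<^sup>2 + K * s"
    proof (cases "\<bar>y\<bar> \<le> \<rho>")
      case True
      then have "\<rho> / K < s" using that by (auto simp: S_def abs_le_iff)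
      then have "\<rho> < K * s" using K by (simp add: pos_divide_less_eq mult.commute)
      moreover have "0 \<le> y\<^sup>2" by simp
      ultimately show ?thesis by linarith
    next
      case False
      then have "\<rho> * 1 < \<bar>y\<bar> * \<bar>y\<bar>" using \<rho> by (intro mult_strict_mono') auto
      moreover have "0 \<le> K * s" using K that by simp
      ultimately show ?thesis by (simp add: power2_eq_square)
    qed
    then have "\<bar>B\<bar> / \<epsilon> < y\<^sup>2 + K * s" using \<rho> by linarith
    then have "\<bar>B\<bar> < \<epsilon> * (y\<^sup>2 + K * s)" using \<epsilon> by (simp add: pos_divide_less_eq mult.commute)
    then show ?thesis using bdd[OF that(2), of y] by (simp add: \<Phi>_def)
  qed
  show ?thesis
  proof (rule that[OF \<epsilon>, of t1 x1])
    show "0 < t1" using t1 \<open>t1 \<noteq> 0\<close> by simp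
    fix y s :: real assume "0 \<le> s"
    then show "z y s - \<epsilon> * (y\<^sup>2 + K * s) \<le> z x1 t1 - \<epsilon> * (x1\<^sup>2 + K * t1)"
      using max[of y s] out[of y s] \<Phi>1 unfolding \<Phi>_def[symmetric] by (cases "(y, s) \<in> S") auto
  qed
qed

lemma test_function_add_quadratic:
  assumes "test_function u ut ux uxx"
  shows "test_function (\<lambda>x t. u x t + e * (x\<^sup>2 + K * t)) (\<lambda>x t. ut x t + e * K)
    (\<lambda>x t. ux x t + e * (2 * x)) (\<lambda>x t. uxx x t + e * 2)"
proof -
  have c: "continuous_on (UNIV \<times> {0<..}) (\<lambda>(x, t). ut x t + e * K)"
    "continuous_on (UNIV \<times> {0<..}) (\<lambda>(x, t). ux x t + e * (2 * x))"
    "continuous_on (UNIV \<times> {0<..}) (\<lambda>(x, t). uxx x t + e * 2)"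
    using assms unfolding test_function_def case_prod_unfold by (auto intro!: continuous_intros)
  have "((\<lambda>s. u x s + e * (x\<^sup>2 + K * s)) has_real_derivative ut x t + e * K) (at t)"
    "((\<lambda>y. u y t + e * (y\<^sup>2 + K * t)) has_real_derivative ux x t + e * (2 * x)) (at x)"
    "((\<lambda>y. ux y t + e * (2 * y)) has_real_derivative uxx x t + e * 2) (at x)" if t: "0 < t" for x t
    by (auto intro!: derivative_eq_intros test_functionD[OF assms t])
  with c show ?thesis unfolding test_function_def by blast
qed

lemma eventually_nhds_pos_time:
  assumes "0 < (t :: real)" "\<And>y s. 0 \<le> s \<Longrightarrow> P y s"
  shows "\<forall>\<^sub>F (y, s) in nhds (x :: real, t). P y s"
proof -
  have "open (UNIV \<times> {0<..} :: (real \<times> real) set)" by (intro open_Times) auto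
  then have "\<forall>\<^sub>F w in nhds (x, t). w \<in> UNIV \<times> {0<..}"
    by (rule eventually_nhds_in_open) (use assms in auto)
  then show ?thesis by (rule eventually_mono) (use assms in auto)
qed

text \<open>The smooth solution plus the penalty is itself a test function for \<open>v\<close>, so
  viscosity solutions need not be regularized. The penalty adds \<open>\<epsilon> * K\<close> to the
  time derivative but at most \<open>16 * ell_up \<beta> * \<epsilon>\<close> to \<open>G\<close>;
  \<open>K\<close> exceeds this factor by 1, which gives the contradiction. The opposite inequality
  subtracts the penalty.\<close>

lemma classical_unique:
  assumes \<beta>: "1 \<le> \<beta>" and u: "test_function u ut ux uxx"
    and eq: "\<And>x t. 0 < t \<Longrightarrow> ut x t = G \<beta> (uxx x t)"
    and cu: "continuous_on (UNIV \<times> {0..}) (\<lambda>(x, t). u x t)"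
    and bu: "\<And>x t. 0 \<le> t \<Longrightarrow> \<bar>u x t\<bar> \<le> B" and iu: "\<And>x. u x 0 = \<phi> x"
    and v: "G_heat_solution \<beta> \<phi> v" and t: "0 \<le> t"
  shows "v x t = u x t"
proof -
  have cv: "continuous_on (UNIV \<times> {0..}) (\<lambda>(x, t). v x t)" and iv: "\<And>x. v x 0 = \<phi> x"
    and sub: "viscosity_subsolution \<beta> v" and super: "viscosity_supersolution \<beta> v"
    using v unfolding G_heat_solution_def by auto
  have "bounded ((\<lambda>(x, t). v x t) ` (UNIV \<times> {0..}))" using v unfolding G_heat_solution_def by auto
  then obtain B' where "\<forall>y\<in>(\<lambda>(x, t). v x t) ` (UNIV \<times> {0..}). norm y \<le> B'"
    unfolding bounded_iff by blast
  then have B': "\<bar>v x t\<bar> \<le> B'" if "0 \<le> t" for x t using that by force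
  define K where "K = 16 * ell_up \<beta> + 1"
  have K: "0 < K" using ell_bounds[OF \<beta>] by (simp add: K_def)
  have "\<not> 0 < v x t - u x t"
  proof
    assume pos: "0 < v x t - u x t"
    have cz: "continuous_on (UNIV \<times> {0..}) (\<lambda>(x, t). v x t - u x t)"
      using continuous_on_diff[OF cv cu] by (simp add: case_prod_unfold)
    have bz: "v x t - u x t \<le> B' + B" if "0 \<le> t" for x t
      using B'[OF that, of x] bu[OF that, of x] by linarith
    obtain \<epsilon> x1 t1 where m: "0 < \<epsilon>" "0 < t1"
      "\<And>y s. 0 \<le> s \<Longrightarrow> v y s - u y s - \<epsilon> * (y\<^sup>2 + K * s) \<le> v x1 t1 - u x1 t1 - \<epsilon> * (x1\<^sup>2 + K * t1)"
      by (rule penalized_max[of "\<lambda>x t. v x t - u x t" "B' + B" x t K, OF cz bz _ pos t K])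
        (auto simp: iu iv)
    have "ut x1 t1 + \<epsilon> * K - G \<beta> (uxx x1 t1 + \<epsilon> * 2) \<le> 0"
    proof (rule sub[unfolded viscosity_subsolution_def, rule_format, OF test_function_add_quadratic[OF u] m(2)])
      show "\<forall>\<^sub>F (y, s) in nhds (x1, t1). v y s - (u y s + \<epsilon> * (y\<^sup>2 + K * s))
          \<le> v x1 t1 - (u x1 t1 + \<epsilon> * (x1\<^sup>2 + K * t1))"
        by (rule eventually_nhds_pos_time[OF m(2)]) (use m(3) in \<open>simp add: algebra_simps\<close>)
    qed
    moreover have "G \<beta> (uxx x1 t1 + \<epsilon> * 2) \<le> G \<beta> (uxx x1 t1) + 16 * ell_up \<beta> * \<epsilon>"
      using G_diff_bounds(2)[OF \<beta>, of "uxx x1 t1" "uxx x1 t1 + \<epsilon> * 2"] m(1) by simp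
    ultimately show False using eq[OF m(2), of x1] m(1) by (simp add: K_def algebra_simps)
  qed
  moreover have "\<not> 0 < u x t - v x t"
  proof
    assume pos: "0 < u x t - v x t"
    have cz: "continuous_on (UNIV \<times> {0..}) (\<lambda>(x, t). u x t - v x t)"
      using continuous_on_diff[OF cu cv] by (simp add: case_prod_unfold)
    have bz: "u x t - v x t \<le> B + B'" if "0 \<le> t" for x t
      using B'[OF that, of x] bu[OF that, of x] by linarith
    obtain \<epsilon> x1 t1 where m: "0 < \<epsilon>" "0 < t1"
      "\<And>y s. 0 \<le> s \<Longrightarrow> u y s - v y s - \<epsilon> * (y\<^sup>2 + K * s) \<le> u x1 t1 - v x1 t1 - \<epsilon> * (x1\<^sup>2 + K * t1)"
      by (rule penalized_max[of "\<lambda>x t. u x t - v x t" "B + B'" x t K, OF cz bz _ pos t K])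
        (auto simp: iu iv)
    have "0 \<le> ut x1 t1 + (- \<epsilon>) * K - G \<beta> (uxx x1 t1 + (- \<epsilon>) * 2)"
    proof (rule super[unfolded viscosity_supersolution_def, rule_format, OF test_function_add_quadratic[OF u] m(2)])
      show "\<forall>\<^sub>F (y, s) in nhds (x1, t1). v x1 t1 - (u x1 t1 + (- \<epsilon>) * (x1\<^sup>2 + K * t1))
          \<le> v y s - (u y s + (- \<epsilon>) * (y\<^sup>2 + K * s))"
        by (rule eventually_nhds_pos_time[OF m(2)]) (use m(3) in \<open>simp add: algebra_simps\<close>)
    qed
    moreover have "G \<beta> (uxx x1 t1) - 16 * ell_up \<beta> * \<epsilon> \<le> G \<beta> (uxx x1 t1 + (- \<epsilon>) * 2)"
      using G_diff_bounds(2)[OF \<beta>, of "uxx x1 t1 + (- \<epsilon>) * 2" "uxx x1 t1"] m(1) by simp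
    ultimately show False using eq[OF m(2), of x1] m(1) by (simp add: K_def algebra_simps)
  qed
  ultimately show ?thesis by simp
qed

section \<open>The classical solution\<close>

context G_heat_limit
begin

definition "C3 = C2 / ell_lo \<beta>"

lemmas p_expansion3 = p_expansion[folded C3_def] and v_lip3 = v_lip[folded C3_def]
  and v_time3 = v_time[folded C3_def]

text \<open>One constant for all estimates, depending on \<beta> alone; being at least 8, it absorbs
  the factors \<open>sqrt 8\<close> caused by the time step of the scheme.\<close>

definition "C4 = C1 + C2 + 8 * (1 + C3)"

lemma C4_bounds:
  "0 \<le> C3" "C1 \<le> C4" "C3 \<le> C4" "1 \<le> C4" "0 \<le> C4" "8 \<le> C4" "3 * C2 \<le> 3 * C4"
proof -
  show nn: "0 \<le> C3" using C2 ell_bounds[OF \<beta>] by (simp add: C3_def)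
  show "C1 \<le> C4" "C3 \<le> C4" "1 \<le> C4" "0 \<le> C4" "8 \<le> C4" "3 * C2 \<le> 3 * C4"
    using C1 C2 nn unfolding C4_def by (simp_all add: algebra_simps)
qed

lemma u_xx: "0 < t \<Longrightarrow> ((\<lambda>y. p y t) has_real_derivative v x t) (at x)"
  by (rule has_real_derivative_of_expansion[of "\<lambda>y. p y t" "\<lambda>y. v y t" "C3 / (8 * t)"])
    (use p_expansion3[of t] v_lip3[of t] in \<open>simp_all add: mult_ac\<close>)

lemma p_lip:
  assumes t: "0 < t"
  shows "\<bar>p y t - p x t\<bar> \<le> C1 * \<bar>y - x\<bar> / sqrt (8 * t)"
proof -
  have "norm (p y t - p x t) \<le> C1 / sqrt (8 * t) * norm (y - x)"
    by (rule field_differentiable_bound[of UNIV "\<lambda>y. p y t" "\<lambda>y. v y t"])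
      (use u_xx[OF t] v_bdd[OF t] in auto)
  then show ?thesis by simp
qed

lemma u_x: "0 < t \<Longrightarrow> ((\<lambda>y. u y t) has_real_derivative p x t) (at x)"
  by (rule has_real_derivative_of_expansion[of "\<lambda>y. u y t" "\<lambda>y. p y t" "C1 / sqrt (8 * t)"])
    (use u_expansion[of t] p_lip[of t] in \<open>simp_all add: mult_ac\<close>)

text \<open>The expansion only runs forward in time. For \<open>s < t\<close> it is started at
  \<open>s > t/2\<close>, where the constants are still controlled by \<open>t\<close>, and
  \<open>v x s\<close> is then exchanged for \<open>v x t\<close> by the time modulus.\<close>

lemma u_t:
  assumes t: "0 < t"
  shows "((\<lambda>s. u x s) has_real_derivative G \<beta> (v x t)) (at t)"
proof (rule has_real_derivative_of_bound)
  define L where "L = C3"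
  define A where "A = 2 * (C2 + L) / t"
  show "((\<lambda>s. A * sqrt (8 * \<bar>s - t\<bar>)) \<longlongrightarrow> 0) (at t)" by (auto intro!: tendsto_eq_intros)
  have "eventually (\<lambda>s. t / 2 < s) (at t)"
    using eventually_at_in_open[of "{t/2<..}" t] t by (auto elim: eventually_mono)
  then show "eventually (\<lambda>s. \<bar>u x s - u x t - (s - t) * G \<beta> (v x t)\<bar> \<le> A * sqrt (8 * \<bar>s - t\<bar>) * \<bar>s - t\<bar>) (at t)"
  proof eventually_elim
    case (elim s)
    have L: "0 \<le> L" using C4_bounds(1) by (simp add: L_def)
    define r where "r = sqrt (8 * \<bar>s - t\<bar>)"
    have r: "0 \<le> r" by (simp add: r_def)
    show ?case
    proof (cases "t \<le> s")
      case True
      have "\<bar>u x (t + (s - t)) - u x t - (s - t) * G \<beta> (v x t)\<bar> \<le> C2 * (s - t) * sqrt (8 * (s - t)) / t"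
        by (rule u_time_expansion) (use t True in auto)
      also have "\<dots> = (C2 / t) * r * \<bar>s - t\<bar>" using True by (simp add: r_def)
      also have "\<dots> \<le> A * r * \<bar>s - t\<bar>"
        unfolding A_def using C2 L t r by (intro mult_right_mono divide_right_mono) auto
      finally show ?thesis by (simp add: r_def)
    next
      case False
      have s: "0 < s" using elim t by linarith
      have inv: "1 / s \<le> 2 / t" "1 / (8 * s) \<le> 1 / t" using elim t s by (auto simp: field_simps)
      have "\<bar>u x (s + (t - s)) - u x s - (t - s) * G \<beta> (v x s)\<bar> \<le> C2 * (t - s) * sqrt (8 * (t - s)) / s"
        by (rule u_time_expansion) (use s False in auto)
      also have "\<dots> = C2 * (t - s) * r * (1 / s)" using False by (simp add: r_def)
      also have "\<dots> \<le> C2 * (t - s) * r * (2 / t)"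
        using inv C2 False r by (intro mult_left_mono mult_nonneg_nonneg) auto
      finally have 1: "\<bar>u x t - u x s - (t - s) * G \<beta> (v x s)\<bar> \<le> C2 * (t - s) * r * (2 / t)" by simp
      have "\<bar>v x (s + (t - s)) - v x s\<bar> \<le> C3 * sqrt (8 * (t - s)) / (8 * s)"
        by (rule v_time3) (use s False in auto)
      then have v: "\<bar>v x t - v x s\<bar> \<le> L * r * (1 / (8 * s))" using False by (simp add: L_def r_def)
      have "\<bar>G \<beta> (v x t) - G \<beta> (v x s)\<bar> \<le> 8 * ell_up \<beta> * \<bar>v x t - v x s\<bar>"
        by (rule G_abs_diff_bounds(2)[OF \<beta>])
      also have "\<dots> \<le> 2 * \<bar>v x t - v x s\<bar>" using ell_bounds[OF \<beta>] by (intro mult_right_mono) auto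
      also have "\<dots> \<le> 2 * (L * r * (1 / (8 * s)))" using v by simp
      also have "\<dots> \<le> 2 * (L * r * (1 / t))"
        using inv(2) L r by (intro mult_left_mono) auto
      finally have "(t - s) * \<bar>G \<beta> (v x t) - G \<beta> (v x s)\<bar> \<le> (t - s) * (2 * (L * r * (1 / t)))"
        using False by (intro mult_left_mono) auto
      then have 2: "\<bar>(t - s) * (G \<beta> (v x t) - G \<beta> (v x s))\<bar> \<le> L * (t - s) * r * (2 / t)"
      proof -
        have "\<bar>(t - s) * (G \<beta> (v x t) - G \<beta> (v x s))\<bar> = (t - s) * \<bar>G \<beta> (v x t) - G \<beta> (v x s)\<bar>"
          using False by (simp add: abs_mult)
        moreover have "(t - s) * (2 * (L * r * (1 / t))) = L * (t - s) * r * (2 / t)" by simp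
        ultimately show ?thesis
          using \<open>(t - s) * \<bar>G \<beta> (v x t) - G \<beta> (v x s)\<bar> \<le> (t - s) * (2 * (L * r * (1 / t)))\<close>
          by (simp only:)
      qed
      have "u x s - u x t - (s - t) * G \<beta> (v x t) =
        - (u x t - u x s - (t - s) * G \<beta> (v x s)) + (t - s) * (G \<beta> (v x t) - G \<beta> (v x s))"
        by (simp add: algebra_simps)
      then have "\<bar>u x s - u x t - (s - t) * G \<beta> (v x t)\<bar>
          \<le> C2 * (t - s) * r * (2 / t) + L * (t - s) * r * (2 / t)"
        using 1 2 by linarith
      also have "\<dots> = A * r * \<bar>s - t\<bar>" using False t by (simp add: A_def field_simps)
      finally show ?thesis by (simp add: r_def)
    qed
  qed
qed

lemma continuous_u: "continuous_on (UNIV \<times> {0..}) (\<lambda>(x, t). u x t)"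
proof (rule continuous_on_of_moduli[where A = "\<lambda>_. 8"])
  fix x t s :: real assume "t \<in> {0..}" "0 \<le> s"
  then have "\<bar>u x (t + s) - u x t\<bar> \<le> sqrt (8 * s)" by (intro u_time) auto
  also have "\<dots> \<le> sqrt (64 * s)" using \<open>0 \<le> s\<close> by simp
  also have "\<dots> = 8 * sqrt s" by (simp add: real_sqrt_mult)
  finally show "\<bar>u x (t + s) - u x t\<bar> \<le> 8 * sqrt s" .
next
  fix x y t :: real
  show "\<bar>u y t - u x t\<bar> \<le> 8 * \<bar>y - x\<bar>" by (rule order_trans[OF u_lip]) simp
qed auto

lemma continuous_p: "continuous_on (UNIV \<times> {0<..}) (\<lambda>(x, t). p x t)"
proof (rule continuous_on_of_moduli[where A = "\<lambda>t. C1 * sqrt 8 / sqrt (8 * t)"])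
  fix x t s :: real assume "t \<in> {0<..}" "0 \<le> s"
  then show "\<bar>p x (t + s) - p x t\<bar> \<le> C1 * sqrt 8 / sqrt (8 * t) * sqrt s"
    using p_time[of t s x] by (simp add: real_sqrt_mult)
next
  fix x y t :: real assume "t \<in> {0<..}"
  then have "\<bar>p y t - p x t\<bar> \<le> C1 * \<bar>y - x\<bar> / sqrt (8 * t)" using p_lip[of t y x] by simp
  also have "\<dots> = C1 / sqrt (8 * t) * \<bar>y - x\<bar> * 1" by simp
  also have "\<dots> \<le> C1 / sqrt (8 * t) * \<bar>y - x\<bar> * sqrt 8"
    using C1 \<open>t \<in> {0<..}\<close> by (intro mult_left_mono) auto
  finally show "\<bar>p y t - p x t\<bar> \<le> C1 * sqrt 8 / sqrt (8 * t) * \<bar>y - x\<bar>" by (simp add: mult_ac)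
next
  fix s t :: real assume "s \<in> {0<..}" "t \<in> {0<..}" "s \<le> t"
  then show "C1 * sqrt 8 / sqrt (8 * t) \<le> C1 * sqrt 8 / sqrt (8 * s)"
    using C1 by (intro divide_left_mono) auto
qed (use C1 in auto)

lemma continuous_v: "continuous_on (UNIV \<times> {0<..}) (\<lambda>(x, t). v x t)"
proof (rule continuous_on_of_moduli[where A = "\<lambda>t. C3 * sqrt 8 / (8 * t)"])
  fix x t s :: real assume "t \<in> {0<..}" "0 \<le> s"
  then show "\<bar>v x (t + s) - v x t\<bar> \<le> C3 * sqrt 8 / (8 * t) * sqrt s"
    using v_time3[of t s x] by (simp add: real_sqrt_mult)
next
  fix x y t :: real assume t: "t \<in> {0<..}"
  then have "\<bar>v y t - v x t\<bar> \<le> C3 * \<bar>y - x\<bar> / (8 * t)" using v_lip3[of t y x] by simp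
  also have "\<dots> = C3 / (8 * t) * \<bar>y - x\<bar> * 1" by simp
  also have "\<dots> \<le> C3 / (8 * t) * \<bar>y - x\<bar> * sqrt 8"
    using C4_bounds(1) t by (intro mult_left_mono mult_nonneg_nonneg divide_nonneg_nonneg) auto
  finally show "\<bar>v y t - v x t\<bar> \<le> C3 * sqrt 8 / (8 * t) * \<bar>y - x\<bar>" by (simp add: mult_ac)
next
  fix s t :: real assume "s \<in> {0<..}" "t \<in> {0<..}" "s \<le> t"
  then show "C3 * sqrt 8 / (8 * t) \<le> C3 * sqrt 8 / (8 * s)"
    using C4_bounds(1) by (intro divide_left_mono mult_nonneg_nonneg) auto
next
  fix t :: real assume "t \<in> {0<..}"
  then show "0 \<le> C3 * sqrt 8 / (8 * t)"
    using C4_bounds(1) by (intro divide_nonneg_nonneg mult_nonneg_nonneg) auto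
qed auto

lemma test_function_u: "test_function u (\<lambda>x t. G \<beta> (v x t)) p v"
  unfolding test_function_def
proof (intro conjI allI impI)
  have "continuous_on (UNIV \<times> {0<..}) (\<lambda>z. G \<beta> (case z of (x, t) \<Rightarrow> v x t))"
    unfolding G_eq by (intro continuous_intros continuous_v)
  then show "continuous_on (UNIV \<times> {0<..}) (\<lambda>(x, t). G \<beta> (v x t))" by (simp add: case_prod_unfold)
qed (use u_t u_x u_xx continuous_p continuous_v in auto)

lemma G_heat_solution_u: "G_heat_solution \<beta> \<phi> u"
  unfolding G_heat_solution_def
proof (intro conjI allI)
  show "bounded ((\<lambda>(x, t). u x t) ` (UNIV \<times> {0..}))"
    unfolding bounded_iff by (rule exI[of _ M]) (use u_bdd in auto)
qed (use continuous_u u_init classical_viscosity[OF \<beta> test_function_u] in auto)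

lemma G_normal_eq: "G_normal \<beta> \<phi> = u 0 1"
  unfolding G_normal_def
proof (rule the_equality)
  show "\<exists>w. G_heat_solution \<beta> \<phi> w \<and> u 0 1 = w 0 1" using G_heat_solution_u by blast
  fix z assume "\<exists>w. G_heat_solution \<beta> \<phi> w \<and> z = w 0 1"
  then obtain w where w: "G_heat_solution \<beta> \<phi> w" "z = w 0 1" by blast
  show "z = u 0 1" unfolding w(2)
    by (rule classical_unique[OF \<beta> test_function_u _ continuous_u _ _ w(1)]) (use u_bdd u_init in auto)
qed

lemma v_bdd': "0 < t \<Longrightarrow> \<bar>v x t\<bar> \<le> C4 / sqrt t"
proof -
  assume t: "0 < t"
  have "\<bar>v x t\<bar> \<le> C1 / sqrt (8 * t)" by (rule v_bdd[OF t])
  also have "\<dots> \<le> C4 / sqrt t" using t C1 C4_bounds by (intro frac_le) auto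
  finally show ?thesis .
qed

lemma v_lip': "0 < t \<Longrightarrow> \<bar>v y t - v x t\<bar> \<le> C4 * \<bar>y - x\<bar> / t"
proof -
  assume t: "0 < t"
  have "\<bar>v y t - v x t\<bar> \<le> C3 * \<bar>y - x\<bar> / (8 * t)" by (rule v_lip3[OF t])
  also have "\<dots> \<le> C4 * \<bar>y - x\<bar> / t" using t C4_bounds by (intro frac_le mult_right_mono mult_nonneg_nonneg) auto
  finally show ?thesis .
qed

lemma u_time': "0 \<le> t \<Longrightarrow> 0 \<le> s \<Longrightarrow> \<bar>u x (t + s) - u x t\<bar> \<le> C4 * sqrt s"
proof -
  assume a: "0 \<le> t" "0 \<le> s"
  have "\<bar>u x (t + s) - u x t\<bar> \<le> sqrt (8 * s)" by (rule u_time[OF a])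
  also have "\<dots> \<le> sqrt (64 * s)" using a by simp
  also have "\<dots> = 8 * sqrt s" by (simp add: real_sqrt_mult)
  also have "\<dots> \<le> C4 * sqrt s" using C4_bounds a by (intro mult_right_mono) auto
  finally show ?thesis .
qed

lemma u_time_expansion': "0 < t \<Longrightarrow> 0 \<le> s \<Longrightarrow>
    \<bar>u x (t + s) - u x t - s * G \<beta> (v x t)\<bar> \<le> 3 * C4 * s * sqrt s / t"
proof -
  assume a: "0 < t" "0 \<le> s"
  have "sqrt (8 * s) \<le> sqrt (9 * s)" using a by simp
  then have sq: "sqrt (8 * s) \<le> 3 * sqrt s" by (simp add: real_sqrt_mult)
  have "\<bar>u x (t + s) - u x t - s * G \<beta> (v x t)\<bar> \<le> C2 * s * sqrt (8 * s) / t"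
    by (rule u_time_expansion[OF a])
  also have "\<dots> \<le> C2 * s * (3 * sqrt s) / t"
    using sq C2 a by (intro divide_right_mono mult_left_mono) auto
  also have "\<dots> = (3 * C2) * (s * sqrt s / t)" by simp
  also have "\<dots> \<le> (3 * C4) * (s * sqrt s / t)"
    using a C4_bounds by (intro mult_right_mono) auto
  finally show ?thesis by simp
qed

end

text \<open>All that Lindeberg's method has to know about the solution. The bound \<open>b\<close>
  may depend on \<phi> and only serves to place \<open>u\<close> in \<open>CbLip\<close> at each
  time; \<open>K\<close> is the constant that enters the error.\<close>

definition G_heat_regular ::
  "real \<Rightarrow> real \<Rightarrow> (real \<Rightarrow> real) \<Rightarrow> real \<Rightarrow> (real \<Rightarrow> real \<Rightarrow> real) \<Rightarrow>
    (real \<Rightarrow> real \<Rightarrow> real) \<Rightarrow> (real \<Rightarrow> real \<Rightarrow> real) \<Rightarrow> bool"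
where
  "G_heat_regular \<beta> K \<phi> b u ux uxx \<longleftrightarrow>
     (\<forall>x. u x 0 = \<phi> x) \<and> (\<forall>x t. \<bar>u x t\<bar> \<le> b) \<and> (\<forall>x y t. \<bar>u y t - u x t\<bar> \<le> \<bar>y - x\<bar>) \<and>
     (\<forall>x t s. 0 \<le> t \<longrightarrow> 0 \<le> s \<longrightarrow> \<bar>u x (t + s) - u x t\<bar> \<le> K * sqrt s) \<and>
     (\<forall>x t. 0 < t \<longrightarrow> ((\<lambda>y. u y t) has_real_derivative ux x t) (at x)) \<and>
     (\<forall>x t. 0 < t \<longrightarrow> ((\<lambda>y. ux y t) has_real_derivative uxx x t) (at x)) \<and>
     (\<forall>x t. 0 < t \<longrightarrow> \<bar>uxx x t\<bar> \<le> K / sqrt t) \<and>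
     (\<forall>x y t. 0 < t \<longrightarrow> \<bar>uxx y t - uxx x t\<bar> \<le> K * \<bar>y - x\<bar> / t) \<and>
     (\<forall>x t s. 0 < t \<longrightarrow> 0 \<le> s \<longrightarrow>
        \<bar>u x (t + s) - u x t - s * G \<beta> (uxx x t)\<bar> \<le> 3 * K * s * sqrt s / t)"

theorem G_heat_regularity:
  assumes \<beta>: "1 \<le> \<beta>"
  shows "\<exists>K>0. \<forall>\<phi>. \<phi> \<in> CbLip \<longrightarrow> 1-lipschitz_on UNIV \<phi> \<longrightarrow>
      (\<exists>b u ux uxx. G_normal \<beta> \<phi> = u 0 1 \<and> G_heat_regular \<beta> K \<phi> b u ux uxx)"
proof (rule exI, rule conjI, rule_tac [2] allI, rule_tac [2] impI, rule_tac [2] impI)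
  \<comment> \<open>The constant is a function of \<beta>, but its bounds are stated inside the
    locale; the zero datum provides an instance.\<close>
  have "G_heat_limit \<beta> 0 (\<lambda>_. 0)" by standard (use \<beta> in auto)
  then show "0 < G_heat_limit.C4 \<beta>" using G_heat_limit.C4_bounds(4) by fastforce
  fix \<phi> :: "real \<Rightarrow> real" assume \<phi>: "\<phi> \<in> CbLip" "1-lipschitz_on UNIV \<phi>"
  then obtain M where M: "\<And>x. \<bar>\<phi> x\<bar> \<le> M"
    unfolding CbLip_def bounded_iff by auto
  interpret G_heat_limit \<beta> M \<phi>
    by standard (use \<phi> M \<beta> in \<open>auto simp: lipschitz_on_def dist_real_def\<close>)
  have "G_heat_regular \<beta> C4 \<phi> M u p v"
    unfolding G_heat_regular_def
    by (intro conjI allI impI u_init u_bdd u_lip u_time' u_x u_xx v_bdd' v_lip' u_time_expansion')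
  with G_normal_eq show "\<exists>b u ux uxx. G_normal \<beta> \<phi> = u 0 1 \<and> G_heat_regular \<beta> C4 \<phi> b u ux uxx"
    by blast
qed

section \<open>Representing sets\<close>

text \<open>Homogeneity is asked for as an inequality, which is easy to verify for infima; using it
  for \<open>1 / c\<close> as well yields equality.\<close>

definition sublinear :: "('v::real_vector \<Rightarrow> real) \<Rightarrow> bool" where
  "sublinear q \<longleftrightarrow> (\<forall>x y. q (x + y) \<le> q x + q y) \<and> (\<forall>c>0. \<forall>x. q (c *\<^sub>R x) \<le> c * q x)"

lemma sublinear_add: "sublinear q \<Longrightarrow> q (x + y) \<le> q x + q y"
  by (simp add: sublinear_def)

lemma sublinear_scale:
  assumes q: "sublinear q" and c: "0 < c"
  shows "q (c *\<^sub>R x) = c * q x"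
proof (rule antisym)
  show "q (c *\<^sub>R x) \<le> c * q x" using assms by (simp add: sublinear_def)
  have "q ((1 / c) *\<^sub>R (c *\<^sub>R x)) \<le> (1 / c) * q (c *\<^sub>R x)"
    using q c unfolding sublinear_def by (metis zero_less_divide_1_iff)
  then show "c * q x \<le> q (c *\<^sub>R x)" using c by (simp add: field_simps)
qed

lemma sublinear_zero: "sublinear q \<Longrightarrow> q 0 = 0"
  using sublinear_scale[of q 2 0] by simp

lemma sublinear_scale0: "sublinear q \<Longrightarrow> 0 \<le> c \<Longrightarrow> q (c *\<^sub>R x) = c * q x"
  using sublinear_scale[of q c x] sublinear_zero[of q] by (cases "c = 0") auto

lemma sublinear_uminus: "sublinear q \<Longrightarrow> - q (- x) \<le> q x"
  using sublinear_add[of q x "- x"] sublinear_zero[of q] by simp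

text \<open>A sublinear functional below \<open>q\<close> whose value at \<open>- y\<close> is at
  most \<open>- q y\<close>, as \<open>t = 1\<close> shows. A linear functional below it therefore
  attains \<open>q y\<close> at \<open>y\<close>.\<close>

definition push_down :: "('v::real_vector \<Rightarrow> real) \<Rightarrow> 'v \<Rightarrow> 'v \<Rightarrow> real" where
  "push_down q y x = (INF t\<in>{0..}. q (x + t *\<^sub>R y) - t * q y)"

lemma push_down_bdd:
  assumes "sublinear q"
  shows "bdd_below ((\<lambda>t. q (x + t *\<^sub>R y) - t * q y) ` {0..})"
proof (rule bdd_belowI2)
  fix t :: real assume "t \<in> {0..}"
  then have "t * q y = q (t *\<^sub>R y)" using sublinear_scale0[OF assms] by simp
  also have "\<dots> \<le> q (x + t *\<^sub>R y) + q (- x)" using sublinear_add[OF assms, of "x + t *\<^sub>R y" "- x"] by simp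
  finally show "- q (- x) \<le> q (x + t *\<^sub>R y) - t * q y" by simp
qed

lemma push_down_le:
  "sublinear q \<Longrightarrow> 0 \<le> t \<Longrightarrow> push_down q y x \<le> q (x + t *\<^sub>R y) - t * q y"
  unfolding push_down_def by (rule cINF_lower[OF push_down_bdd]) auto

lemma sublinear_push_down:
  assumes q: "sublinear q"
  shows "sublinear (push_down q y)"
  unfolding sublinear_def
proof (intro conjI allI impI)
  fix x1 x2
  have "push_down q y (x1 + x2) - (q (x1 + s *\<^sub>R y) - s * q y) \<le> q (x2 + t *\<^sub>R y) - t * q y"
    if "0 \<le> s" "0 \<le> t" for s t
  proof -
    have "push_down q y (x1 + x2) \<le> q (x1 + x2 + (s + t) *\<^sub>R y) - (s + t) * q y"
      by (rule push_down_le[OF q]) (use that in auto)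
    also have "x1 + x2 + (s + t) *\<^sub>R y = (x1 + s *\<^sub>R y) + (x2 + t *\<^sub>R y)" by (simp add: algebra_simps)
    also have "q \<dots> \<le> q (x1 + s *\<^sub>R y) + q (x2 + t *\<^sub>R y)" by (rule sublinear_add[OF q])
    finally show ?thesis by (simp add: algebra_simps)
  qed
  then have "push_down q y (x1 + x2) - (q (x1 + s *\<^sub>R y) - s * q y) \<le> push_down q y x2" if "0 \<le> s" for s
    using that unfolding push_down_def[of q y x2] by (intro cINF_greatest) auto
  then have "push_down q y (x1 + x2) - push_down q y x2 \<le> q (x1 + s *\<^sub>R y) - s * q y" if "0 \<le> s" for s
    using that by (simp add: algebra_simps)
  then have "push_down q y (x1 + x2) - push_down q y x2 \<le> push_down q y x1"
    unfolding push_down_def[of q y x1] by (intro cINF_greatest) auto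
  then show "push_down q y (x1 + x2) \<le> push_down q y x1 + push_down q y x2" by simp
next
  fix c :: real and x assume c: "0 < c"
  have "push_down q y (c *\<^sub>R x) / c \<le> q (x + t *\<^sub>R y) - t * q y" if "0 \<le> t" for t
  proof -
    have "push_down q y (c *\<^sub>R x) \<le> q (c *\<^sub>R x + (c * t) *\<^sub>R y) - (c * t) * q y"
      by (rule push_down_le[OF q]) (use that c in auto)
    also have "c *\<^sub>R x + (c * t) *\<^sub>R y = c *\<^sub>R (x + t *\<^sub>R y)" by (simp add: algebra_simps)
    also have "q \<dots> = c * q (x + t *\<^sub>R y)" by (rule sublinear_scale[OF q c])
    finally show ?thesis using c by (simp add: field_simps)
  qed
  then have "push_down q y (c *\<^sub>R x) / c \<le> push_down q y x"
    unfolding push_down_def[of q y x] by (intro cINF_greatest) auto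
  then show "push_down q y (c *\<^sub>R x) \<le> c * push_down q y x" using c by (simp add: field_simps)
qed

text \<open>Lower bounds for Zorn's lemma. The infimum is finite because every member is at least
  \<open>- p (- x)\<close> at \<open>x\<close>, and it is subadditive because two members can be
  replaced by the smaller one.\<close>

lemma sublinear_INF_chain:
  fixes C :: "('v::real_vector \<Rightarrow> real) set"
  assumes C: "C \<noteq> {}" "\<And>q. q \<in> C \<Longrightarrow> sublinear q \<and> q \<le> p" and p: "sublinear p"
    and chain: "\<And>q r. q \<in> C \<Longrightarrow> r \<in> C \<Longrightarrow> q \<le> r \<or> r \<le> q"
  defines "I \<equiv> (\<lambda>x. INF q\<in>C. q x)"
  shows "sublinear I" "\<And>q. q \<in> C \<Longrightarrow> I \<le> q"
proof -
  have bdd: "bdd_below ((\<lambda>q. q x) ` C)" for x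
  proof (rule bdd_belowI2)
    fix q assume q: "q \<in> C"
    have "- p (- x) \<le> - q (- x)" using C(2)[OF q] by (simp add: le_fun_def)
    also have "\<dots> \<le> q x" using C(2)[OF q] sublinear_uminus by blast
    finally show "- p (- x) \<le> q x" .
  qed
  have le: "I x \<le> q x" if "q \<in> C" for q x
    unfolding I_def by (rule cINF_lower[OF bdd that])
  then show "\<And>q. q \<in> C \<Longrightarrow> I \<le> q" by (simp add: le_fun_def)
  show "sublinear I"
    unfolding sublinear_def
  proof (intro conjI allI impI)
    fix x y
    have "I (x + y) - q x \<le> r y" if q: "q \<in> C" and r: "r \<in> C" for q r
    proof -
      obtain m where m: "m \<in> C" "m \<le> q" "m \<le> r" using chain[OF q r] q r by blast
      have "I (x + y) \<le> m (x + y)" by (rule le[OF m(1)])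
      also have "\<dots> \<le> m x + m y" using C(2)[OF m(1)] sublinear_add by blast
      also have "\<dots> \<le> q x + r y" using m by (intro add_mono) (auto simp: le_fun_def)
      finally show ?thesis by simp
    qed
    then have h: "I (x + y) - q x \<le> I y" if "q \<in> C" for q
      using that C(1) unfolding I_def by (intro cINF_greatest) auto
    have "I (x + y) - I y \<le> q x" if "q \<in> C" for q using h[OF that] by linarith
    then have "I (x + y) - I y \<le> I x" using C(1) unfolding I_def by (intro cINF_greatest) auto
    then show "I (x + y) \<le> I x + I y" by simp
  next
    fix c :: real and x assume c: "0 < c"
    have "I (c *\<^sub>R x) / c \<le> q x" if q: "q \<in> C" for q
      using le[OF q, of "c *\<^sub>R x"] sublinear_scale[of q c x] C(2)[OF q] c by (simp add: field_simps)
    then have "I (c *\<^sub>R x) / c \<le> I x" using C(1) unfolding I_def by (intro cINF_greatest) auto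
    then show "I (c *\<^sub>R x) \<le> c * I x" using c by (simp add: field_simps)
  qed
qed

text \<open>A minimal sublinear functional agrees with all its push-downs, which makes it additive.\<close>

lemma ex_linear_le_sublinear:
  fixes p :: "'v::real_vector \<Rightarrow> real"
  assumes p: "sublinear p"
  shows "\<exists>l. linear l \<and> l \<le> p"
proof -
  define A where "A = {q. sublinear q \<and> q \<le> p}"
  have "\<exists>m\<in>A. \<forall>a\<in>A. m \<ge> a \<longrightarrow> a = m"
  proof (rule predicate_Zorn)
    show "partial_order_on A (relation_of (\<ge>) A)"
      by (rule partial_order_on_relation_ofI) auto
  next
    fix C assume C: "C \<in> Chains (relation_of (\<ge>) A)"
    have CA: "C \<subseteq> A" using C by (auto simp: Chains_def relation_of_def)
    show "\<exists>u\<in>A. \<forall>a\<in>C. u \<le> a"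
    proof (cases "C = {}")
      case True
      then show ?thesis using p by (auto simp: A_def)
    next
      case False
      have ch: "q \<le> r \<or> r \<le> q" if "q \<in> C" "r \<in> C" for q r
        using C that unfolding Chains_def relation_of_def by auto
      note I = sublinear_INF_chain[OF False _ p ch]
      obtain q where "q \<in> C" using False by blast
      have "(\<lambda>x. INF q\<in>C. q x) \<in> A"
        unfolding A_def mem_Collect_eq
      proof
        show "sublinear (\<lambda>x. INF q\<in>C. q x)" by (rule I(1)) (use CA in \<open>auto simp: A_def\<close>)
        have "(\<lambda>x. INF q\<in>C. q x) \<le> q" by (rule I(2)[OF _ _ _ \<open>q \<in> C\<close>]) (use CA in \<open>auto simp: A_def\<close>)
        also have "q \<le> p" using \<open>q \<in> C\<close> CA by (auto simp: A_def)
        finally show "(\<lambda>x. INF q\<in>C. q x) \<le> p" .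
      qed
      moreover have "\<forall>a\<in>C. (\<lambda>x. INF q\<in>C. q x) \<le> a"
        by (intro ballI, rule I(2)) (use CA in \<open>auto simp: A_def\<close>)
      ultimately show ?thesis by blast
    qed
  qed
  then obtain l where l: "sublinear l" "l \<le> p" and min: "\<And>q. sublinear q \<Longrightarrow> q \<le> l \<Longrightarrow> q = l"
    unfolding A_def by (auto intro: order_trans)
  have add: "l (x + y) = l x + l y" for x y
  proof (rule antisym)
    show "l (x + y) \<le> l x + l y" by (rule sublinear_add[OF l(1)])
    have "push_down l y \<le> l"
      unfolding le_fun_def using push_down_le[OF l(1), of 0 y] by simp
    then have "push_down l y = l" by (intro min sublinear_push_down l)
    then show "l x + l y \<le> l (x + y)" using push_down_le[OF l(1), of 1 y x] by simp
  qed
  have neg: "l (- x) = - l x" for x using add[of x "- x"] sublinear_zero[OF l(1)] by simp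
  have "linear l"
  proof
    show "l (x + y) = l x + l y" for x y by (rule add)
    show "l (c *\<^sub>R x) = c *\<^sub>R l x" for c x
    proof (cases "0 \<le> c")
      case True
      then show ?thesis using sublinear_scale0[OF l(1)] by simp
    next
      case False
      then have "l (- (- c *\<^sub>R x)) = - ((- c) * l x)" unfolding neg using sublinear_scale0[OF l(1), of "- c" x] by simp
      then show ?thesis by simp
    qed
  qed
  with l(2) show ?thesis by blast
qed

lemma ex_linear_support:
  fixes p :: "'v::real_vector \<Rightarrow> real"
  assumes p: "sublinear p"
  shows "\<exists>l. linear l \<and> (\<forall>x. l x \<le> p x) \<and> l y = p y"
proof -
  obtain l where l: "linear l" "l \<le> push_down p y"
    using ex_linear_le_sublinear[OF sublinear_push_down[OF p, of y]] by blast
  have le: "l x \<le> p x" for x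
    using l(2) push_down_le[OF p, of 0 y x] by (simp add: le_fun_def) (meson order_trans)
  have "l (- y) \<le> - p y"
    using l(2) push_down_le[OF p, of 1 y "- y"] sublinear_zero[OF p] by (simp add: le_fun_def) (metis order_trans)
  then have "p y \<le> l y" using linear_neg[OF l(1), of y] by simp
  with le[of y] have "l y = p y" by simp
  with l(1) le show ?thesis by blast
qed

section \<open>Riesz representation on the real line\<close>

lemma Bcontfun_apply:
  assumes "continuous_on UNIV f" "\<And>x. \<bar>f x\<bar> \<le> (b::real)"
  shows "apply_bcontfun (Bcontfun f) = f"
  by (rule Bcontfun_inverse) (rule bcontfun_normI, use assms in auto)

lemma apply_bcontfun_sum: "apply_bcontfun (\<Sum>i\<in>I. f i) x = (\<Sum>i\<in>I. apply_bcontfun (f i) x)"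
  for f :: "'i \<Rightarrow> ('a::topological_space \<Rightarrow>\<^sub>C real)"
  by (induction I rule: infinite_finite_induct) auto

definition ramp :: "real \<Rightarrow> real \<Rightarrow> real \<Rightarrow> real" where
  "ramp a b x = max 0 (min 1 ((b - x) / (b - a)))"

lemma ramp_simps:
  assumes "a < b"
  shows "x \<le> a \<Longrightarrow> ramp a b x = 1" "b \<le> x \<Longrightarrow> ramp a b x = 0" "0 \<le> ramp a b x" "ramp a b x \<le> 1"
  using assms by (auto simp: ramp_def min_def max_def field_simps)

definition tail_fun :: "nat \<Rightarrow> real \<Rightarrow> real" where
  "tail_fun N x = min 1 (max 0 (\<bar>x\<bar> - real N))"

lemma tail_fun_simps:
  "0 \<le> tail_fun N x" "tail_fun N x \<le> 1" "real N + 1 \<le> \<bar>x\<bar> \<Longrightarrow> tail_fun N x = 1"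
  by (auto simp: tail_fun_def)

lemma continuous_on_ramp: "a < b \<Longrightarrow> continuous_on A (ramp a b)"
  unfolding ramp_def by (intro continuous_intros) auto

lemma continuous_on_tail_fun: "continuous_on A (tail_fun N)"
  unfolding tail_fun_def by (intro continuous_intros)

definition bramp :: "real \<Rightarrow> real \<Rightarrow> (real \<Rightarrow>\<^sub>C real)" where "bramp a b = Bcontfun (ramp a b)"
definition btail :: "nat \<Rightarrow> (real \<Rightarrow>\<^sub>C real)" where "btail N = Bcontfun (tail_fun N)"

lemma bramp [simp]: "a < b \<Longrightarrow> apply_bcontfun (bramp a b) x = ramp a b x"
proof -
  assume ab: "a < b"
  have "\<bar>ramp a b y\<bar> \<le> 1" for y using ramp_simps(3,4)[OF ab, of y] by linarith
  then show ?thesis unfolding bramp_def by (subst Bcontfun_apply[OF continuous_on_ramp[OF ab]]) auto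
qed

lemma btail [simp]: "apply_bcontfun (btail N) x = tail_fun N x"
proof -
  have "\<bar>tail_fun N y\<bar> \<le> 1" for y using tail_fun_simps(1,2)[of N y] by linarith
  then show ?thesis unfolding btail_def by (subst Bcontfun_apply[OF continuous_on_tail_fun]) auto
qed

text \<open>A positive normalized functional on bounded continuous functions may carry mass at
  infinity and then is not an integral; \<open>tight\<close> excludes this.\<close>

locale positive_functional =
  fixes l :: "(real \<Rightarrow>\<^sub>C real) \<Rightarrow> real"
  assumes lin: "linear l" and pos: "\<And>f. (\<And>x. 0 \<le> apply_bcontfun f x) \<Longrightarrow> 0 \<le> l f"
    and one: "l (const_bcontfun 1) = 1"
    and tight: "\<And>\<epsilon>. 0 < \<epsilon> \<Longrightarrow> \<exists>N. l (btail N) < \<epsilon>"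
begin

lemma l_add: "l (f + g) = l f + l g" and l_diff: "l (f - g) = l f - l g" and l_scale: "l (c *\<^sub>R f) = c * l f"
  and l_sum: "l (sum F I) = (\<Sum>i\<in>I. l (F i))"
  using lin by (simp_all add: linear_add linear_diff linear_scale linear_sum)

lemma mono: "(\<And>x. apply_bcontfun f x \<le> apply_bcontfun g x) \<Longrightarrow> l f \<le> l g"
  using pos[of "g - f"] by (simp add: l_diff)

lemma const: "l (const_bcontfun c) = c"
proof -
  have "const_bcontfun c = c *\<^sub>R const_bcontfun (1::real)" by (rule bcontfun_eqI) simp
  then have "l (const_bcontfun c) = l (c *\<^sub>R const_bcontfun 1)" by (rule arg_cong)
  then show ?thesis by (simp add: l_scale one)
qed

lemma abs_le: "(\<And>x. \<bar>apply_bcontfun f x\<bar> \<le> b) \<Longrightarrow> \<bar>l f\<bar> \<le> b"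
  using mono[of f "const_bcontfun b"] mono[of "const_bcontfun (- b)" f] by (auto simp: const abs_le_iff minus_le_iff)

text \<open>The indicator of \<open>{..a}\<close> is not continuous. Approximating it from above by
  continuous functions gives the distribution function \<open>F\<close> of the measure
  sought.\<close>

definition "majorants a = {f :: real \<Rightarrow>\<^sub>C real. (\<forall>x. 0 \<le> apply_bcontfun f x) \<and> (\<forall>x\<le>a. 1 \<le> apply_bcontfun f x)}"
definition "F a = (INF f\<in>majorants a. l f)"

lemma majorants_nonempty: "majorants a \<noteq> {}"
proof -
  have "const_bcontfun 1 \<in> majorants a" by (simp add: majorants_def)
  then show ?thesis by blast
qed

lemma majorants_bdd: "bdd_below (l ` majorants a)"
  by (rule bdd_belowI2[of _ 0]) (auto simp: majorants_def intro: pos)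

lemma F_le: "f \<in> majorants a \<Longrightarrow> F a \<le> l f"
  unfolding F_def by (rule cINF_lower[OF majorants_bdd])

lemma le_F:
  assumes "\<And>x. apply_bcontfun f x \<le> 1" "\<And>x. b < x \<Longrightarrow> apply_bcontfun f x \<le> 0"
  shows "l f \<le> F b"
  unfolding F_def
proof (rule cINF_greatest[OF majorants_nonempty])
  fix g assume g: "g \<in> majorants b"
  show "l f \<le> l g"
  proof (rule mono)
    fix x show "apply_bcontfun f x \<le> apply_bcontfun g x"
    proof (cases "x \<le> b")
      case True
      then have "1 \<le> apply_bcontfun g x" using g by (simp add: majorants_def)
      with assms(1)[of x] show ?thesis by linarith
    next
      case False
      then have "0 \<le> apply_bcontfun g x" using g by (simp add: majorants_def)
      with assms(2)[of x] False show ?thesis by linarith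
    qed
  qed
qed

lemma F_mono: "a \<le> b \<Longrightarrow> F a \<le> F b"
  unfolding F_def by (rule cINF_superset_mono[OF majorants_nonempty majorants_bdd]) (auto simp: majorants_def)

lemma F_bounds: "0 \<le> F a" "F a \<le> 1"
proof -
  show "0 \<le> F a" unfolding F_def by (rule cINF_greatest[OF majorants_nonempty]) (auto simp: majorants_def intro: pos)
  show "F a \<le> 1" using F_le[of "const_bcontfun 1" a] by (simp add: majorants_def const)
qed

lemma F_at_top: "1 - l (btail N) \<le> F (real N + 1)"
proof -
  have "l (const_bcontfun 1 - btail N) \<le> F (real N + 1)"
    by (rule le_F) (auto simp: tail_fun_simps)
  then show ?thesis by (simp add: l_diff const)
qed

lemma F_at_bot: "F (- (real N + 1)) \<le> l (btail N)"
  by (rule F_le) (auto simp: majorants_def tail_fun_simps)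

lemma F_lim_top: "(F \<longlongrightarrow> 1) at_top"
proof (rule order_tendstoI)
  fix a :: real assume "a < 1"
  then obtain N where N: "l (btail N) < 1 - a" using tight[of "1 - a"] by auto
  show "eventually (\<lambda>x. a < F x) at_top"
    using eventually_ge_at_top[of "real N + 1"]
  proof eventually_elim
    case (elim x)
    then show ?case using F_at_top[of N] F_mono[OF elim] N by linarith
  qed
next
  fix a :: real assume "1 < a"
  then have "F x < a" for x using F_bounds(2)[of x] by linarith
  then show "eventually (\<lambda>x. F x < a) at_top" by simp
qed

lemma F_lim_bot: "(F \<longlongrightarrow> 0) at_bot"
proof (rule order_tendstoI)
  fix a :: real assume "0 < a"
  then obtain N where N: "l (btail N) < a" using tight by auto
  show "eventually (\<lambda>x. F x < a) at_bot"
    using eventually_le_at_bot[of "- (real N + 1)"]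
  proof eventually_elim
    case (elim x)
    then show ?case using F_at_bot[of N] F_mono[OF elim] N by linarith
  qed
next
  fix a :: real assume "a < 0"
  then have "a < F x" for x using F_bounds(1)[of x] by linarith
  then show "eventually (\<lambda>x. a < F x) at_bot" by simp
qed

text \<open>A nearly optimal majorant at \<open>a\<close> is still above
  \<open>1 - \<epsilon>/2\<close> slightly to the right of \<open>a\<close>; adding the constant
  \<open>\<epsilon>/2\<close> makes it a majorant there.\<close>

lemma F_right_small:
  assumes \<epsilon>: "0 < \<epsilon>"
  obtains \<delta> where "0 < \<delta>" "F (a + \<delta>) < F a + \<epsilon>"
proof -
  have "\<exists>f\<in>majorants a. l f < F a + \<epsilon> / 2"
  proof (rule ccontr)
    assume "\<not> ?thesis"
    then have "F a + \<epsilon> / 2 \<le> F a" unfolding F_def by (intro cINF_greatest[OF majorants_nonempty]) (auto simp: not_less)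
    with \<epsilon> show False by simp
  qed
  then obtain f where f: "f \<in> majorants a" "l f < F a + \<epsilon> / 2" by blast
  have "isCont (apply_bcontfun f) a" 
    using continuous_on_eq_continuous_at[THEN iffD1, OF open_UNIV continuous_on_apply_bcontfun] by blast
  then obtain \<delta> where \<delta>: "0 < \<delta>" "\<And>x. \<bar>x - a\<bar> < \<delta> \<Longrightarrow> \<bar>apply_bcontfun f x - apply_bcontfun f a\<bar> < \<epsilon> / 2"
    using \<epsilon> unfolding continuous_at_eps_delta dist_real_def by (metis half_gt_zero)
  have fa: "1 \<le> apply_bcontfun f a" using f by (simp add: majorants_def)
  have "f + const_bcontfun (\<epsilon> / 2) \<in> majorants (a + \<delta> / 2)"
    unfolding majorants_def
  proof (intro CollectI conjI allI impI)
    fix x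
    show "0 \<le> apply_bcontfun (f + const_bcontfun (\<epsilon> / 2)) x" using f \<epsilon> by (simp add: majorants_def)
    assume x: "x \<le> a + \<delta> / 2"
    show "1 \<le> apply_bcontfun (f + const_bcontfun (\<epsilon> / 2)) x"
    proof (cases "x \<le> a")
      case True
      then have "1 \<le> apply_bcontfun f x" using f by (simp add: majorants_def)
      then show ?thesis using \<epsilon> by simp
    next
      case False
      then have "\<bar>x - a\<bar> < \<delta>" using x \<delta> by auto
      then have "apply_bcontfun f a - \<epsilon> / 2 < apply_bcontfun f x" using \<delta>(2)[of x] by linarith
      then show ?thesis using fa by simp
    qed
  qed
  from F_le[OF this] f(2) have "F (a + \<delta> / 2) < F a + \<epsilon>" by (simp add: l_add const)
  with that[of "\<delta> / 2"] \<delta>(1) show ?thesis by simp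
qed

lemma F_right_cont: "continuous (at_right a) F"
  unfolding continuous_within
proof (rule order_tendstoI)
  fix y assume "y < F a"
  then have "y < F x" if "a < x" for x using F_mono[of a x] that by linarith
  then show "eventually (\<lambda>x. y < F x) (at_right a)"
    by (auto simp: eventually_at_filter)
next
  fix y assume "F a < y"
  then obtain \<delta> where \<delta>: "0 < \<delta>" "F (a + \<delta>) < y" using F_right_small[of "y - F a" a] by auto
  have "eventually (\<lambda>x. x \<in> {a<..<a + \<delta>}) (at_right a)" by (rule eventually_at_right_real) (use \<delta> in simp)
  then show "eventually (\<lambda>x. F x < y) (at_right a)"
  proof eventually_elim
    case (elim x)
    then show ?case using \<delta>(2) F_mono[of x "a + \<delta>"] by simp
  qed
qed

definition "\<mu> = interval_measure F"

lemma real_distribution_\<mu>: "real_distribution \<mu>"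
  unfolding \<mu>_def by (rule real_distribution_interval_measure[OF F_mono F_right_cont F_lim_bot F_lim_top])

sublocale \<mu>: real_distribution \<mu> by (rule real_distribution_\<mu>)

lemma integrable_bcontfun: "integrable \<mu> (apply_bcontfun f)" for f :: "real \<Rightarrow>\<^sub>C real"
proof (rule \<mu>.integrable_const_bound[of _ "norm f"])
  show "AE x in \<mu>. norm (apply_bcontfun f x) \<le> norm f" using norm_bounded[of f] by simp
  have "apply_bcontfun f \<in> borel_measurable borel"
    by (rule borel_measurable_continuous_onI) simp
  then show "apply_bcontfun f \<in> borel_measurable \<mu>" by simp
qed

lemma measure_Iic: "measure \<mu> {..a} = F a"
  unfolding \<mu>_def by (rule measure_interval_measure_Iic[OF F_mono F_right_cont F_lim_bot])

text \<open>The defect of the representation. It is shown to be small for compactly supported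
  functions and for tails, hence zero.\<close>

definition "d f = l f - (\<integral>x. apply_bcontfun f x \<partial>\<mu>)"

lemma d_add: "d (f + g) = d f + d g" and d_diff: "d (f - g) = d f - d g" and d_scale: "d (c *\<^sub>R f) = c * d f"
  by (simp_all add: d_def l_add l_diff l_scale integrable_bcontfun algebra_simps)

lemma d_zero: "d 0 = 0" using d_scale[of 0 0] by simp

lemma d_sum: "d (sum f I) = (\<Sum>i\<in>I. d (f i))"
  by (induction I rule: infinite_finite_induct) (auto simp: d_add d_zero)

lemma d_bound:
  assumes "\<And>x. \<bar>apply_bcontfun f x\<bar> \<le> b"
  shows "\<bar>d f\<bar> \<le> 2 * b"
proof -
  have "(\<integral>x. apply_bcontfun f x \<partial>\<mu>) \<le> b" "- b \<le> (\<integral>x. apply_bcontfun f x \<partial>\<mu>)"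
    using assms by (auto intro!: \<mu>.integral_le_const \<mu>.integral_ge_const integrable_bcontfun simp: abs_le_iff minus_le_iff)
  then show ?thesis using abs_le[OF assms] unfolding d_def by linarith
qed

lemma integral_ramp_bounds:
  assumes "a < b"
  shows "F a \<le> (\<integral>x. ramp a b x \<partial>\<mu>)" "(\<integral>x. ramp a b x \<partial>\<mu>) \<le> F b"
proof -
  have i: "integrable \<mu> (ramp a b)" 
  proof -
    have "apply_bcontfun (bramp a b) = ramp a b" using assms by (intro ext) simp
    then show ?thesis using integrable_bcontfun[of "bramp a b"] by simp
  qed
  have ii: "integrable \<mu> (indicator {..c} :: real \<Rightarrow> real)" for c
    by (rule integrable_real_indicator) (auto simp: \<mu>.emeasure_eq_measure)
  have "F c = (\<integral>x. indicator {..c} x \<partial>\<mu>)" for c by (simp add: measure_Iic)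
  moreover have "(\<integral>x. indicator {..a} x \<partial>\<mu>) \<le> (\<integral>x. ramp a b x \<partial>\<mu>)"
    by (rule integral_mono[OF ii i]) (use ramp_simps[OF assms] in \<open>simp add: indicator_def\<close>)
  moreover have "(\<integral>x. ramp a b x \<partial>\<mu>) \<le> (\<integral>x. indicator {..b} x \<partial>\<mu>)"
    by (rule integral_mono[OF i ii]) (use ramp_simps[OF assms] in \<open>simp add: indicator_def\<close>)
  ultimately show "F a \<le> (\<integral>x. ramp a b x \<partial>\<mu>)" "(\<integral>x. ramp a b x \<partial>\<mu>) \<le> F b" by simp_all
qed

text \<open>The functional and the integral both send the ramp into the interval from
  \<open>F a\<close> to \<open>F b\<close>. By right continuity a short ramp starting at
  \<open>a\<close> has small defect, even if \<open>F\<close> jumps at \<open>a\<close>.\<close>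

lemma d_ramp:
  assumes "a < b"
  shows "\<bar>d (bramp a b)\<bar> \<le> F b - F a"
proof -
  have "F a \<le> l (bramp a b)" by (rule F_le) (use assms in \<open>auto simp: majorants_def ramp_simps\<close>)
  moreover have "l (bramp a b) \<le> F b" by (rule le_F) (use assms in \<open>auto simp: ramp_simps\<close>)
  moreover have "(\<integral>x. apply_bcontfun (bramp a b) x \<partial>\<mu>) = (\<integral>x. ramp a b x \<partial>\<mu>)" using assms by simp
  ultimately show ?thesis using integral_ramp_bounds[OF assms] unfolding d_def by linarith
qed

end

context positive_functional
begin

lemma ex_uniform_modulus:
  fixes g :: "real \<Rightarrow> real"
  assumes cont: "continuous_on UNIV g" and supp: "\<And>x. R \<le> \<bar>x\<bar> \<Longrightarrow> g x = 0" and \<epsilon>: "0 < \<epsilon>"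
  obtains \<delta> where "0 < \<delta>" "\<And>x y. \<bar>x - y\<bar> < \<delta> \<Longrightarrow> \<bar>g x - g y\<bar> < \<epsilon>"
proof -
  define S where "S = {- R - 1..R + 1}"
  have "uniformly_continuous_on S g"
    by (rule compact_uniformly_continuous) (auto simp: S_def intro: continuous_on_subset[OF cont])
  then obtain \<delta> where \<delta>: "0 < \<delta>" "\<And>x y. y \<in> S \<Longrightarrow> x \<in> S \<Longrightarrow> \<bar>x - y\<bar> < \<delta> \<Longrightarrow> \<bar>g x - g y\<bar> < \<epsilon>"
    unfolding uniformly_continuous_on_def dist_real_def using \<epsilon> by blast
  show ?thesis
  proof (rule that[of "min \<delta> 1"])
    fix x y assume xy: "\<bar>x - y\<bar> < min \<delta> 1"
    show "\<bar>g x - g y\<bar> < \<epsilon>"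
    proof (cases "x \<in> S \<and> y \<in> S")
      case True
      then show ?thesis using \<delta>(2)[of y x] xy by simp
    next
      case False
      then have "R \<le> \<bar>x\<bar>" "R \<le> \<bar>y\<bar>" using xy unfolding S_def by auto
      then show ?thesis using supp \<epsilon> by simp
    qed
  qed (use \<delta> in simp)
qed

text \<open>\<open>H\<close> combines differences of short ramps at the grid points
  \<open>x i\<close>. These differences \<open>w i\<close> are nonnegative bumps of width at most
  \<open>2h\<close> with sum at most 1, so \<open>g - H\<close> is governed by the oscillation of
  \<open>g\<close>. The defect of \<open>H\<close> is small because each ramp contributes at most
  \<open>\<epsilon>/n\<close>.\<close>

lemma d_compact_support:
  assumes supp: "\<And>x. R \<le> \<bar>x\<bar> \<Longrightarrow> apply_bcontfun g x = 0" and R: "0 < R" and \<epsilon>: "0 < \<epsilon>"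
  shows "\<bar>d g\<bar> \<le> (4 + 2 * norm g) * \<epsilon>"
proof -
  let ?g = "apply_bcontfun g"
  obtain \<delta> where \<delta>: "0 < \<delta>" "\<And>x y. \<bar>x - y\<bar> < \<delta> \<Longrightarrow> \<bar>?g x - ?g y\<bar> < \<epsilon>"
    using ex_uniform_modulus[OF continuous_on_apply_bcontfun supp \<epsilon>] by blast
  \<comment> \<open>Then the maximal width \<open>2h = 4R/n\<close> of a bump is less than
    \<delta>.\<close>
  obtain n :: nat where n: "0 < n" "4 * R / \<delta> < real n"
  proof -
    obtain n :: nat where n: "4 * R / \<delta> < real n" using reals_Archimedean2 by blast
    moreover have "0 < 4 * R / \<delta>" using R \<delta>(1) by simp
    ultimately have "0 < real n" by linarith
    with that[of n] n show ?thesis by simp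
  qed
  define h where "h = 2 * R / real n"
  have h: "0 < h" "2 * h < \<delta>" "real n * h = 2 * R" using n R \<delta>(1) by (auto simp: h_def field_simps)
  define x where "x i = - R + real i * h" for i
  have x0: "x 0 = - R" and xn: "x n = R" and xS: "x (Suc i) = x i + h" for i
    using h(3) by (auto simp: x_def algebra_simps)
  have "\<exists>y. x i < y \<and> y \<le> x i + h \<and> F y - F (x i) \<le> \<epsilon> / real n" for i
  proof -
    have "0 < \<epsilon> / real n" using \<epsilon> n by simp
    then obtain r where r: "0 < r" "F (x i + r) < F (x i) + \<epsilon> / real n" by (rule F_right_small)
    have "F (x i + min r h) \<le> F (x i + r)" by (rule F_mono) simp
    then show ?thesis using r h by (intro exI[of _ "x i + min r h"]) auto
  qed
  then obtain y where y: "\<And>i. x i < y i" "\<And>i. y i \<le> x i + h" "\<And>i. F (y i) - F (x i) \<le> \<epsilon> / real n" by metis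
  define \<theta> where "\<theta> i = bramp (x i) (y i)" for i
  have \<theta>: "apply_bcontfun (\<theta> i) z = ramp (x i) (y i) z" for i z using y(1) by (simp add: \<theta>_def)
  have rs: "s \<le> x j \<Longrightarrow> ramp (x j) (y j) s = 1" "y j \<le> s \<Longrightarrow> ramp (x j) (y j) s = 0"
    "0 \<le> ramp (x j) (y j) s" "ramp (x j) (y j) s \<le> 1" for j s
    using ramp_simps[OF y(1)[of j]] by auto
  define H where "H = (\<Sum>i<n. ?g (x i) *\<^sub>R (\<theta> (Suc i) - \<theta> i))"
  have "\<bar>apply_bcontfun (g - H) z\<bar> \<le> 2 * \<epsilon>" for z
  proof -
    define w where "w i = ramp (x (Suc i)) (y (Suc i)) z - ramp (x i) (y i) z" for i
    have w0: "0 \<le> w i" for i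
    proof (cases "z \<le> x (Suc i)")
      case True
      then show ?thesis using rs(1)[of z "Suc i"] rs(4)[of i z] by (simp add: w_def)
    next
      case False
      then have "y i \<le> z" using y(2)[of i] xS[of i] by linarith
      then show ?thesis using rs(2)[of i z] rs(3)[of "Suc i" z] by (simp add: w_def)
    qed
    have wz: "w i * \<bar>?g z - ?g (x i)\<bar> \<le> w i * \<epsilon>" for i
    proof (cases "x i \<le> z \<and> z \<le> x i + 2 * h")
      case True
      then have "\<bar>?g z - ?g (x i)\<bar> < \<epsilon>" by (intro \<delta>(2)) (use h in auto)
      then show ?thesis using w0 by (intro mult_left_mono) auto
    next
      case False
      then consider "z < x i" | "x i + 2 * h < z" by linarith
      then have "w i = 0"
      proof cases
        case 1
        then have "z \<le> x (Suc i)" using xS[of i] h by linarith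
        then show ?thesis using 1 rs(1)[of z "Suc i"] rs(1)[of z i] by (simp add: w_def)
      next
        case 2
        then have "y i \<le> z" "y (Suc i) \<le> z" using xS[of i] h y(2)[of i] y(2)[of "Suc i"] by linarith+
        then show ?thesis using rs(2)[of "Suc i" z] rs(2)[of i z] by (simp add: w_def)
      qed
      then show ?thesis by simp
    qed
    have sw: "(\<Sum>i<n. w i) = ramp (x n) (y n) z - ramp (x 0) (y 0) z"
      unfolding w_def by (rule sum_lessThan_telescope)
    have sw1: "(\<Sum>i<n. w i) \<le> 1"
      unfolding sw using rs(3)[of 0 z] rs(4)[of n z] by linarith
    \<comment> \<open>Inside the support the bumps fail to sum to 1 only to the left of
      \<open>x 0 + h\<close>, where \<open>g\<close> is small because it vanishes at
      \<open>x 0 = - R\<close>.\<close>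
    have edge: "\<bar>?g z * (1 - (\<Sum>i<n. w i))\<bar> \<le> \<epsilon>"
    proof (cases "R \<le> \<bar>z\<bar>")
      case True
      then show ?thesis using supp \<epsilon> by simp
    next
      case False
      then have "z \<le> x n" using xn by linarith
      then have "1 - (\<Sum>i<n. w i) = ramp (x 0) (y 0) z" unfolding sw using rs(1)[of z n] by simp
      moreover have "\<bar>?g z * ramp (x 0) (y 0) z\<bar> \<le> \<epsilon>"
      proof (cases "z < x 0 + h")
        case True
        have "?g (x 0) = 0" using supp[of "- R"] R x0 by simp
        moreover have "\<bar>?g z - ?g (x 0)\<bar> < \<epsilon>" by (rule \<delta>(2)) (use True False h x0 in auto)
        ultimately have "\<bar>?g z\<bar> * \<bar>ramp (x 0) (y 0) z\<bar> \<le> \<epsilon> * 1"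
          using rs(3)[of 0 z] rs(4)[of 0 z] by (intro mult_mono) auto
        then show ?thesis by (simp add: abs_mult)
      next
        case False
        then have "y 0 \<le> z" using y(2)[of 0] by linarith
        then show ?thesis using rs(2)[of 0 z] \<epsilon> by simp
      qed
      ultimately show ?thesis by simp
    qed
    have "apply_bcontfun H z = (\<Sum>i<n. ?g (x i) * w i)"
      by (simp add: H_def apply_bcontfun_sum \<theta> w_def)
    then have "apply_bcontfun (g - H) z = ?g z * (1 - (\<Sum>i<n. w i)) + (\<Sum>i<n. w i * (?g z - ?g (x i)))"
      by (simp add: algebra_simps sum_subtractf sum_distrib_left)
    moreover have "\<bar>\<Sum>i<n. w i * (?g z - ?g (x i))\<bar> \<le> (\<Sum>i<n. w i * \<epsilon>)"
      by (intro order_trans[OF sum_abs] sum_mono) (use wz w0 in \<open>simp add: abs_mult\<close>)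
    moreover have "(\<Sum>i<n. w i * \<epsilon>) \<le> \<epsilon>"
      using sw1 \<epsilon> by (simp flip: sum_distrib_right)
    ultimately show ?thesis using edge by linarith
  qed
  then have 1: "\<bar>d (g - H)\<bar> \<le> 2 * (2 * \<epsilon>)" by (rule d_bound)
  have dH: "d H = (\<Sum>i<n. ?g (x i) * (d (\<theta> (Suc i)) - d (\<theta> i)))"
    unfolding H_def by (simp only: d_sum d_scale d_diff)
  have db: "\<bar>d (\<theta> i)\<bar> \<le> \<epsilon> / real n" for i
    unfolding \<theta>_def using d_ramp[OF y(1)[of i]] y(3)[of i] by linarith
  have "2 * \<epsilon> / real n = \<epsilon> / real n + \<epsilon> / real n" by simp
  then have dd: "\<bar>d (\<theta> (Suc i)) - d (\<theta> i)\<bar> \<le> 2 * \<epsilon> / real n" for i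
    using db[of i] db[of "Suc i"] by linarith
  have "\<bar>d H\<bar> \<le> (\<Sum>i<n. norm g * (2 * \<epsilon> / real n))"
    unfolding dH
  proof (intro order_trans[OF sum_abs] sum_mono)
    fix i
    show "\<bar>?g (x i) * (d (\<theta> (Suc i)) - d (\<theta> i))\<bar> \<le> norm g * (2 * \<epsilon> / real n)"
      unfolding abs_mult by (intro mult_mono dd) (use norm_bounded[of g] in auto)
  qed
  also have "\<dots> = 2 * norm g * \<epsilon>" using n by simp
  finally have 2: "\<bar>d H\<bar> \<le> 2 * norm g * \<epsilon>" .
  have "d g = d (g - H) + d H" by (simp add: d_diff)
  with 1 2 show ?thesis by (simp add: algebra_simps)
qed

text \<open>The cutoff \<open>tail_fun (Suc N)\<close> vanishes for \<open>|x| \<le> N + 1\<close>,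
  so its integral is at most the mass outside, which \<open>F\<close> controls at
  \<open>N + 1\<close> and \<open>- (N + 1)\<close>. The functional contributes one \<epsilon> and
  the integral two.\<close>

lemma d_tail:
  assumes N: "l (btail N) < \<epsilon>" and g: "\<And>x. apply_bcontfun g x = apply_bcontfun f x * tail_fun (Suc N) x"
  shows "\<bar>d g\<bar> \<le> 3 * norm f * \<epsilon>"
proof -
  let ?T = "btail (Suc N)"
  have b: "\<bar>apply_bcontfun g x\<bar> \<le> norm f * tail_fun (Suc N) x" for x
    unfolding g abs_mult using norm_bounded[of f x] tail_fun_simps[of "Suc N" x] by (intro mult_mono) auto
  have "l ?T \<le> l (btail N)" by (rule mono) (simp add: tail_fun_def)
  then have lT: "l ?T \<le> \<epsilon>" using N by simp
  have "l g \<le> l (norm f *\<^sub>R ?T)" by (rule mono) (use b in \<open>simp add: abs_le_iff\<close>)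
  moreover have "l ((- norm f) *\<^sub>R ?T) \<le> l g" by (rule mono) (use b in \<open>simp add: abs_le_iff minus_le_iff\<close>)
  moreover have "norm f * l ?T \<le> norm f * \<epsilon>" using lT by (intro mult_left_mono) auto
  ultimately have 1: "\<bar>l g\<bar> \<le> norm f * \<epsilon>" 
    using linear_neg[OF lin, of "norm f *\<^sub>R ?T"] by (simp add: l_scale)
  have iT: "integrable \<mu> (tail_fun (Suc N))"
  proof -
    have "apply_bcontfun ?T = tail_fun (Suc N)" by (intro ext) simp
    then show ?thesis using integrable_bcontfun[of ?T] by simp
  qed
  have ii: "integrable \<mu> (indicator {..c} :: real \<Rightarrow> real)" for c
    by (rule integrable_real_indicator) (auto simp: \<mu>.emeasure_eq_measure)
  have "(\<integral>x. tail_fun (Suc N) x \<partial>\<mu>) \<le> (\<integral>x. 1 - indicator {..real N + 1} x + indicator {..- (real N + 1)} x \<partial>\<mu>)"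
  proof (rule integral_mono[OF iT])
    show "tail_fun (Suc N) x \<le> 1 - indicator {..real N + 1} x + indicator {..- (real N + 1)} x" for x
      by (auto simp: tail_fun_def indicator_def)
  qed (intro Bochner_Integration.integrable_add Bochner_Integration.integrable_diff ii, simp)
  also have "\<dots> = 1 - F (real N + 1) + F (- (real N + 1))"
    using ii \<mu>.prob_space by (simp add: measure_Iic)
  also have "\<dots> \<le> 2 * \<epsilon>" using F_at_top[of N] F_at_bot[of N] N by linarith
  finally have T: "(\<integral>x. tail_fun (Suc N) x \<partial>\<mu>) \<le> 2 * \<epsilon>" .
  have "\<bar>\<integral>x. apply_bcontfun g x \<partial>\<mu>\<bar> \<le> (\<integral>x. \<bar>apply_bcontfun g x\<bar> \<partial>\<mu>)"
    by (rule integral_abs_bound)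
  also have "\<dots> \<le> (\<integral>x. norm f * tail_fun (Suc N) x \<partial>\<mu>)"
    by (rule integral_mono) (use b integrable_bcontfun iT in auto)
  also have "\<dots> = norm f * (\<integral>x. tail_fun (Suc N) x \<partial>\<mu>)" by simp
  also have "\<dots> \<le> norm f * (2 * \<epsilon>)" using T by (intro mult_left_mono) auto
  finally have 2: "\<bar>\<integral>x. apply_bcontfun g x \<partial>\<mu>\<bar> \<le> norm f * (2 * \<epsilon>)" .
  show ?thesis using 1 2 unfolding d_def by (simp add: algebra_simps)
qed

lemma d_eq_0: "d f = 0"
proof -
  define K where "K = 3 * norm f + (4 + 2 * (2 * norm f))"
  have K: "0 < K" by (simp add: K_def add_nonneg_pos)
  have "\<bar>d f\<bar> \<le> K * \<epsilon>" if \<epsilon>: "0 < \<epsilon>" for \<epsilon>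
  proof -
    obtain N where N: "l (btail N) < \<epsilon>" using tight[OF \<epsilon>] by blast
    define g where "g = Bcontfun (\<lambda>x. apply_bcontfun f x * tail_fun (Suc N) x)"
    have bd: "\<bar>apply_bcontfun f x * tail_fun (Suc N) x\<bar> \<le> norm f" for x
    proof -
      have "\<bar>apply_bcontfun f x\<bar> * \<bar>tail_fun (Suc N) x\<bar> \<le> norm f * 1"
        using norm_bounded[of f x] tail_fun_simps[of "Suc N" x] by (intro mult_mono) auto
      then show ?thesis by (simp add: abs_mult)
    qed
    have g: "apply_bcontfun g x = apply_bcontfun f x * tail_fun (Suc N) x" for x
      unfolding g_def by (subst Bcontfun_apply[OF _ bd]) (auto intro!: continuous_intros continuous_on_tail_fun)
    have ng: "norm g \<le> norm f" by (rule norm_bound) (use g bd in auto)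
    have "\<bar>d (f - g)\<bar> \<le> (4 + 2 * norm (f - g)) * \<epsilon>"
      by (rule d_compact_support[of "real (Suc N) + 1"]) (use g tail_fun_simps(3) \<epsilon> in auto)
    also have "\<dots> \<le> (4 + 2 * (2 * norm f)) * \<epsilon>"
      using norm_triangle_ineq4[of f g] ng \<epsilon> by (intro mult_right_mono) auto
    finally have "\<bar>d (f - g)\<bar> \<le> (4 + 2 * (2 * norm f)) * \<epsilon>" .
    moreover have "\<bar>d g\<bar> \<le> 3 * norm f * \<epsilon>" by (rule d_tail[OF N g])
    moreover have "d f = d (f - g) + d g" by (simp add: d_diff)
    ultimately show ?thesis by (simp add: K_def algebra_simps)
  qed
  from this[of "\<bar>d f\<bar> / (2 * K)"] K show ?thesis by (cases "d f = 0") auto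
qed

theorem representation: "\<exists>\<mu>. real_distribution \<mu> \<and> (\<forall>f. l f = (\<integral>x. apply_bcontfun f x \<partial>\<mu>))"
proof -
  have "l f = (\<integral>x. apply_bcontfun f x \<partial>\<mu>)" for f using d_eq_0[of f] by (simp add: d_def)
  then show ?thesis using real_distribution_\<mu> by blast
qed

end

section \<open>Closure properties of bounded Lipschitz functions\<close>

lemma CbLip_bounds:
  assumes "g \<in> CbLip"
  obtains b L where "\<And>x. \<bar>g x\<bar> \<le> b" "\<And>x y. \<bar>g x - g y\<bar> \<le> L * \<bar>x - y\<bar>"
proof -
  obtain L where L: "L-lipschitz_on UNIV g" using assms unfolding CbLip_def by blast
  obtain b where "\<forall>y\<in>range g. norm y \<le> b" using assms unfolding CbLip_def bounded_iff by blast
  then have "\<bar>g x\<bar> \<le> b" for x by simp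
  moreover have "\<bar>g x - g y\<bar> \<le> L * \<bar>x - y\<bar>" for x y
    using lipschitz_onD[OF L, of x y] by (simp add: dist_real_def)
  ultimately show ?thesis by (rule that)
qed

lemma CbLipI:
  assumes "\<And>x. \<bar>g x\<bar> \<le> b" "\<And>x y. \<bar>g x - g y\<bar> \<le> L * \<bar>x - y\<bar>"
  shows "g \<in> CbLip"
proof -
  have "\<bar>g x - g y\<bar> \<le> \<bar>L\<bar> * \<bar>x - y\<bar>" for x y
    by (rule order_trans[OF assms(2)]) (intro mult_right_mono, auto)
  then have "\<bar>L\<bar>-lipschitz_on UNIV g"
    unfolding lipschitz_on_def dist_real_def by simp
  then show ?thesis unfolding CbLip_def bounded_iff using assms(1) by auto
qed

lemma CbLip_const [simp]: "(\<lambda>_. c) \<in> CbLip"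
  by (rule CbLipI[of _ "\<bar>c\<bar>" 0]) auto

lemma CbLip_add:
  assumes "f \<in> CbLip" "g \<in> CbLip"
  shows "(\<lambda>x. f x + g x) \<in> CbLip"
proof -
  obtain b L where f: "\<And>x. \<bar>f x\<bar> \<le> b" "\<And>x y. \<bar>f x - f y\<bar> \<le> L * \<bar>x - y\<bar>" using CbLip_bounds[OF assms(1)] by metis
  obtain b' L' where g: "\<And>x. \<bar>g x\<bar> \<le> b'" "\<And>x y. \<bar>g x - g y\<bar> \<le> L' * \<bar>x - y\<bar>" using CbLip_bounds[OF assms(2)] by metis
  show ?thesis
  proof (rule CbLipI)
    show "\<bar>f x + g x\<bar> \<le> b + b'" for x using f(1)[of x] g(1)[of x] by linarith
    show "\<bar>f x + g x - (f y + g y)\<bar> \<le> (L + L') * \<bar>x - y\<bar>" for x y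
      using f(2)[of x y] g(2)[of x y] by (simp add: algebra_simps)
  qed
qed

lemma CbLip_scale:
  assumes "f \<in> CbLip"
  shows "(\<lambda>x. c * f x) \<in> CbLip"
proof -
  obtain b L where f: "\<And>x. \<bar>f x\<bar> \<le> b" "\<And>x y. \<bar>f x - f y\<bar> \<le> L * \<bar>x - y\<bar>" using CbLip_bounds[OF assms(1)] by metis
  show ?thesis
  proof (rule CbLipI)
    show "\<bar>c * f x\<bar> \<le> \<bar>c\<bar> * b" for x using f(1)[of x] by (simp add: abs_mult mult_left_mono)
    show "\<bar>c * f x - c * f y\<bar> \<le> (\<bar>c\<bar> * L) * \<bar>x - y\<bar>" for x y
      using mult_left_mono[OF f(2)[of x y], of "\<bar>c\<bar>"] by (simp add: abs_mult mult.assoc flip: right_diff_distrib)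
  qed
qed

lemma continuous_on_CbLip: "g \<in> CbLip \<Longrightarrow> continuous_on A g"
  unfolding CbLip_def by (auto intro: lipschitz_on_continuous_on continuous_on_subset)

lemma tail_fun_CbLip: "tail_fun N \<in> CbLip"
proof (rule CbLipI[of _ 1 1])
  show "\<bar>tail_fun N x\<bar> \<le> 1" for x unfolding tail_fun_def by linarith
  show "\<bar>tail_fun N x - tail_fun N y\<bar> \<le> 1 * \<bar>x - y\<bar>" for x y
    unfolding tail_fun_def min_def max_def by (simp split: abs_split)
qed

section \<open>Construction of a weakly compact representing set\<close>

context sublinear_expectation_space
begin

lemma CbLip_comp_H:
  assumes "X \<in> H" "g \<in> CbLip"
  shows "(\<lambda>\<omega>. g (X \<omega>)) \<in> H"
proof -
  obtain b L where g: "\<And>x. \<bar>g x\<bar> \<le> b" "\<And>x y. \<bar>g x - g y\<bar> \<le> L * \<bar>x - y\<bar>" using CbLip_bounds[OF assms(2)] by metis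
  have "bounded (range (\<lambda>v :: nat \<Rightarrow> real. g (v 0)))" unfolding bounded_iff using g(1) by auto
  moreover have "\<bar>g (v 0) - g (w 0)\<bar> \<le> L * L2_set (\<lambda>i. v i - w i) {..<1}" for v w :: "nat \<Rightarrow> real"
    using g(2)[of "v 0" "w 0"] by (simp add: L2_set_def)
  ultimately have "(\<lambda>v. g (v 0)) \<in> CbLip_n 1" unfolding CbLip_n_def by blast
  from H_CbLip[of 1 "\<lambda>_. X", OF _ this] assms show ?thesis by simp
qed

definition "comp_exp X g = E (\<lambda>\<omega>. g (X \<omega>))"

text \<open>The extension to all bounded continuous functions is needed because these, and not only the
  Lipschitz ones, generate the weak topology.\<close>

definition "ext_exp X f = (INF g\<in>{g \<in> CbLip. \<forall>x. apply_bcontfun f x \<le> g x}. comp_exp X g)"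
  for f :: "real \<Rightarrow>\<^sub>C real"

context
  fixes X assumes X: "X \<in> H"
begin

lemma comp_exp_mono: "f \<in> CbLip \<Longrightarrow> g \<in> CbLip \<Longrightarrow> (\<And>x. f x \<le> g x) \<Longrightarrow> comp_exp X f \<le> comp_exp X g"
  unfolding comp_exp_def by (rule E1[OF CbLip_comp_H[OF X] CbLip_comp_H[OF X]])

lemma comp_exp_const: "comp_exp X (\<lambda>_. c) = c"
  unfolding comp_exp_def by (rule E3)

lemma comp_exp_add: "f \<in> CbLip \<Longrightarrow> g \<in> CbLip \<Longrightarrow> comp_exp X (\<lambda>x. f x + g x) \<le> comp_exp X f + comp_exp X g"
  unfolding comp_exp_def by (rule E4[OF CbLip_comp_H[OF X] CbLip_comp_H[OF X]])

lemma comp_exp_scale: "f \<in> CbLip \<Longrightarrow> 0 \<le> c \<Longrightarrow> comp_exp X (\<lambda>x. c * f x) = c * comp_exp X f"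
  unfolding comp_exp_def by (rule E2[OF CbLip_comp_H[OF X]])

lemma ext_exp_bdd: "bdd_below (comp_exp X ` {g \<in> CbLip. \<forall>x. apply_bcontfun f x \<le> g x})"
proof (rule bdd_belowI2[of _ "- norm f"])
  fix g assume g: "g \<in> {g \<in> CbLip. \<forall>x. apply_bcontfun f x \<le> g x}"
  have "comp_exp X (\<lambda>_. - norm f) \<le> comp_exp X g"
  proof (rule comp_exp_mono)
    fix x
    have "- norm f \<le> apply_bcontfun f x" using norm_bounded[of f x] unfolding real_norm_def by linarith
    also have "\<dots> \<le> g x" using g by simp
    finally show "- norm f \<le> g x" .
  qed (use g in auto)
  then show "- norm f \<le> comp_exp X g" by (simp add: comp_exp_const)
qed

lemma ext_exp_nonempty: "{g \<in> CbLip. \<forall>x. apply_bcontfun f x \<le> g x} \<noteq> {}" for f :: "real \<Rightarrow>\<^sub>C real"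
proof -
  have "(\<lambda>_. norm f) \<in> {g \<in> CbLip. \<forall>x. apply_bcontfun f x \<le> g x}"
    using norm_bounded[of f] by (auto simp: abs_le_iff)
  then show ?thesis by blast
qed

lemma ext_exp_le: "g \<in> CbLip \<Longrightarrow> (\<And>x. apply_bcontfun f x \<le> g x) \<Longrightarrow> ext_exp X f \<le> comp_exp X g"
  unfolding ext_exp_def by (rule cINF_lower[OF ext_exp_bdd]) simp

lemma le_ext_exp: "(\<And>g. g \<in> CbLip \<Longrightarrow> (\<And>x. apply_bcontfun f x \<le> g x) \<Longrightarrow> b \<le> comp_exp X g) \<Longrightarrow> b \<le> ext_exp X f"
  unfolding ext_exp_def by (rule cINF_greatest[OF ext_exp_nonempty]) blast

lemma ext_exp_eq: "g \<in> CbLip \<Longrightarrow> (\<And>x. apply_bcontfun f x = g x) \<Longrightarrow> ext_exp X f = comp_exp X g"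
proof (rule antisym)
  assume g: "g \<in> CbLip" "\<And>x. apply_bcontfun f x = g x"
  show "ext_exp X f \<le> comp_exp X g" by (rule ext_exp_le) (use g in auto)
  show "comp_exp X g \<le> ext_exp X f" by (rule le_ext_exp, rule comp_exp_mono) (use g in auto)
qed

lemma sublinear_ext_exp: "sublinear (ext_exp X)"
  unfolding sublinear_def
proof (intro conjI allI impI)
  fix f1 f2
  have h: "ext_exp X (f1 + f2) - comp_exp X g1 \<le> comp_exp X g2"
    if "g1 \<in> CbLip" "\<And>x. apply_bcontfun f1 x \<le> g1 x" "g2 \<in> CbLip" "\<And>x. apply_bcontfun f2 x \<le> g2 x" for g1 g2
  proof -
    have "ext_exp X (f1 + f2) \<le> comp_exp X (\<lambda>x. g1 x + g2 x)"
      by (rule ext_exp_le) (use that in \<open>auto intro: CbLip_add add_mono\<close>)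
    also have "\<dots> \<le> comp_exp X g1 + comp_exp X g2" by (rule comp_exp_add) (use that in auto)
    finally show ?thesis by simp
  qed
  have h2: "ext_exp X (f1 + f2) - comp_exp X g1 \<le> ext_exp X f2"
    if "g1 \<in> CbLip" "\<And>x. apply_bcontfun f1 x \<le> g1 x" for g1
    by (rule le_ext_exp) (rule h[OF that])
  have "ext_exp X (f1 + f2) - ext_exp X f2 \<le> ext_exp X f1"
  proof (rule le_ext_exp)
    fix g assume "g \<in> CbLip" "\<And>x. apply_bcontfun f1 x \<le> g x"
    from h2[OF this] show "ext_exp X (f1 + f2) - ext_exp X f2 \<le> comp_exp X g" by linarith
  qed
  then show "ext_exp X (f1 + f2) \<le> ext_exp X f1 + ext_exp X f2" by simp
next
  fix c :: real and f assume c: "0 < c"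
  have "ext_exp X (c *\<^sub>R f) / c \<le> ext_exp X f"
  proof (rule le_ext_exp)
    fix g assume g: "g \<in> CbLip" "\<And>x. apply_bcontfun f x \<le> g x"
    have "ext_exp X (c *\<^sub>R f) \<le> comp_exp X (\<lambda>x. c * g x)"
      by (rule ext_exp_le) (use g c in \<open>auto intro: CbLip_scale\<close>)
    also have "\<dots> = c * comp_exp X g" using g c by (simp add: comp_exp_scale)
    finally show "ext_exp X (c *\<^sub>R f) / c \<le> comp_exp X g" using c by (simp add: field_simps)
  qed
  then show "ext_exp X (c *\<^sub>R f) \<le> c * ext_exp X f" using c by (simp add: field_simps)
qed

definition "dominated = {l. linear l \<and> (\<forall>f. l f \<le> ext_exp X f)}"

text \<open>Domination of \<open>- f\<close> gives positivity, domination of the constants 1 and -1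
  gives normalization, and \<open>E5\<close> for the tail functions gives tightness.\<close>

lemma dominated_positive_functional:
  assumes "l \<in> dominated"
  shows "positive_functional l"
proof (rule positive_functional.intro)
  show lin: "linear l" using assms by (simp add: dominated_def)
  have le: "l f \<le> comp_exp X g" if "g \<in> CbLip" "\<And>x. apply_bcontfun f x \<le> g x" for f g
  proof -
    have "l f \<le> ext_exp X f" using assms by (simp add: dominated_def)
    also have "\<dots> \<le> comp_exp X g" by (rule ext_exp_le[OF that])
    finally show ?thesis .
  qed
  show "0 \<le> l f" if "\<And>x. 0 \<le> apply_bcontfun f x" for f
  proof -
    have "l (- f) \<le> comp_exp X (\<lambda>_. 0)" by (rule le) (use that in auto)
    then show ?thesis by (simp add: comp_exp_const linear_neg[OF lin])
  qed
  show "l (const_bcontfun 1) = 1"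
  proof (rule antisym)
    show "l (const_bcontfun 1) \<le> 1" using le[of "\<lambda>_. 1" "const_bcontfun 1"] by (simp add: comp_exp_const)
    show "1 \<le> l (const_bcontfun 1)" using le[of "\<lambda>_. - 1" "- const_bcontfun 1"]
      by (simp add: comp_exp_const linear_neg[OF lin])
  qed
  fix \<epsilon> :: real assume \<epsilon>: "0 < \<epsilon>"
  have "(\<lambda>N. E (\<lambda>\<omega>. tail_fun N (X \<omega>))) \<longlonglongrightarrow> 0"
  proof (rule conjunct2[OF E5[OF X tail_fun_CbLip]])
    show "decseq (\<lambda>k. tail_fun k x)" for x by (auto simp: decseq_def tail_fun_def)
    show "(\<lambda>k. tail_fun k x) \<longlonglongrightarrow> 0" for x
    proof (rule tendsto_eventually)
      show "eventually (\<lambda>k. tail_fun k x = 0) sequentially"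
        using eventually_ge_at_top[of "nat \<lceil>\<bar>x\<bar>\<rceil>"]
        by eventually_elim (auto simp: tail_fun_def)
    qed
  qed
  from order_tendstoD(2)[OF this \<epsilon>] obtain N where "comp_exp X (tail_fun N) < \<epsilon>"
    unfolding comp_exp_def eventually_sequentially by blast
  moreover have "l (btail N) \<le> comp_exp X (tail_fun N)" by (rule le) (auto intro: tail_fun_CbLip)
  ultimately show "\<exists>N. l (btail N) < \<epsilon>" by (intro exI[of _ N]) simp
qed

text \<open>The Banach-Alaoglu argument: a pointwise closed set inside a product of compact
  intervals.\<close>

lemma compact_dominated: "compact dominated"
proof -
  have "compactin (product_topology (\<lambda>_. euclideanreal) UNIV) (PiE UNIV (\<lambda>f. {- norm f..norm f}))"
    for f :: "real \<Rightarrow>\<^sub>C real"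
    unfolding compactin_PiE by auto
  then have c: "compact (PiE UNIV (\<lambda>f :: real \<Rightarrow>\<^sub>C real. {- norm f..norm f}))"
    by (simp add: euclidean_product_topology)
  have co: "continuous_on UNIV (\<lambda>l :: (real \<Rightarrow>\<^sub>C real) \<Rightarrow> real. l f)" for f
    by (rule continuous_on_product_coordinates)
  have "closed {l :: (real \<Rightarrow>\<^sub>C real) \<Rightarrow> real. \<forall>f g. l (f + g) = l f + l g}"
    by (intro closed_Collect_all closed_Collect_eq continuous_on_add co)
  moreover have "closed {l :: (real \<Rightarrow>\<^sub>C real) \<Rightarrow> real. \<forall>c f. l (c *\<^sub>R f) = c *\<^sub>R l f}"
    by (intro closed_Collect_all closed_Collect_eq continuous_on_scaleR continuous_on_const co)
  moreover have "closed {l :: (real \<Rightarrow>\<^sub>C real) \<Rightarrow> real. \<forall>f. l f \<le> ext_exp X f}"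
    by (intro closed_Collect_all closed_Collect_le continuous_on_const co)
  ultimately have "closed ({l. \<forall>f g. l (f + g) = l f + l g} \<inter> {l. \<forall>c f. l (c *\<^sub>R f) = c *\<^sub>R l f} \<inter>
      {l. \<forall>f. l f \<le> ext_exp X f})" by (intro closed_Int)
  also have "\<dots> = dominated" by (auto simp: dominated_def linear_iff)
  finally have "closed dominated" .
  moreover have "dominated \<subseteq> PiE UNIV (\<lambda>f. {- norm f..norm f})"
  proof
    fix l assume "l \<in> dominated"
    then interpret positive_functional l by (rule dominated_positive_functional)
    have "\<bar>l f\<bar> \<le> norm f" for f by (rule abs_le) (use norm_bounded[of f] in auto)
    then show "l \<in> PiE UNIV (\<lambda>f. {- norm f..norm f})" by (auto simp: abs_le_iff minus_le_iff)
  qed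
  ultimately show ?thesis using compact_Int_closed[OF c, of dominated] by (simp add: Int_absorb1)
qed

text \<open>The integrals that generate the weak topology are coordinates of the functional, so
  passing to the measure is continuous and the image of \<open>dominated\<close> is compact. A
  supporting functional at \<phi> makes the supremum a maximum.\<close>

lemma ex_represents: "\<exists>\<Theta>. represents E X \<Theta>"
proof -
  define R where "R l = (SOME \<mu>. real_distribution \<mu> \<and> (\<forall>f. l f = (\<integral>x. apply_bcontfun f x \<partial>\<mu>)))"
    for l :: "(real \<Rightarrow>\<^sub>C real) \<Rightarrow> real"
  have R: "real_distribution (R l)" "\<And>f. l f = (\<integral>x. apply_bcontfun f x \<partial>R l)" if "l \<in> dominated" for l
    using someI_ex[OF positive_functional.representation[OF dominated_positive_functional[OF that]]]
    unfolding R_def by blast+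
  have Rp: "prob_space (R l)" "sets (R l) = sets borel" if "l \<in> dominated" for l
    using R(1)[OF that] by (simp_all add: real_distribution_def real_distribution_axioms_def)
  have int: "(\<integral>x. f x \<partial>R l) = l (Bcontfun f)" if "l \<in> dominated" "continuous_on UNIV f" "bounded (range f)" for f l
    using R(2)[OF that(1), of "Bcontfun f"] Bcontfun_inverse[of f] that(2,3) by (simp add: bcontfun_def)
  define S where "S = {{\<mu>. prob_space \<mu> \<and> sets \<mu> = sets borel \<and> (\<integral>x. f x \<partial>\<mu>) \<in> U}
        | (f :: real \<Rightarrow> real) (U :: real set). continuous_on UNIV f \<and> bounded (range f) \<and> open U}"
  have "continuous_map (top_of_set dominated) weak_topology R"
    unfolding weak_topology_def S_def[symmetric]
  proof (rule continuous_on_generated_topo)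
    fix V assume "V \<in> S"
    then obtain f :: "real \<Rightarrow> real" and U :: "real set" where V: "V = {\<mu>. prob_space \<mu> \<and> sets \<mu> = sets borel \<and> (\<integral>x. f x \<partial>\<mu>) \<in> U}"
      and f: "continuous_on UNIV f" "bounded (range f)" and U: "open U" unfolding S_def by blast
    have "R -` V \<inter> topspace (top_of_set dominated) = (\<lambda>l. l (Bcontfun f)) -` U \<inter> dominated"
      using Rp int[OF _ f] by (auto simp: V)
    also have "openin (top_of_set dominated) \<dots>"
      using open_vimage[OF U continuous_on_product_coordinates[of "Bcontfun f"]]
      by (metis Int_commute openin_open_Int)
    finally show "openin (top_of_set dominated) (R -` V \<inter> topspace (top_of_set dominated))" .
  next
    \<comment> \<open>This subbasic set consists of all Borel probability measures, which makes them
      points of the topology.\<close>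
    have "{\<mu> :: real measure. prob_space \<mu> \<and> sets \<mu> = sets borel \<and> (\<integral>x. (0::real) \<partial>\<mu>) \<in> UNIV} \<in> S"
      unfolding S_def by (rule CollectI, rule exI[of _ "\<lambda>_. 0"], rule exI[of _ UNIV]) auto
    then show "R ` topspace (top_of_set dominated) \<subseteq> \<Union> S" using Rp by auto
  qed
  moreover have "compactin (top_of_set dominated) dominated"
    using compact_dominated by (simp add: compactin_subtopology)
  ultimately have cpt: "compactin weak_topology (R ` dominated)" by (rule image_compactin[rotated])
  have sup: "E (\<lambda>\<omega>. \<phi> (X \<omega>)) = (SUP \<mu>\<in>R ` dominated. \<integral>x. \<phi> x \<partial>\<mu>)" if \<phi>: "\<phi> \<in> CbLip" for \<phi>
  proof -
    have c: "continuous_on UNIV \<phi>" "bounded (range \<phi>)"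
      using \<phi> continuous_on_CbLip by (auto simp: CbLip_def)
    have ap: "apply_bcontfun (Bcontfun \<phi>) = \<phi>" using Bcontfun_inverse[of \<phi>] c by (simp add: bcontfun_def)
    have e: "ext_exp X (Bcontfun \<phi>) = comp_exp X \<phi>" by (rule ext_exp_eq[OF \<phi>]) (simp add: ap)
    obtain l where l: "l \<in> dominated" "l (Bcontfun \<phi>) = comp_exp X \<phi>"
      using ex_linear_support[OF sublinear_ext_exp, of "Bcontfun \<phi>"] unfolding dominated_def e by blast
    have "(SUP \<mu>\<in>R ` dominated. \<integral>x. \<phi> x \<partial>\<mu>) = comp_exp X \<phi>"
    proof (rule cSup_eq_maximum)
      show "comp_exp X \<phi> \<in> (\<lambda>\<mu>. \<integral>x. \<phi> x \<partial>\<mu>) ` R ` dominated"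
        using l int[OF l(1) c] by force
      fix y assume "y \<in> (\<lambda>\<mu>. \<integral>x. \<phi> x \<partial>\<mu>) ` R ` dominated"
      then obtain l' where "l' \<in> dominated" "y = l' (Bcontfun \<phi>)" using int[OF _ c] by auto
      then show "y \<le> comp_exp X \<phi>" unfolding dominated_def e[symmetric] by blast
    qed
    then show ?thesis by (simp add: comp_exp_def)
  qed
  have ne: "R ` dominated \<noteq> {}" using ex_linear_support[OF sublinear_ext_exp, of 0] by (auto simp: dominated_def)
  have "represents E X (R ` dominated)"
    unfolding represents_def by (intro conjI ballI ne cpt sup)
  then show ?thesis ..
qed

end

end

section \<open>Lindeberg's method\<close>

lemma ext_integral_eq:
  assumes "integrable \<mu> \<psi>"
  shows "ext_integral \<mu> \<psi> = ereal (\<integral>x. \<psi> x \<partial>\<mu>)"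
proof -
  have fin: "(\<integral>\<^sup>+x. ennreal (\<psi> x) \<partial>\<mu>) < \<infinity>" "(\<integral>\<^sup>+x. ennreal (- \<psi> x) \<partial>\<mu>) < \<infinity>"
    using assms by (auto simp: real_integrable_def less_top)
  have eq: "enn2ereal x = ereal (enn2real x)" if "x < \<infinity>" for x
    using that by (cases x rule: ennreal_cases) (simp_all add: enn2ereal_ennreal)
  show ?thesis
    unfolding ext_integral_def real_lebesgue_integral_def[OF assms] eq[OF fin(1)] eq[OF fin(2)] by simp
qed

lemma integrable_of_ext_integral_le:
  assumes "\<psi> \<in> borel_measurable \<mu>" "\<And>x. 0 \<le> \<psi> x" "ext_integral \<mu> \<psi> \<le> ereal b"
  shows "integrable \<mu> \<psi>"
proof (rule integrableI_nonneg[OF assms(1)])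
  have "(\<integral>\<^sup>+x. ennreal (- \<psi> x) \<partial>\<mu>) = 0" using assms(2) by (simp add: ennreal_neg)
  then have le: "enn2ereal (\<integral>\<^sup>+x. ennreal (\<psi> x) \<partial>\<mu>) \<le> ereal b"
    using assms(3) by (simp add: ext_integral_def zero_ennreal.rep_eq)
  have "x < \<infinity>" if "enn2ereal x \<le> ereal b" for x
    using that by (cases x rule: ennreal_cases) (simp_all add: top_ennreal.rep_eq)
  from this[OF le] show "(\<integral>\<^sup>+x. ennreal (\<psi> x) \<partial>\<mu>) < \<infinity>" .
qed (use assms(2) in simp)

lemma powr_five_halves: "\<bar>x\<bar> powr (2 + 1 / 2) = x\<^sup>2 * sqrt \<bar>x\<bar>"
proof (cases "x = 0")
  case False
  then have "\<bar>x\<bar> powr (2 + 1 / 2) = \<bar>x\<bar> powr 2 * \<bar>x\<bar> powr (1 / 2)" by (simp only: powr_add)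
  also have "\<dots> = x\<^sup>2 * sqrt \<bar>x\<bar>" using False by (simp add: powr_half_sqrt)
  finally show ?thesis .
qed simp

lemma representsD:
  assumes "represents E X \<Theta>" "\<mu> \<in> \<Theta>"
  shows "prob_space \<mu>" "sets \<mu> = sets borel"
proof -
  have "\<Theta> \<subseteq> topspace weak_topology"
    using assms(1) compactin_subset_topspace unfolding represents_def by blast
  with assms(2) have "\<mu> \<in> topspace weak_topology" by blast
  then show "prob_space \<mu>" "sets \<mu> = sets borel"
    unfolding weak_topology_def topology_generated_by_topspace by auto
qed

context sublinear_expectation_space
begin

definition "rep_set X = (SOME \<Theta>. represents E X \<Theta>)"

lemma represents_rep_set: "X \<in> H \<Longrightarrow> represents E X (rep_set X)"
  unfolding rep_set_def by (rule someI_ex[OF ex_represents])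

lemma upper_exp_eq: "upper_exp E X \<psi> = (SUP \<mu>\<in>rep_set X. ext_integral \<mu> \<psi>)"
  by (simp add: upper_exp_def rep_set_def)

lemma ext_integral_le_upper_exp: "\<mu> \<in> rep_set X \<Longrightarrow> ext_integral \<mu> \<psi> \<le> upper_exp E X \<psi>"
  unfolding upper_exp_eq by (rule SUP_upper)

text \<open>A constant is a Lipschitz function of no variables.\<close>

lemma const_H: "(\<lambda>_. c) \<in> H"
proof -
  have "(\<lambda>_. c) \<in> CbLip_n 0" unfolding CbLip_n_def by (auto intro!: exI[of _ 0])
  from H_CbLip[of 0, OF _ this] show ?thesis by simp
qed

lemma E_abs_diff_le:
  assumes "Y \<in> H" "Z \<in> H" "\<And>\<omega>. \<bar>Y \<omega> - Z \<omega>\<bar> \<le> c"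
  shows "\<bar>E Y - E Z\<bar> \<le> c"
proof -
  have main: "E Y \<le> E Z + c" if "Y \<in> H" "Z \<in> H" "\<And>\<omega>. Y \<omega> \<le> Z \<omega> + c" for Y Z
  proof -
    have "E Y \<le> E (\<lambda>\<omega>. Z \<omega> + c)" by (rule E1[OF H_add[OF that(2) const_H] that(1)]) (rule that(3))
    also have "\<dots> \<le> E Z + E (\<lambda>_. c)" by (rule E4[OF that(2) const_H])
    finally show ?thesis by (simp add: E3)
  qed
  have le: "Y \<omega> \<le> Z \<omega> + c" "Z \<omega> \<le> Y \<omega> + c" for \<omega> using assms(3)[of \<omega>] by linarith+
  have "E Y \<le> E Z + c" by (rule main[OF assms(1,2) le(1)])
  moreover have "E Z \<le> E Y + c" by (rule main[OF assms(2,1) le(2)])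
  ultimately show ?thesis by linarith
qed

end

locale centered_variable = sublinear_expectation_space +
  fixes X and su sl :: real and m :: real
  assumes X: "X \<in> H"
    and mean: "upper_exp E X (\<lambda>x. x) = 0" "upper_exp E X (\<lambda>x. - x) = 0"
    and su: "upper_exp E X (\<lambda>x. x\<^sup>2) = ereal (su\<^sup>2)"
    and sl: "- upper_exp E X (\<lambda>x. - x\<^sup>2) = ereal (sl\<^sup>2)"
    and m: "upper_exp E X (\<lambda>x. \<bar>x\<bar> powr (2 + 1 / 2)) \<le> ereal m"
begin

lemma sl': "upper_exp E X (\<lambda>x. - x\<^sup>2) = ereal (- sl\<^sup>2)"
  using sl by (cases "upper_exp E X (\<lambda>x. - x\<^sup>2)") auto

context
  fixes \<mu> assumes \<mu>: "\<mu> \<in> rep_set X"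
begin

lemma prob_\<mu>: "prob_space \<mu>" and sets_\<mu> [measurable_cong]: "sets \<mu> = sets borel"
  using representsD[OF represents_rep_set[OF X] \<mu>] by auto

lemma integrable_sq: "integrable \<mu> (\<lambda>x. x\<^sup>2)"
proof (rule integrable_of_ext_integral_le)
  show "(\<lambda>x. x\<^sup>2) \<in> borel_measurable \<mu>" by measurable
  show "ext_integral \<mu> (\<lambda>x. x\<^sup>2) \<le> ereal (su\<^sup>2)"
    using ext_integral_le_upper_exp[OF \<mu>, of "\<lambda>x. x\<^sup>2"] unfolding su .
qed simp

lemma integral_sq: "(\<integral>x. x\<^sup>2 \<partial>\<mu>) \<le> su\<^sup>2" "sl\<^sup>2 \<le> (\<integral>x. x\<^sup>2 \<partial>\<mu>)"
proof -
  show "(\<integral>x. x\<^sup>2 \<partial>\<mu>) \<le> su\<^sup>2"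
    using ext_integral_le_upper_exp[OF \<mu>, of "\<lambda>x. x\<^sup>2"] unfolding su ext_integral_eq[OF integrable_sq] by simp
  have "integrable \<mu> (\<lambda>x. - x\<^sup>2)" using integrable_sq by simp
  from ext_integral_eq[OF this] show "sl\<^sup>2 \<le> (\<integral>x. x\<^sup>2 \<partial>\<mu>)"
    using ext_integral_le_upper_exp[OF \<mu>, of "\<lambda>x. - x\<^sup>2"] unfolding sl' by simp
qed

lemma integrable_id: "integrable \<mu> (\<lambda>x. x)"
proof (rule Bochner_Integration.integrable_bound)
  interpret prob_space \<mu> by (rule prob_\<mu>)
  show "integrable \<mu> (\<lambda>x. 1 + x\<^sup>2)" using integrable_sq by simp
  show "(\<lambda>x. x) \<in> borel_measurable \<mu>" by measurable
  have "\<bar>x\<bar> \<le> 1 + x\<^sup>2" for x :: real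
  proof -
    have "0 \<le> (\<bar>x\<bar> - 1 / 2)\<^sup>2" by simp
    then show ?thesis by (simp add: power2_eq_square algebra_simps)
  qed
  then show "AE x in \<mu>. norm x \<le> norm (1 + x\<^sup>2)" by simp
qed

text \<open>Both upper means vanish, so no measure of the set can have a positive or a negative
  mean.\<close>

lemma integral_id: "(\<integral>x. x \<partial>\<mu>) = 0"
proof -
  have "integrable \<mu> (\<lambda>x. - x)" using integrable_id by simp
  from ext_integral_eq[OF this] ext_integral_le_upper_exp[OF \<mu>, of "\<lambda>x. - x"]
    ext_integral_eq[OF integrable_id] ext_integral_le_upper_exp[OF \<mu>, of "\<lambda>x. x"]
  show ?thesis unfolding mean by (simp add: zero_ereal_def)
qed

lemma integrable_moment: "integrable \<mu> (\<lambda>x. x\<^sup>2 * sqrt \<bar>x\<bar>)"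
  and integral_moment: "(\<integral>x. x\<^sup>2 * sqrt \<bar>x\<bar> \<partial>\<mu>) \<le> m"
proof -
  have le: "ext_integral \<mu> (\<lambda>x. x\<^sup>2 * sqrt \<bar>x\<bar>) \<le> ereal m"
    using order_trans[OF ext_integral_le_upper_exp[OF \<mu>] m] by (simp only: powr_five_halves)
  show i: "integrable \<mu> (\<lambda>x. x\<^sup>2 * sqrt \<bar>x\<bar>)"
  proof (rule integrable_of_ext_integral_le[OF _ _ le])
    show "(\<lambda>x. x\<^sup>2 * sqrt \<bar>x\<bar>) \<in> borel_measurable \<mu>" by measurable
  qed simp
  show "(\<integral>x. x\<^sup>2 * sqrt \<bar>x\<bar> \<partial>\<mu>) \<le> m" using le unfolding ext_integral_eq[OF i] by simp
qed

end

lemma rep_set_nonempty: "rep_set X \<noteq> {}"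
  using represents_rep_set[OF X] by (simp add: represents_def)

lemma ex_integral_sq_gt:
  assumes "0 < \<epsilon>"
  obtains \<mu> where "\<mu> \<in> rep_set X" "su\<^sup>2 - \<epsilon> < (\<integral>x. x\<^sup>2 \<partial>\<mu>)"
proof -
  have "ereal (su\<^sup>2 - \<epsilon>) < (SUP \<mu>\<in>rep_set X. ext_integral \<mu> (\<lambda>x. x\<^sup>2))"
    using assms unfolding upper_exp_eq[symmetric] su by simp
  then obtain \<mu> where "\<mu> \<in> rep_set X" "ereal (su\<^sup>2 - \<epsilon>) < ext_integral \<mu> (\<lambda>x. x\<^sup>2)"
    unfolding less_SUP_iff by blast
  with that ext_integral_eq[OF integrable_sq] show ?thesis by simp
qed

lemma ex_integral_sq_lt:
  assumes "0 < \<epsilon>"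
  obtains \<mu> where "\<mu> \<in> rep_set X" "(\<integral>x. x\<^sup>2 \<partial>\<mu>) < sl\<^sup>2 + \<epsilon>"
proof -
  have "ereal (- sl\<^sup>2 - \<epsilon>) < (SUP \<mu>\<in>rep_set X. ext_integral \<mu> (\<lambda>x. - x\<^sup>2))"
    using assms unfolding upper_exp_eq[symmetric] sl' by simp
  then obtain \<mu> where \<mu>: "\<mu> \<in> rep_set X" "ereal (- sl\<^sup>2 - \<epsilon>) < ext_integral \<mu> (\<lambda>x. - x\<^sup>2)"
    unfolding less_SUP_iff by blast
  have "integrable \<mu> (\<lambda>x. - x\<^sup>2)" using integrable_sq[OF \<mu>(1)] by simp
  with that \<mu> ext_integral_eq[OF this] show ?thesis by simp
qed

text \<open>Lets the right-hand side of the bound absorb powers of the step size. Under a measure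
  with second moment above \<open>3/4 * su^2\<close>, the part of \<open>x^2\<close> on
  \<open>|x| > su/2\<close> contributes at least \<open>su^2 / 2\<close>, and there
  \<open>x^2\<close> is at most \<open>x^2 * sqrt |x| / sqrt (su/2)\<close>.\<close>

lemma moment_lower_bound:
  assumes "0 < su"
  shows "su\<^sup>2 * sqrt su \<le> 4 * m"
proof -
  define \<kappa> where "\<kappa> = su / 2"
  have l: "0 < \<kappa>" using assms by (simp add: \<kappa>_def)
  obtain \<mu> where \<mu>: "\<mu> \<in> rep_set X" "su\<^sup>2 - su\<^sup>2 / 4 < (\<integral>x. x\<^sup>2 \<partial>\<mu>)"
    using ex_integral_sq_gt[of "su\<^sup>2 / 4"] assms by auto
  interpret prob_space \<mu> by (rule prob_\<mu>[OF \<mu>(1)])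
  have "(\<integral>x. x\<^sup>2 \<partial>\<mu>) \<le> (\<integral>x. \<kappa>\<^sup>2 + (x\<^sup>2 * sqrt \<bar>x\<bar>) / sqrt \<kappa> \<partial>\<mu>)"
  proof (rule integral_mono)
    show "x\<^sup>2 \<le> \<kappa>\<^sup>2 + (x\<^sup>2 * sqrt \<bar>x\<bar>) / sqrt \<kappa>" for x
    proof (cases "\<bar>x\<bar> \<le> \<kappa>")
      case True
      then have "\<bar>x\<bar>\<^sup>2 \<le> \<kappa>\<^sup>2" by (intro power_mono) auto
      moreover have "0 \<le> (x\<^sup>2 * sqrt \<bar>x\<bar>) / sqrt \<kappa>" using l by simp
      ultimately show ?thesis by simp
    next
      case False
      then have "x\<^sup>2 * sqrt \<kappa> \<le> x\<^sup>2 * sqrt \<bar>x\<bar>" by (intro mult_left_mono) auto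
      then have "x\<^sup>2 \<le> (x\<^sup>2 * sqrt \<bar>x\<bar>) / sqrt \<kappa>" using l by (simp add: pos_le_divide_eq)
      then show ?thesis by (simp add: add_increasing)
    qed
  qed (use integrable_sq[OF \<mu>(1)] integrable_moment[OF \<mu>(1)] in auto)
  also have "\<dots> = \<kappa>\<^sup>2 + (\<integral>x. x\<^sup>2 * sqrt \<bar>x\<bar> \<partial>\<mu>) / sqrt \<kappa>"
    using integrable_moment[OF \<mu>(1)] prob_space by simp
  also have "\<dots> \<le> \<kappa>\<^sup>2 + m / sqrt \<kappa>"
    using integral_moment[OF \<mu>(1)] l by (intro add_left_mono divide_right_mono) auto
  finally have "su\<^sup>2 / 2 \<le> m / sqrt \<kappa>" using \<mu>(2) by (simp add: \<kappa>_def power2_eq_square)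
  then have 1: "su\<^sup>2 / 2 * sqrt \<kappa> \<le> m" using l by (simp add: pos_le_divide_eq)
  have "sqrt (su / 4) \<le> sqrt \<kappa>" using assms by (simp add: \<kappa>_def)
  then have "sqrt su / 2 \<le> sqrt \<kappa>" by (simp add: real_sqrt_divide)
  then have "su\<^sup>2 / 2 * (sqrt su / 2) \<le> su\<^sup>2 / 2 * sqrt \<kappa>" by (intro mult_left_mono) auto
  with 1 show ?thesis by (simp add: algebra_simps)
qed

text \<open>The linear term integrates to 0 under every measure, so the supremum only concerns the
  quadratic one: it selects the upper variance for \<open>D \<ge> 0\<close> and the lower variance
  otherwise.\<close>

lemma one_step:
  assumes \<psi>: "\<psi> \<in> CbLip" and K: "0 \<le> K"
    and taylor: "\<And>x. \<bar>\<psi> x - (A + B * x + D / 2 * x\<^sup>2)\<bar> \<le> K * (x\<^sup>2 * sqrt \<bar>x\<bar>)"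
  shows "\<bar>E (\<lambda>\<omega>. \<psi> (X \<omega>)) - (A + (max D 0 * su\<^sup>2 - max (- D) 0 * sl\<^sup>2) / 2)\<bar> \<le> K * m"
proof -
  define R where "R = (max D 0 * su\<^sup>2 - max (- D) 0 * sl\<^sup>2) / 2"
  have eq: "E (\<lambda>\<omega>. \<psi> (X \<omega>)) = (SUP \<mu>\<in>rep_set X. \<integral>x. \<psi> x \<partial>\<mu>)"
    using represents_rep_set[OF X] \<psi> by (simp add: represents_def)
  have int: "\<bar>(\<integral>x. \<psi> x \<partial>\<mu>) - (A + D / 2 * (\<integral>x. x\<^sup>2 \<partial>\<mu>))\<bar> \<le> K * m" if \<mu>: "\<mu> \<in> rep_set X" for \<mu>
  proof -
    interpret prob_space \<mu> by (rule prob_\<mu>[OF \<mu>])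
    note [measurable_cong] = sets_\<mu>[OF \<mu>]
    obtain b L where b: "\<And>x. \<bar>\<psi> x\<bar> \<le> b" using CbLip_bounds[OF \<psi>] by metis
    have "\<psi> \<in> borel_measurable borel" by (rule borel_measurable_continuous_onI[OF continuous_on_CbLip[OF \<psi>]])
    then have "\<psi> \<in> borel_measurable \<mu>" by (simp add: measurable_cong_sets[OF sets_\<mu>[OF \<mu>] refl])
    then have i\<psi>: "integrable \<mu> \<psi>" by (intro integrable_const_bound[of _ b]) (use b in auto)
    note ii = integrable_sq[OF \<mu>] integrable_id[OF \<mu>]
    have "(\<integral>x. \<psi> x - (A + B * x + D / 2 * x\<^sup>2) \<partial>\<mu>) = (\<integral>x. \<psi> x \<partial>\<mu>) - (A + D / 2 * (\<integral>x. x\<^sup>2 \<partial>\<mu>))"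
      using i\<psi> ii integral_id[OF \<mu>] prob_space by simp
    moreover have "\<bar>\<integral>x. \<psi> x - (A + B * x + D / 2 * x\<^sup>2) \<partial>\<mu>\<bar> \<le> (\<integral>x. \<bar>\<psi> x - (A + B * x + D / 2 * x\<^sup>2)\<bar> \<partial>\<mu>)"
      by (rule integral_abs_bound)
    moreover have "\<dots> \<le> (\<integral>x. K * (x\<^sup>2 * sqrt \<bar>x\<bar>) \<partial>\<mu>)"
      by (rule integral_mono) (use i\<psi> ii integrable_moment[OF \<mu>] taylor in auto)
    moreover have "\<dots> = K * (\<integral>x. x\<^sup>2 * sqrt \<bar>x\<bar> \<partial>\<mu>)" by simp
    moreover have "\<dots> \<le> K * m" by (rule mult_left_mono[OF integral_moment[OF \<mu>] K])
    ultimately show ?thesis by linarith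
  qed
  have up: "D / 2 * (\<integral>x. x\<^sup>2 \<partial>\<mu>) \<le> R" if \<mu>: "\<mu> \<in> rep_set X" for \<mu>
  proof (cases "0 \<le> D")
    case True
    then show ?thesis using mult_left_mono[OF integral_sq(1)[OF \<mu>], of "D / 2"] by (simp add: R_def)
  next
    case False
    then show ?thesis using mult_left_mono_neg[OF integral_sq(2)[OF \<mu>], of "D / 2"] by (simp add: R_def)
  qed
  have bound: "(\<integral>x. \<psi> x \<partial>\<mu>) \<le> A + R + K * m" if "\<mu> \<in> rep_set X" for \<mu>
    using int[OF that] up[OF that] by linarith
  have "(SUP \<mu>\<in>rep_set X. \<integral>x. \<psi> x \<partial>\<mu>) \<le> A + R + K * m"
    by (rule cSUP_least[OF rep_set_nonempty bound])
  moreover have "A + R - K * m \<le> (SUP \<mu>\<in>rep_set X. \<integral>x. \<psi> x \<partial>\<mu>)"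
  proof (rule field_le_epsilon)
    fix \<epsilon> :: real assume \<epsilon>: "0 < \<epsilon>"
    \<comment> \<open>The extreme variances are approached up to \<open>e\<close>, at a cost of at
      most \<epsilon>; the summand 1 keeps the denominator positive for
      \<open>D = 0\<close>.\<close>
    define e where "e = \<epsilon> / (\<bar>D\<bar> / 2 + 1)"
    have e: "0 < e" "\<bar>D\<bar> / 2 * e \<le> \<epsilon>" using \<epsilon> by (auto simp: e_def field_simps add_pos_nonneg)
    have "\<exists>\<mu>\<in>rep_set X. R - \<epsilon> \<le> D / 2 * (\<integral>x. x\<^sup>2 \<partial>\<mu>)"
    proof (cases "0 \<le> D")
      case True
      obtain \<mu> where \<mu>: "\<mu> \<in> rep_set X" "su\<^sup>2 - e < (\<integral>x. x\<^sup>2 \<partial>\<mu>)" by (rule ex_integral_sq_gt[OF e(1)])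
      have "D / 2 * (su\<^sup>2 - e) \<le> D / 2 * (\<integral>x. x\<^sup>2 \<partial>\<mu>)" using \<mu> True by (intro mult_left_mono) auto
      then show ?thesis using \<mu>(1) e True by (intro bexI[of _ \<mu>]) (auto simp: R_def algebra_simps)
    next
      case False
      obtain \<mu> where \<mu>: "\<mu> \<in> rep_set X" "(\<integral>x. x\<^sup>2 \<partial>\<mu>) < sl\<^sup>2 + e" by (rule ex_integral_sq_lt[OF e(1)])
      have "D / 2 * (sl\<^sup>2 + e) \<le> D / 2 * (\<integral>x. x\<^sup>2 \<partial>\<mu>)" using \<mu> False by (intro mult_left_mono_neg) auto
      then show ?thesis using \<mu>(1) e False by (intro bexI[of _ \<mu>]) (auto simp: R_def algebra_simps)
    qed
    then obtain \<mu> where \<mu>: "\<mu> \<in> rep_set X" "R - \<epsilon> \<le> D / 2 * (\<integral>x. x\<^sup>2 \<partial>\<mu>)" by blast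
    have "(\<integral>x. \<psi> x \<partial>\<mu>) \<le> (SUP \<mu>\<in>rep_set X. \<integral>x. \<psi> x \<partial>\<mu>)"
      by (rule cSUP_upper[OF \<mu>(1)]) (rule bdd_aboveI2[OF bound])
    then show "A + R - K * m \<le> (SUP \<mu>\<in>rep_set X. \<integral>x. \<psi> x \<partial>\<mu>) + \<epsilon>"
      using int[OF \<mu>(1)] \<mu>(2) by linarith
  qed
  ultimately show ?thesis unfolding eq R_def[symmetric] by linarith
qed

end

section \<open>Telescoping along independent variables\<close>

context sublinear_expectation_space
begin

lemma CbLip_shift: "f \<in> CbLip \<Longrightarrow> (\<lambda>x. f (a + x / s)) \<in> CbLip" for s :: real
proof -
  assume "f \<in> CbLip"
  then obtain b L where f: "\<And>x. \<bar>f x\<bar> \<le> b" "\<And>x y. \<bar>f x - f y\<bar> \<le> L * \<bar>x - y\<bar>" using CbLip_bounds by metis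
  show ?thesis
  proof (rule CbLipI[of _ b])
    show "\<bar>f (a + x / s) - f (a + y / s)\<bar> \<le> (L / \<bar>s\<bar>) * \<bar>x - y\<bar>" for x y
      using f(2)[of "a + x / s" "a + y / s"] by (simp add: abs_divide flip: diff_divide_distrib)
  qed (rule f)
qed

lemma H_sum: "finite I \<Longrightarrow> (\<And>i. i \<in> I \<Longrightarrow> \<xi> i \<in> H) \<Longrightarrow> (\<lambda>\<omega>. \<Sum>i\<in>I. \<xi> i \<omega>) \<in> H"
  by (induction I rule: finite_induct) (auto intro: H_zero H_add)

lemma CbLip_n_sum:
  assumes "f \<in> CbLip"
  shows "(\<lambda>v. f ((\<Sum>j<k. v j) / s)) \<in> CbLip_n k"
proof -
  obtain b L where f: "\<And>x. \<bar>f x\<bar> \<le> b" "\<And>x y. \<bar>f x - f y\<bar> \<le> L * \<bar>x - y\<bar>" using CbLip_bounds[OF assms] by metis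
  have "\<bar>f ((\<Sum>j<k. v j) / s) - f ((\<Sum>j<k. w j) / s)\<bar> \<le> (\<bar>L\<bar> / \<bar>s\<bar> * real k) * L2_set (\<lambda>i. v i - w i) {..<k}"
    for v w :: "nat \<Rightarrow> real"
  proof -
    have "\<bar>f ((\<Sum>j<k. v j) / s) - f ((\<Sum>j<k. w j) / s)\<bar> \<le> L * \<bar>(\<Sum>j<k. v j) / s - (\<Sum>j<k. w j) / s\<bar>"
      by (rule f(2))
    also have "(\<Sum>j<k. v j) / s - (\<Sum>j<k. w j) / s = (\<Sum>j<k. v j - w j) / s"
      by (simp add: sum_subtractf diff_divide_distrib)
    also have "L * \<bar>\<dots>\<bar> \<le> \<bar>L\<bar> * (\<bar>\<Sum>j<k. v j - w j\<bar> / \<bar>s\<bar>)"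
      by (simp add: abs_divide mult_right_mono divide_right_mono)
    also have "\<dots> \<le> \<bar>L\<bar> * ((\<Sum>j<k. L2_set (\<lambda>i. v i - w i) {..<k}) / \<bar>s\<bar>)"
    proof (intro mult_left_mono divide_right_mono)
      have "\<bar>v j - w j\<bar> \<le> L2_set (\<lambda>i. v i - w i) {..<k}" if "j \<in> {..<k}" for j
        using member_le_L2_set[of "{..<k}" j "\<lambda>i. \<bar>v i - w i\<bar>"] that by (simp add: L2_set_def)
      then show "\<bar>\<Sum>j<k. v j - w j\<bar> \<le> (\<Sum>j<k. L2_set (\<lambda>i. v i - w i) {..<k})"
        by (intro order_trans[OF sum_abs] sum_mono) auto
    qed auto
    finally show ?thesis by (simp add: mult_ac)
  qed
  moreover have "bounded (range (\<lambda>v. f ((\<Sum>j<k. v j) / s)))" unfolding bounded_iff using f(1) by auto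
  ultimately show ?thesis unfolding CbLip_n_def by blast
qed

text \<open>Independence lets the last variable be integrated first. The inner expectation \<Psi>
  inherits the bound and the Lipschitz constant of \<open>f (Suc k)\<close> and is uniformly close
  to \<open>f k\<close>, so \<open>f k\<close> may replace it under the outer expectation.\<close>

lemma lindeberg_telescope:
  assumes \<xi>: "\<And>i. i \<in> {1..n} \<Longrightarrow> \<xi> i \<in> H" and ind: "indep_seq E n \<xi>"
    and f: "\<And>i. f i \<in> CbLip"
    and step: "\<And>i x. i \<in> {1..n} \<Longrightarrow> \<bar>E (\<lambda>\<omega>. f i (x + \<xi> i \<omega> / s)) - f (i - 1) x\<bar> \<le> e i"
  shows "k \<in> {1..n} \<Longrightarrow> \<bar>E (\<lambda>\<omega>. f k ((\<Sum>i=1..k. \<xi> i \<omega>) / s)) - f 0 0\<bar> \<le> (\<Sum>i=1..k. e i)"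
proof (induction k)
  case (Suc k)
  show ?case
  proof (cases "k = 0")
    case True
    then show ?thesis using step[of 1 0] Suc.prems by simp
  next
    case False
    then have k: "k \<in> {1..n}" "1 \<le> k \<and> k < n" "Suc k \<in> {1..n}" using Suc.prems by auto
    define \<Psi> where "\<Psi> x = E (\<lambda>\<omega>. f (Suc k) (x + \<xi> (Suc k) \<omega> / s))" for x
    have inH: "(\<lambda>\<omega>. f (Suc k) (x + \<xi> (Suc k) \<omega> / s)) \<in> H" for x
      by (rule CbLip_comp_H[OF \<xi>[OF k(3)] CbLip_shift[OF f]])
    obtain b L where fb: "\<And>x. \<bar>f (Suc k) x\<bar> \<le> b" "\<And>x y. \<bar>f (Suc k) x - f (Suc k) y\<bar> \<le> L * \<bar>x - y\<bar>"
      using CbLip_bounds[OF f[of "Suc k"]] by metis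
    have \<Psi>: "\<Psi> \<in> CbLip"
    proof (rule CbLipI)
      show "\<bar>\<Psi> x\<bar> \<le> b" for x
        using E_abs_diff_le[OF inH const_H[of 0], of x b] fb(1) by (simp add: \<Psi>_def E3)
      show "\<bar>\<Psi> x - \<Psi> y\<bar> \<le> L * \<bar>x - y\<bar>" for x y
        unfolding \<Psi>_def
      proof (rule E_abs_diff_le[OF inH inH])
        show "\<bar>f (Suc k) (x + \<xi> (Suc k) \<omega> / s) - f (Suc k) (y + \<xi> (Suc k) \<omega> / s)\<bar> \<le> L * \<bar>x - y\<bar>" for \<omega>
          using fb(2)[of "x + \<xi> (Suc k) \<omega> / s" "y + \<xi> (Suc k) \<omega> / s"] by simp
      qed
    qed
    define S where "S \<omega> = (\<Sum>i=1..k. \<xi> i \<omega>) / s" for \<omega>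
    have SH: "S \<in> H"
      unfolding S_def using H_scale[OF H_sum[of "{1..k}" \<xi>], of "1 / s"] \<xi> k by simp
    have S_eq: "S \<omega> = (\<Sum>j<k. \<xi> (j + 1) \<omega>) / s" for \<omega>
      unfolding S_def by (simp add: sum.atLeast1_atMost_eq lessThan_Suc_atMost[symmetric])
    have "indep_from E 1 (\<lambda>_. \<xi> (k + 1)) k (\<lambda>j. \<xi> (j + 1))"
      using ind k(2) unfolding indep_seq_def by blast
    from this[unfolded indep_from_def, rule_format, OF CbLip_n_sum[OF f[of "Suc k"], of "k + 1" s]]
    have "E (\<lambda>\<omega>. f (Suc k) ((\<Sum>j<k + 1. if j < k then \<xi> (j + 1) \<omega> else \<xi> (k + 1) \<omega>) / s)) =
      E (\<lambda>\<omega>. E (\<lambda>\<omega>'. f (Suc k) ((\<Sum>j<k + 1. if j < k then \<xi> (j + 1) \<omega> else \<xi> (k + 1) \<omega>') / s)))"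
      by simp
    moreover have "(\<Sum>j<k + 1. if j < k then \<xi> (j + 1) \<omega> else \<xi> (k + 1) \<omega>') / s = S \<omega> + \<xi> (Suc k) \<omega>' / s" for \<omega> \<omega>'
      by (simp add: S_eq add_divide_distrib)
    moreover have "(\<Sum>i=1..Suc k. \<xi> i \<omega>) / s = S \<omega> + \<xi> (Suc k) \<omega> / s" for \<omega>
      by (simp add: S_def add_divide_distrib)
    ultimately have "E (\<lambda>\<omega>. f (Suc k) ((\<Sum>i=1..Suc k. \<xi> i \<omega>) / s)) = E (\<lambda>\<omega>. \<Psi> (S \<omega>))"
      by (simp only: \<Psi>_def)
    moreover have "\<bar>E (\<lambda>\<omega>. \<Psi> (S \<omega>)) - E (\<lambda>\<omega>. f k (S \<omega>))\<bar> \<le> e (Suc k)"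
    proof (rule E_abs_diff_le[OF CbLip_comp_H[OF SH \<Psi>] CbLip_comp_H[OF SH f]])
      show "\<bar>\<Psi> (S \<omega>) - f k (S \<omega>)\<bar> \<le> e (Suc k)" for \<omega>
        using step[OF k(3), of "S \<omega>"] by (simp add: \<Psi>_def)
    qed
    moreover have "\<bar>E (\<lambda>\<omega>. f k (S \<omega>)) - f 0 0\<bar> \<le> (\<Sum>i=1..k. e i)"
      using Suc.IH[OF k(1)] by (simp add: S_def)
    ultimately show ?thesis by simp
  qed
qed simp

end

section \<open>Taylor remainder, step sizes and the total error\<close>

lemma sqrt_sqrt_power4: "0 \<le> t \<Longrightarrow> sqrt (sqrt t) ^ 4 = t"
proof -
  assume "0 \<le> t"
  have "sqrt (sqrt t) ^ 4 = (sqrt (sqrt t) ^ 2) ^ 2" by (simp flip: power_mult)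
  with \<open>0 \<le> t\<close> show ?thesis by simp
qed

text \<open>Interpolation with \<open>a = t^(1/4)\<close> and \<open>r = sqrt |z|\<close>. If
  \<open>r \<le> a\<close>, the Lipschitz bound applies and \<open>r^2 / a^4 \<le> r / a^3\<close>;
  otherwise the supremum bound applies, twice, and \<open>1 / a^2 \<le> r / a^3\<close>.\<close>

lemma taylor_bound:
  fixes f :: "real \<Rightarrow> real"
  assumes d1: "\<And>y. (f has_real_derivative f' y) (at y)" and d2: "\<And>y. (f' has_real_derivative f'' y) (at y)"
    and lip: "\<And>y. \<bar>f'' y - f'' x\<bar> \<le> K * \<bar>y - x\<bar> / t" and bdd: "\<And>y. \<bar>f'' y\<bar> \<le> K / sqrt t"
    and t: "0 < t" and K: "0 \<le> K"
  shows "\<bar>f (x + z) - (f x + f' x * z + f'' x / 2 * z\<^sup>2)\<bar> \<le> K / sqrt (sqrt t) ^ 3 * (z\<^sup>2 * sqrt \<bar>z\<bar>)"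
proof (cases "z = 0")
  case False
  define a where "a = sqrt (sqrt t)"
  have a: "0 < a" "a\<^sup>2 = sqrt t" "a ^ 4 = t"
    using t by (simp_all add: a_def sqrt_sqrt_power4)
  define r where "r = sqrt \<bar>z\<bar>"
  have r: "0 < r" "r * r = \<bar>z\<bar>" using False by (simp_all add: r_def)
  define diff where "diff m = (if m = 0 then f else if m = (1::nat) then f' else f'')" for m
  have "\<exists>s. (if x + z < x then x + z < s \<and> s < x else x < s \<and> s < x + z) \<and>
    f (x + z) = (\<Sum>m<2. (diff m x / fact m) * (x + z - x) ^ m) + (diff 2 s / fact 2) * (x + z - x)\<^sup>2"
  proof (rule Taylor[of 2 diff f "min x (x + z)" "max x (x + z)" x "x + z"])
    show "\<forall>m s. m < 2 \<and> min x (x + z) \<le> s \<and> s \<le> max x (x + z) \<longrightarrow> DERIV (diff m) s :> diff (Suc m) s"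
      using d1 d2 by (auto simp: diff_def less_2_cases_iff)
  qed (use False in \<open>auto simp: diff_def\<close>)
  then obtain s where s: "if x + z < x then x + z < s \<and> s < x else x < s \<and> s < x + z"
    "f (x + z) = (\<Sum>m<2. (diff m x / fact m) * (x + z - x) ^ m) + (diff 2 s / fact 2) * (x + z - x)\<^sup>2"
    by blast
  have sx: "\<bar>s - x\<bar> \<le> \<bar>z\<bar>" using s(1) by (auto split: if_splits)
  have tay: "f (x + z) - (f x + f' x * z + f'' x / 2 * z\<^sup>2) = (f'' s - f'' x) / 2 * z\<^sup>2"
    unfolding s(2) by (simp add: diff_def numeral_2_eq_2 field_simps)
  have "\<bar>f'' s - f'' x\<bar> \<le> 2 * (K / a ^ 3 * r)"
  proof (cases "r \<le> a")
    case True
    have "\<bar>f'' s - f'' x\<bar> \<le> K * \<bar>s - x\<bar> / t" by (rule lip)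
    also have "\<dots> \<le> K * (r * r) / t" using sx r K t by (intro divide_right_mono mult_left_mono) auto
    also have "\<dots> \<le> K * (a * r) / t" using True r K t by (intro divide_right_mono mult_left_mono mult_right_mono) auto
    also have "\<dots> = K / a ^ 3 * r" unfolding a(3)[symmetric] using a(1) by (simp add: field_simps eval_nat_numeral)
    also have "\<dots> \<le> 2 * (K / a ^ 3 * r)"
    proof -
      have "0 \<le> K / a ^ 3 * r" using K a r by simp
      then show ?thesis by linarith
    qed
    finally show ?thesis .
  next
    case False
    have "\<bar>f'' s - f'' x\<bar> \<le> 2 * (K / a\<^sup>2)" using bdd[of s] bdd[of x] unfolding a(2) by linarith
    also have "K / a\<^sup>2 = K / a ^ 3 * a" using a(1) by (simp add: field_simps eval_nat_numeral)
    also have "2 * (K / a ^ 3 * a) \<le> 2 * (K / a ^ 3 * r)" using False K a by (intro mult_left_mono) auto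
    finally show ?thesis .
  qed
  then have "\<bar>(f'' s - f'' x) / 2\<bar> \<le> K / a ^ 3 * r" by (simp add: abs_divide mult_ac)
  then have le: "\<bar>(f'' s - f'' x) / 2\<bar> * z\<^sup>2 \<le> K / a ^ 3 * r * z\<^sup>2"
    by (rule mult_right_mono) simp
  have "\<bar>(f'' s - f'' x) / 2 * z\<^sup>2\<bar> = \<bar>(f'' s - f'' x) / 2\<bar> * z\<^sup>2" by (simp add: abs_mult)
  also note le
  also have "K / a ^ 3 * r * z\<^sup>2 = K / a ^ 3 * (z\<^sup>2 * r)" by simp
  finally show ?thesis unfolding tay a_def r_def .
qed simp

text \<open>A discrete form of integrating \<open>t^(-3/4)\<close>. Factor
  \<open>\<delta> = b^4 - a^4\<close> by \<open>b - a\<close>; since \<open>b \<le> 2a\<close>, the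
  cofactor is at most \<open>(8 + 4 + 2 + 1) * a^3\<close>.\<close>

lemma quartic_step:
  assumes "0 < t" "0 \<le> \<delta>" "\<delta> \<le> t"
  shows "\<delta> / sqrt (sqrt t) ^ 3 \<le> 15 * (sqrt (sqrt (t + \<delta>)) - sqrt (sqrt t))"
proof -
  define a b where "a = sqrt (sqrt t)" "b = sqrt (sqrt (t + \<delta>))"
  have a: "0 < a" "a ^ 4 = t" and b: "b ^ 4 = t + \<delta>"
    using assms by (simp_all add: a_b_def sqrt_sqrt_power4)
  have ab: "a \<le> b" using assms by (simp add: a_b_def)
  have b0: "0 < b" using ab a by linarith
  have "b \<le> 2 * a"
  proof (rule power_le_imp_le_base)
    show "b ^ Suc 3 \<le> (2 * a) ^ Suc 3" using a b assms by (simp add: power_mult_distrib eval_nat_numeral)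
  qed (use a in simp)
  then have "b * b \<le> (2 * a) * (2 * a)" "b * b * b \<le> (2 * a) * (2 * a) * (2 * a)"
    using b0 by (intro mult_mono; simp)+
  moreover have "b * a * a \<le> (2 * a) * a * a" using \<open>b \<le> 2 * a\<close> a by (intro mult_right_mono) auto
  moreover have "b * b * a \<le> (2 * a) * (2 * a) * a" using \<open>b * b \<le> (2 * a) * (2 * a)\<close> a by (intro mult_right_mono) auto
  ultimately have le: "b * b * b + b * b * a + b * a * a + a * a * a \<le> 15 * (a * a * a)" by linarith
  have "\<delta> = (b - a) * (b * b * b + b * b * a + b * a * a + a * a * a)"
    using a(2) b by (simp add: eval_nat_numeral algebra_simps)
  also have "\<dots> \<le> (b - a) * (15 * (a * a * a))" using le ab by (intro mult_left_mono) auto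
  finally have "\<delta> \<le> 15 * (b - a) * a ^ 3" by (simp add: power3_eq_cube mult_ac)
  then show ?thesis using a unfolding a_b_def[symmetric] by (simp add: pos_divide_le_eq)
qed

lemma sum_telescope_pred: "(\<Sum>i=1..n. a (i - 1) - a i) = a 0 - (a n :: real)" for n :: nat
  by (induction n) auto

context sublinear_expectation_space
begin

text \<open>Origin of 398: a step costs \<open>13 * K * M\<close> times its weight, 1 for the Taylor
  remainder and 12 for the time expansion; the weights \<open>\<delta> i / a i ^ 3\<close> sum to at
  most 30; and the time shift is paid twice with \<open>4 * K * M\<close>.\<close>

lemma normal_approximation_estimate:
  fixes n :: nat and su sl mom :: "nat \<Rightarrow> real" and u p v :: "real \<Rightarrow> real \<Rightarrow> real"
  defines "m \<equiv> \<lambda>i. (su i + sl i) / 2"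
  defines "s \<equiv> sqrt (\<Sum>i=1..n. (m i)\<^sup>2)"
  assumes \<beta>: "1 \<le> \<beta>" and K: "0 < K" and \<phi>: "\<phi> \<in> CbLip"
    and reg: "G_heat_regular \<beta> K \<phi> b u p v"
    and n: "1 \<le> n" and ind: "indep_seq E n \<xi>"
    and var: "\<And>i. i \<in> {1..n} \<Longrightarrow> centered_variable \<Omega> H E (\<xi> i) (su i) (sl i) (mom i)"
    and sd: "\<And>i. i \<in> {1..n} \<Longrightarrow> sl i \<le> su i \<and> 0 < sl i \<and> su i / sl i = \<beta>"
    and M: "\<And>i. i \<in> {1..n} \<Longrightarrow> mom i / ((m i)\<^sup>2 * sqrt (m i)) * sqrt (m i / s) \<le> M"
  shows "\<bar>E (\<lambda>\<omega>. \<phi> ((\<Sum>i=1..n. \<xi> i \<omega>) / s)) - u 0 1\<bar> \<le> 398 * K * M"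
proof -
  note r = reg[unfolded G_heat_regular_def]
  have init: "u x 0 = \<phi> x" and bdd: "\<bar>u x t\<bar> \<le> b" and lip: "\<bar>u y t - u x t\<bar> \<le> \<bar>y - x\<bar>" for x y t
    using r by simp_all
  have time: "0 \<le> t \<Longrightarrow> 0 \<le> r \<Longrightarrow> \<bar>u x (t + r) - u x t\<bar> \<le> K * sqrt r"
    and ut: "0 < t \<Longrightarrow> 0 \<le> r \<Longrightarrow> \<bar>u x (t + r) - u x t - r * G \<beta> (v x t)\<bar> \<le> 3 * K * r * sqrt r / t" for x t r
    using r by simp_all
  have ux: "0 < t \<Longrightarrow> ((\<lambda>y. u y t) has_real_derivative p x t) (at x)"
    and uxx: "0 < t \<Longrightarrow> ((\<lambda>y. p y t) has_real_derivative v x t) (at x)"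
    and v_bdd: "0 < t \<Longrightarrow> \<bar>v x t\<bar> \<le> K / sqrt t"
    and v_lip: "0 < t \<Longrightarrow> \<bar>v y t - v x t\<bar> \<le> K * \<bar>y - x\<bar> / t" for x y t
    using r by simp_all
  have \<xi>: "\<xi> i \<in> H" if "i \<in> {1..n}" for i
    using centered_variable.X[OF var[OF that]] .
  have m: "0 < m i" "m i \<le> su i" "0 < su i" if "i \<in> {1..n}" for i
    using sd[OF that] by (auto simp: m_def)
  have sum_pos: "0 < (\<Sum>i=1..n. (m i)\<^sup>2)"
    by (rule sum_pos) (use n m in \<open>auto simp: less_le\<close>)
  then have s: "0 < s" "s\<^sup>2 = (\<Sum>i=1..n. (m i)\<^sup>2)" by (simp_all add: s_def)
  define \<delta> where "\<delta> i = (m i / s)\<^sup>2" for i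
  have \<delta>0: "0 \<le> \<delta> i" for i by (simp add: \<delta>_def)
  have sum1: "(\<Sum>i=1..n. \<delta> i) = 1"
    using s sum_pos by (simp add: \<delta>_def power_divide flip: sum_divide_distrib)
  have part: "(\<Sum>i=1..k. \<delta> i) \<le> 1" if "k \<le> n" for k
    unfolding sum1[symmetric] by (rule sum_mono2) (use that \<delta>0 in auto)
  have \<delta>1: "\<delta> i \<le> 1" if "i \<in> {1..n}" for i
    unfolding sum1[symmetric] by (rule member_le_sum) (use that \<delta>0 in auto)
  have root: "sqrt (sqrt (\<delta> i)) = sqrt (m i / s)" if "i \<in> {1..n}" for i
    using m[OF that] s by (simp add: \<delta>_def)
  \<comment> \<open>As \<open>m i \<le> su i\<close>, the moment ratio is at least 1/4, so
    \<open>4 * M\<close> dominates the fourth root of every step.\<close>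
  have rootM: "sqrt (sqrt (\<delta> i)) \<le> 4 * M" if i: "i \<in> {1..n}" for i
  proof -
    have "(m i)\<^sup>2 * sqrt (m i) \<le> (su i)\<^sup>2 * sqrt (su i)"
      using m[OF i] by (intro mult_mono power_mono) auto
    also have "\<dots> \<le> 4 * mom i" by (rule centered_variable.moment_lower_bound[OF var[OF i] m(3)[OF i]])
    finally have "1 \<le> 4 * (mom i / ((m i)\<^sup>2 * sqrt (m i)))" using m[OF i] by (simp add: field_simps)
    then have "1 * sqrt (m i / s) \<le> 4 * (mom i / ((m i)\<^sup>2 * sqrt (m i))) * sqrt (m i / s)"
      using m[OF i] s by (intro mult_right_mono) auto
    then show ?thesis using M[OF i] unfolding root[OF i] by linarith
  qed
  define \<eta> where "\<eta> = Max (\<delta> ` {1..n})"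
  have "\<eta> \<in> \<delta> ` {1..n}" unfolding \<eta>_def by (rule Max_in) (use n in auto)
  then obtain i0 where i0: "i0 \<in> {1..n}" "\<eta> = \<delta> i0" by blast
  have \<eta>: "\<delta> i \<le> \<eta>" if "i \<in> {1..n}" for i unfolding \<eta>_def using that by (intro Max_ge) auto
  have \<eta>0: "0 < \<eta>" using m[OF i0(1)] s by (simp add: i0(2) \<delta>_def)
  have \<eta>1: "\<eta> \<le> 1" using \<delta>1[OF i0(1)] by (simp add: i0(2))
  have \<eta>M: "sqrt \<eta> \<le> 4 * M"
  proof -
    have "sqrt \<eta> * sqrt \<eta> \<le> sqrt \<eta> * 1" using \<eta>1 \<eta>0 by (intro mult_left_mono) auto
    then have "\<eta> \<le> sqrt \<eta>" using \<eta>0 by simp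
    then have "sqrt \<eta> \<le> sqrt (sqrt \<eta>)" by (rule real_sqrt_le_mono)
    also have "\<dots> \<le> 4 * M" using rootM[OF i0(1)] unfolding i0(2) .
    finally show ?thesis .
  qed
  have M0: "0 \<le> M" using \<eta>M \<eta>0 real_sqrt_ge_zero[of \<eta>] by linarith
  \<comment> \<open>The time left after \<open>k\<close> steps, shifted by the largest step. Thus
    \<open>\<delta> i \<le> \<eta> \<le> t i\<close> holds for every \<open>i\<close>, also for the
    last one, whose unshifted time is 0.\<close>
  define t where "t k = \<eta> + (1 - (\<Sum>i=1..k. \<delta> i))" for k
  have t_ge: "\<eta> \<le> t k" if "k \<le> n" for k using part[OF that] by (simp add: t_def)
  have t0: "t 0 = 1 + \<eta>" and tn: "t n = \<eta>" using sum1 by (simp_all add: t_def)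
  have t_pred: "t (i - 1) = t i + \<delta> i" if "i \<in> {1..n}" for i
    using that by (cases i) (auto simp: t_def)
  define a where "a k = sqrt (sqrt (t k))" for k
  define f where "f k = (\<lambda>x. u x (t k))" for k
  define e where "e i = 13 * K * M * (\<delta> i / a i ^ 3)" for i
  have fC: "f k \<in> CbLip" for k
    by (rule CbLipI[of _ b 1]) (use bdd lip in \<open>auto simp: f_def abs_minus_commute\<close>)
  have step: "\<bar>E (\<lambda>\<omega>. f i (x + \<xi> i \<omega> / s)) - f (i - 1) x\<bar> \<le> e i" if i: "i \<in> {1..n}" for i x
  proof -
    interpret cv: centered_variable \<Omega> H E "\<xi> i" "su i" "sl i" "mom i" by (rule var[OF i])
    define T where "T = t i"
    have T: "0 < T" "\<delta> i \<le> T" using t_ge[of i] \<eta>0 \<eta>[OF i] i by (auto simp: T_def)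
    have a3: "0 < a i ^ 3" using T by (simp add: a_def T_def)
    have a4: "a i ^ 4 = T" using T by (simp add: a_def T_def[symmetric] sqrt_sqrt_power4)
    define V where "V = v x T"
    define K1 where "K1 = K / a i ^ 3 / (s\<^sup>2 * sqrt s)"
    have "\<bar>E (\<lambda>\<omega>. (\<lambda>y. f i (x + y / s)) (\<xi> i \<omega>)) -
        (u x T + (max (V / s\<^sup>2) 0 * (su i)\<^sup>2 - max (- (V / s\<^sup>2)) 0 * (sl i)\<^sup>2) / 2)\<bar> \<le> K1 * mom i"
    proof (rule cv.one_step[where B = "p x T / s"])
      show "(\<lambda>y. f i (x + y / s)) \<in> CbLip" by (rule CbLip_shift[OF fC])
      show "0 \<le> K1" using K a3 s(1) by (simp only: K1_def) (intro divide_nonneg_nonneg mult_nonneg_nonneg; simp)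
      fix y
      have "\<bar>u (x + y / s) T - (u x T + p x T * (y / s) + V / 2 * (y / s)\<^sup>2)\<bar>
          \<le> K / sqrt (sqrt T) ^ 3 * ((y / s)\<^sup>2 * sqrt \<bar>y / s\<bar>)"
        unfolding V_def by (rule taylor_bound[OF ux[OF T(1)] uxx[OF T(1)] v_lip[OF T(1)] v_bdd[OF T(1)] T(1)]) (use K in simp)
      also have "sqrt (sqrt T) = a i" by (simp add: a_def T_def)
      also have "K / a i ^ 3 * ((y / s)\<^sup>2 * sqrt \<bar>y / s\<bar>) = K1 * (y\<^sup>2 * sqrt \<bar>y\<bar>)"
        using s by (simp add: K1_def power_divide abs_divide real_sqrt_divide)
      finally show "\<bar>f i (x + y / s) - (u x T + p x T / s * y + V / s\<^sup>2 / 2 * y\<^sup>2)\<bar> \<le> K1 * (y\<^sup>2 * sqrt \<bar>y\<bar>)"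
        by (simp add: f_def T_def power_divide mult.commute mult.left_commute)
    qed
    \<comment> \<open>The ratio \<beta> and the mean \<open>m i\<close> determine both deviations of
      \<open>\<xi> i\<close>: divided by \<open>m i\<close> they are the ones that define
      \<open>G\<close>.\<close>
    moreover have "(max (V / s\<^sup>2) 0 * (su i)\<^sup>2 - max (- (V / s\<^sup>2)) 0 * (sl i)\<^sup>2) / 2 = \<delta> i * G \<beta> V"
    proof -
      have su: "su i = \<beta> * sl i" using sd[OF i] by (auto simp: divide_eq_eq)
      have b0: "1 + \<beta> \<noteq> 0" using \<beta> by linarith
      have sl': "sl i = 2 / (1 + \<beta>) * m i" using b0 by (simp add: m_def su field_simps)
      have su': "su i = 2 * \<beta> / (1 + \<beta>) * m i" unfolding su sl' by simp
      have mx: "max (c / s\<^sup>2) 0 = max c 0 / s\<^sup>2" for c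
        using s(1) by (auto simp: max_def divide_le_0_iff)
      have "(max (V / s\<^sup>2) 0 * (su i)\<^sup>2 - max (- (V / s\<^sup>2)) 0 * (sl i)\<^sup>2) / 2 =
          (max V 0 / s\<^sup>2 * (su i)\<^sup>2 - max (- V) 0 / s\<^sup>2 * (sl i)\<^sup>2) / 2"
        using mx[of V] mx[of "- V"] by simp
      also have "\<dots> = \<delta> i * G \<beta> V"
        unfolding su' sl' G_def \<delta>_def power_mult_distrib power_divide by (simp add: algebra_simps diff_divide_distrib)
      finally show ?thesis .
    qed
    moreover have "K1 * mom i \<le> K * M * (\<delta> i / a i ^ 3)"
    proof -
      have "mom i / (s\<^sup>2 * sqrt s) = (mom i / ((m i)\<^sup>2 * sqrt (m i)) * sqrt (m i / s)) * \<delta> i"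
        using m[OF i] s by (simp add: \<delta>_def real_sqrt_divide power_divide)
      also have "\<dots> \<le> M * \<delta> i" by (rule mult_right_mono[OF M[OF i] \<delta>0])
      finally have "(K / a i ^ 3) * (mom i / (s\<^sup>2 * sqrt s)) \<le> (K / a i ^ 3) * (M * \<delta> i)"
        using K a3 by (intro mult_left_mono) auto
      then show ?thesis by (simp add: K1_def mult_ac)
    qed
    \<comment> \<open>With \<open>c = \<delta>^(1/4)\<close>, one factor of
      \<open>sqrt \<delta> = c * c\<close> is bounded by \<open>4 * M\<close> and the other by
      \<open>a i\<close>, which weakens the singularity from \<open>1 / a^4\<close> to
      \<open>1 / a^3\<close>.\<close>
    moreover have "\<bar>u x (T + \<delta> i) - u x T - \<delta> i * G \<beta> V\<bar> \<le> 12 * K * M * (\<delta> i / a i ^ 3)"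
    proof -
      define c where "c = sqrt (sqrt (\<delta> i))"
      have a0: "0 < a i" using T by (simp add: a_def T_def)
      have c: "0 \<le> c" "c \<le> a i" "c \<le> 4 * M" "sqrt (\<delta> i) = c * c"
        using rootM[OF i] T(2) \<delta>0 by (simp_all add: c_def a_def T_def)
      have "\<bar>u x (T + \<delta> i) - u x T - \<delta> i * G \<beta> V\<bar> \<le> 3 * K * \<delta> i * sqrt (\<delta> i) / T"
        unfolding V_def by (rule ut[OF T(1) \<delta>0])
      also have "\<dots> = 3 * K * \<delta> i * ((c * c) / a i ^ 4)" unfolding c(4) a4 by simp
      also have "\<dots> \<le> 3 * K * \<delta> i * ((4 * M * a i) / a i ^ 4)"
        using c M0 a0 K \<delta>0 by (intro mult_left_mono divide_right_mono mult_mono) auto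
      also have "(4 * M * a i) / a i ^ 4 = 4 * M / a i ^ 3" using a0 by (simp add: eval_nat_numeral)
      finally show ?thesis by (simp add: mult_ac)
    qed
    moreover have "f (i - 1) x = u x (T + \<delta> i)" by (simp only: f_def t_pred[OF i] T_def)
    moreover have "e i = K * M * (\<delta> i / a i ^ 3) + 12 * K * M * (\<delta> i / a i ^ 3)"
      by (simp add: e_def algebra_simps)
    ultimately show ?thesis by simp
  qed
  have "(\<Sum>i=1..n. \<delta> i / a i ^ 3) \<le> (\<Sum>i=1..n. 15 * (a (i - 1) - a i))"
  proof (rule sum_mono)
    fix i assume i: "i \<in> {1..n}"
    have "\<delta> i / sqrt (sqrt (t i)) ^ 3 \<le> 15 * (sqrt (sqrt (t i + \<delta> i)) - sqrt (sqrt (t i)))"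
      by (rule quartic_step) (use t_ge[of i] \<eta>0 \<eta>[OF i] i \<delta>0[of i] in auto)
    then show "\<delta> i / a i ^ 3 \<le> 15 * (a (i - 1) - a i)" by (simp only: a_def t_pred[OF i])
  qed
  also have "\<dots> = 15 * (a 0 - a n)" by (simp only: sum_distrib_left[symmetric] sum_telescope_pred)
  also have "\<dots> \<le> 30"
  proof -
    have "t 0 \<le> 16" using \<eta>1 by (simp add: t0)
    then have "sqrt (sqrt (t 0)) \<le> sqrt (sqrt 16)" by (intro real_sqrt_le_mono)
    also have "sqrt (sqrt (16 :: real)) = 2" by (simp add: real_sqrt_unique)
    finally have "sqrt (sqrt (t 0)) \<le> 2" .
    then have "a 0 \<le> 2" by (simp add: a_def)
    moreover have "0 \<le> a n" using \<eta>0 by (simp add: a_def tn)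
    ultimately show ?thesis by simp
  qed
  finally have sum30: "(\<Sum>i=1..n. \<delta> i / a i ^ 3) \<le> 30" .
  have "\<bar>E (\<lambda>\<omega>. f n ((\<Sum>i=1..n. \<xi> i \<omega>) / s)) - f 0 0\<bar> \<le> (\<Sum>i=1..n. e i)"
    by (rule lindeberg_telescope[OF \<xi> ind fC step]) (use n in auto)
  also have "\<dots> = 13 * K * M * (\<Sum>i=1..n. \<delta> i / a i ^ 3)" by (simp add: e_def sum_distrib_left)
  also have "\<dots> \<le> 13 * K * M * 30" using K M0 by (intro mult_left_mono[OF sum30]) auto
  finally have 1: "\<bar>E (\<lambda>\<omega>. f n ((\<Sum>i=1..n. \<xi> i \<omega>) / s)) - f 0 0\<bar> \<le> 390 * K * M" by simp
  have KM: "K * sqrt \<eta> \<le> 4 * K * M" using mult_left_mono[OF \<eta>M, of K] K by simp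
  have W: "(\<lambda>\<omega>. (\<Sum>i=1..n. \<xi> i \<omega>) / s) \<in> H"
    using H_scale[OF H_sum[of "{1..n}" \<xi>], of "1 / s"] \<xi> by simp
  \<comment> \<open>The two prices of the shift: here \<phi> is exchanged for the solution at time
    \<eta>, and below the time \<open>1 + \<eta>\<close> for 1.\<close>
  have 2: "\<bar>E (\<lambda>\<omega>. \<phi> ((\<Sum>i=1..n. \<xi> i \<omega>) / s)) - E (\<lambda>\<omega>. f n ((\<Sum>i=1..n. \<xi> i \<omega>) / s))\<bar> \<le> K * sqrt \<eta>"
  proof (rule E_abs_diff_le[OF CbLip_comp_H[OF W \<phi>] CbLip_comp_H[OF W fC]])
    fix \<omega>
    show "\<bar>\<phi> ((\<Sum>i=1..n. \<xi> i \<omega>) / s) - f n ((\<Sum>i=1..n. \<xi> i \<omega>) / s)\<bar> \<le> K * sqrt \<eta>"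
      using time[of 0 \<eta> "(\<Sum>i=1..n. \<xi> i \<omega>) / s"] \<eta>0 by (simp add: init f_def tn abs_minus_commute)
  qed
  have 3: "\<bar>f 0 0 - u 0 1\<bar> \<le> K * sqrt \<eta>" using time[of 1 \<eta> 0] \<eta>0 by (simp add: f_def t0)
  from 1 2 3 KM show ?thesis by linarith
qed

end

theorem ex_normal_approx_bound:
  assumes \<beta>: "1 \<le> \<beta>"
  shows "\<exists>C>0. normal_approx_bound TYPE('w) \<beta> (1 / 2) C"
proof -
  obtain K where K: "0 < K" and reg: "\<forall>\<phi>. \<phi> \<in> CbLip \<longrightarrow> 1-lipschitz_on UNIV \<phi> \<longrightarrow>
      (\<exists>b u p v. G_normal \<beta> \<phi> = u 0 1 \<and> G_heat_regular \<beta> K \<phi> b u p v)"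
    using G_heat_regularity[OF \<beta>] by blast
  have "normal_approx_bound TYPE('w) \<beta> (1 / 2) (398 * K)"
    unfolding normal_approx_bound_def
  proof (intro allI impI)
    fix \<Omega> :: "'w set" and H E and n :: nat and \<xi> and su sl :: "nat \<Rightarrow> real"
    assume "sublinear_expectation_space \<Omega> H E" and n: "1 \<le> n" and \<xi>: "\<forall>i\<in>{1..n}. \<xi> i \<in> H"
      and ind: "indep_seq E n \<xi>"
      and mom: "\<forall>i\<in>{1..n}. upper_exp E (\<xi> i) (\<lambda>x. x) = 0 \<and> upper_exp E (\<xi> i) (\<lambda>x. - x) = 0 \<and>
           upper_exp E (\<xi> i) (\<lambda>x. x\<^sup>2) = ereal ((su i)\<^sup>2) \<and>
           - upper_exp E (\<xi> i) (\<lambda>x. - x\<^sup>2) = ereal ((sl i)\<^sup>2) \<and>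
           sl i \<le> su i \<and> 0 < sl i \<and> su i / sl i = \<beta>"
    interpret sublinear_expectation_space \<Omega> H E by fact
    define m where "m i = (su i + sl i) / 2" for i
    define s where "s = sqrt (\<Sum>i=1..n. (m i)\<^sup>2)"
    define R where "R i = upper_exp E (\<xi> i) (\<lambda>x. \<bar>x\<bar> powr (2 + 1 / 2)) / ereal (m i powr (2 + 1 / 2))
      * ereal ((m i / s) powr (1 / 2))" for i
    define Q where "Q = (SUP i\<in>{1..n}. R i)"
    have m: "0 < m i" if "i \<in> {1..n}" for i
    proof -
      have "sl i \<le> su i" "0 < sl i" using mom that by blast+
      then have "0 < su i + sl i" by linarith
      then show ?thesis by (simp add: m_def)
    qed
    have "0 < (\<Sum>i=1..n. (m i)\<^sup>2)" by (rule sum_pos) (use n m in \<open>auto simp: less_le\<close>)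
    then have s: "0 < s" by (simp add: s_def)
    have nonneg: "0 \<le> upper_exp E (\<xi> i) (\<lambda>x. \<bar>x\<bar> powr (2 + 1 / 2))" if i: "i \<in> {1..n}" for i
    proof -
      obtain \<mu> where \<mu>: "\<mu> \<in> rep_set (\<xi> i)"
        using represents_rep_set[of "\<xi> i"] \<xi> i unfolding represents_def by blast
      have "(\<integral>\<^sup>+x. ennreal (- (\<bar>x\<bar> powr (2 + 1 / 2))) \<partial>\<mu>) = 0" by (simp add: ennreal_neg)
      then have "0 \<le> ext_integral \<mu> (\<lambda>x. \<bar>x\<bar> powr (2 + 1 / 2))"
        by (simp add: ext_integral_def zero_ennreal.rep_eq)
      also have "\<dots> \<le> upper_exp E (\<xi> i) (\<lambda>x. \<bar>x\<bar> powr (2 + 1 / 2))" by (rule ext_integral_le_upper_exp[OF \<mu>])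
      finally show ?thesis .
    qed
    have R_nonneg: "0 \<le> R i" if i: "i \<in> {1..n}" for i
      unfolding R_def using nonneg[OF i] m[OF i]
      by (intro ereal_0_le_mult zero_le_divide_ereal) (auto simp: less_imp_le)
    have "(SUP \<phi>\<in>{\<phi> \<in> CbLip. 1-lipschitz_on UNIV \<phi>}.
        ereal \<bar>E (\<lambda>\<omega>. \<phi> ((\<Sum>i=1..n. \<xi> i \<omega>) / s)) - G_normal \<beta> \<phi>\<bar>) \<le> ereal (398 * K) * Q"
    proof (rule SUP_least)
      fix \<phi> assume "\<phi> \<in> {\<phi> \<in> CbLip. 1-lipschitz_on UNIV \<phi>}"
      then have \<phi>: "\<phi> \<in> CbLip" "1-lipschitz_on UNIV \<phi>" by auto
      have RQ: "R i \<le> Q" if "i \<in> {1..n}" for i unfolding Q_def by (rule SUP_upper[OF that])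
      have Q0: "0 \<le> Q" using RQ[of 1] R_nonneg[of 1] n by (auto intro: order_trans)
      show "ereal \<bar>E (\<lambda>\<omega>. \<phi> ((\<Sum>i=1..n. \<xi> i \<omega>) / s)) - G_normal \<beta> \<phi>\<bar> \<le> ereal (398 * K) * Q"
      \<comment> \<open>If the supremum is infinite, the claim is trivial; if it is finite, all
        moments involved are finite and the real estimate applies.\<close>
      proof (cases Q)
        case PInf
        then show ?thesis using K by simp
      next
        case MInf
        then show ?thesis using Q0 by simp
      next
        case (real M)
        define mom' where "mom' i = real_of_ereal (upper_exp E (\<xi> i) (\<lambda>x. \<bar>x\<bar> powr (2 + 1 / 2)))" for i
        have fin: "upper_exp E (\<xi> i) (\<lambda>x. \<bar>x\<bar> powr (2 + 1 / 2)) = ereal (mom' i)" if i: "i \<in> {1..n}" for i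
        proof -
          have "upper_exp E (\<xi> i) (\<lambda>x. \<bar>x\<bar> powr (2 + 1 / 2)) \<noteq> \<infinity>"
          proof
            assume "upper_exp E (\<xi> i) (\<lambda>x. \<bar>x\<bar> powr (2 + 1 / 2)) = \<infinity>"
            then have "R i = \<infinity>" using m[OF i] s by (simp add: R_def)
            with RQ[OF i] real show False by simp
          qed
          then show ?thesis unfolding mom'_def using nonneg[OF i]
            by (cases "upper_exp E (\<xi> i) (\<lambda>x. \<bar>x\<bar> powr (2 + 1 / 2))") auto
        qed
        have Mle: "mom' i / ((m i)\<^sup>2 * sqrt (m i)) * sqrt (m i / s) \<le> M" if i: "i \<in> {1..n}" for i
        proof -
          have "m i powr (2 + 1 / 2) = (m i)\<^sup>2 * sqrt (m i)" using powr_five_halves[of "m i"] m[OF i] by simp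
          moreover have "(m i / s) powr (1 / 2) = sqrt (m i / s)" using m[OF i] s by (simp add: powr_half_sqrt)
          moreover have "R i \<le> ereal M" using RQ[OF i] real by simp
          ultimately show ?thesis using m[OF i] unfolding R_def fin[OF i] by simp
        qed
        obtain b u p v where u: "G_normal \<beta> \<phi> = u 0 1" "G_heat_regular \<beta> K \<phi> b u p v"
          using reg \<phi> by blast
        have var: "centered_variable \<Omega> H E (\<xi> i) (su i) (sl i) (mom' i)" if i: "i \<in> {1..n}" for i
          by (intro centered_variable.intro centered_variable_axioms.intro sublinear_expectation_space_axioms)
            (use mom \<xi> i fin[OF i] in auto)
        have "\<bar>E (\<lambda>\<omega>. \<phi> ((\<Sum>i=1..n. \<xi> i \<omega>) / s)) - u 0 1\<bar> \<le> 398 * K * M"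
          unfolding s_def m_def
          by (rule normal_approximation_estimate[OF \<beta> K \<phi>(1) u(2) n ind var])
            (use mom Mle in \<open>auto simp: s_def m_def\<close>)
        then show ?thesis by (simp add: u(1) real)
      qed
    qed
    then show "let m = \<lambda>i. (su i + sl i) / 2; s = sqrt (\<Sum>i=1..n. (m i)\<^sup>2); W = \<lambda>\<omega>. \<Sum>i=1..n. \<xi> i \<omega>
      in (SUP \<phi>\<in>{\<phi> \<in> CbLip. 1-lipschitz_on UNIV \<phi>}. ereal \<bar>E (\<lambda>\<omega>. \<phi> (W \<omega> / s)) - G_normal \<beta> \<phi>\<bar>)
        \<le> ereal (398 * K) * (SUP i\<in>{1..n}. upper_exp E (\<xi> i) (\<lambda>x. \<bar>x\<bar> powr (2 + 1 / 2)) /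
            ereal (m i powr (2 + 1 / 2)) * ereal ((m i / s) powr (1 / 2)))"
      unfolding Let_def Q_def R_def s_def m_def .
  qed
  with K show ?thesis by (intro exI[of _ "398 * K"]) simp
qed

section \<open>Independence of the type of sample points\<close>

context sublinear_expectation_space
begin

text \<open>The variables on the target are those whose composition with \<open>T\<close> lies in
  \<open>H\<close>, so each axiom is the original one for compositions.\<close>

lemma push_forward:
  fixes T :: "'w \<Rightarrow> 'v"
  shows "sublinear_expectation_space (T ` \<Omega>) {Y. (\<lambda>\<omega>. Y (T \<omega>)) \<in> H} (\<lambda>Y. E (\<lambda>\<omega>. Y (T \<omega>)))"
proof
  fix m and Xs :: "nat \<Rightarrow> 'v \<Rightarrow> real" and \<phi>
  assume "\<And>i. i < m \<Longrightarrow> Xs i \<in> {Y. (\<lambda>\<omega>. Y (T \<omega>)) \<in> H}" "\<phi> \<in> CbLip_n m"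
  then show "(\<lambda>\<omega>. \<phi> (\<lambda>i. Xs i \<omega>)) \<in> {Y. (\<lambda>\<omega>. Y (T \<omega>)) \<in> H}"
    using H_CbLip[of m "\<lambda>i \<omega>. Xs i (T \<omega>)" \<phi>] by simp
next
  fix X :: "'v \<Rightarrow> real" and f
  assume "X \<in> {Y. (\<lambda>\<omega>. Y (T \<omega>)) \<in> H}" "\<And>k. f k \<in> CbLip" "\<And>x. decseq (\<lambda>k. f k x)" "\<And>x. (\<lambda>k. f k x) \<longlonglongrightarrow> 0"
  then show "decseq (\<lambda>k. E (\<lambda>\<omega>. f k (X (T \<omega>)))) \<and> (\<lambda>k. E (\<lambda>\<omega>. f k (X (T \<omega>)))) \<longlonglongrightarrow> 0"
    using E5[of "\<lambda>\<omega>. X (T \<omega>)" f] by simp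
qed (use H_zero H_add H_scale E1 E2 E3 E4 in auto)

end

lemma upper_exp_push_forward: "upper_exp (\<lambda>Y. E (\<lambda>\<omega>. Y (T \<omega>))) X \<psi> = upper_exp E (\<lambda>\<omega>. X (T \<omega>)) \<psi>"
  by (simp add: upper_exp_def represents_def)

lemma indep_seq_push_forward:
  "indep_seq (\<lambda>Y. E (\<lambda>\<omega>. Y (T \<omega>))) n X \<longleftrightarrow> indep_seq E n (\<lambda>i \<omega>. X i (T \<omega>))"
  by (simp add: indep_seq_def indep_from_def)

text \<open>Only compositions with the sequence of variables are evaluated, so the coordinates on
  \<open>nat \<Rightarrow> real\<close> can take their place. Both sides of the bound keep their
  values, and hence the constants carry over.\<close>

lemma normal_approx_bound_transfer:
  assumes "normal_approx_bound TYPE(nat \<Rightarrow> real) \<beta> \<alpha> C"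
  shows "normal_approx_bound TYPE('w) \<beta> \<alpha> C"
  unfolding normal_approx_bound_def
proof (intro allI impI)
  fix \<Omega> :: "'w set" and H E and n :: nat and \<xi> and su sl :: "nat \<Rightarrow> real"
  assume space: "sublinear_expectation_space \<Omega> H E" and n: "1 \<le> n" and \<xi>: "\<forall>i\<in>{1..n}. \<xi> i \<in> H"
    and ind: "indep_seq E n \<xi>"
    and mom: "\<forall>i\<in>{1..n}. upper_exp E (\<xi> i) (\<lambda>x. x) = 0 \<and> upper_exp E (\<xi> i) (\<lambda>x. - x) = 0 \<and>
         upper_exp E (\<xi> i) (\<lambda>x. x\<^sup>2) = ereal ((su i)\<^sup>2) \<and>
         - upper_exp E (\<xi> i) (\<lambda>x. - x\<^sup>2) = ereal ((sl i)\<^sup>2) \<and>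
         sl i \<le> su i \<and> 0 < sl i \<and> su i / sl i = \<beta>"
  define T where "T \<omega> = (\<lambda>i. \<xi> i \<omega>)" for \<omega>
  define X where "X i = (\<lambda>v :: nat \<Rightarrow> real. v i)" for i
  have X: "(\<lambda>\<omega>. X i (T \<omega>)) = \<xi> i" for i by (simp add: X_def T_def)
  have XT: "X i (T \<omega>) = \<xi> i \<omega>" for i \<omega> by (simp add: X_def T_def)
  have X2: "(\<lambda>i \<omega>. X i (T \<omega>)) = \<xi>" by (simp add: X)
  note b = assms[unfolded normal_approx_bound_def, rule_format,
      OF sublinear_expectation_space.push_forward[OF space, of T] n, of X su sl,
      unfolded Let_def indep_seq_push_forward X2 upper_exp_push_forward X XT]
  show "let m = \<lambda>i. (su i + sl i) / 2; s = sqrt (\<Sum>i=1..n. (m i)\<^sup>2); W = \<lambda>\<omega>. \<Sum>i=1..n. \<xi> i \<omega>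
      in (SUP \<phi>\<in>{\<phi> \<in> CbLip. 1-lipschitz_on UNIV \<phi>}. ereal \<bar>E (\<lambda>\<omega>. \<phi> (W \<omega> / s)) - G_normal \<beta> \<phi>\<bar>)
        \<le> ereal C * (SUP i\<in>{1..n}. upper_exp E (\<xi> i) (\<lambda>x. \<bar>x\<bar> powr (2 + \<alpha>)) /
            ereal (m i powr (2 + \<alpha>)) * ereal ((m i / s) powr \<alpha>))"
    unfolding Let_def by (rule b) (use \<xi> ind mom X in auto)
qed

theorem theorem5p1:
  fixes \<beta> :: real
  assumes "1 \<le> \<beta>"
  shows "(\<exists>\<alpha> C. 0 < \<alpha> \<and> \<alpha> < 1 \<and> 0 < C \<and> normal_approx_bound TYPE(nat \<Rightarrow> real) \<beta> \<alpha> C) \<and>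
    (\<forall>\<alpha> C. normal_approx_bound TYPE(nat \<Rightarrow> real) \<beta> \<alpha> C \<longrightarrow> normal_approx_bound TYPE('w) \<beta> \<alpha> C)"
proof
  obtain C where "0 < C" "normal_approx_bound TYPE(nat \<Rightarrow> real) \<beta> (1 / 2) C"
    using ex_normal_approx_bound[OF assms] by blast
  then show "\<exists>\<alpha> C. 0 < \<alpha> \<and> \<alpha> < 1 \<and> 0 < C \<and> normal_approx_bound TYPE(nat \<Rightarrow> real) \<beta> \<alpha> C"
    by (intro exI[of _ "1 / 2"] exI[of _ C]) simp
  show "\<forall>\<alpha> C. normal_approx_bound TYPE(nat \<Rightarrow> real) \<beta> \<alpha> C \<longrightarrow> normal_approx_bound TYPE('w) \<beta> \<alpha> C"
    using normal_approx_bound_transfer by blast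
qed

end
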